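(* Let $M_3$ be the McCool group of rank $3$ and let $\mathrm{gr}(M_3)=\bigoplus_{c\ge 1}\gamma_c(M_3)/\gamma_{c+1}(M_3)$ be its associated graded Lie algebra over $\mathbb{Z}$. Then: (1) $\mathrm{gr}(M_3)$ is a torsion-free $\mathbb{Z}$-module. In particular, $\mathrm{gr}(M_3)\cong L/J$ as Lie algebras over $\mathbb{Z}$, where $L$ is a free Lie algebra over $\mathbb{Z}$ of rank $6$ and $J$ is an ideal of $L$ which is a free Lie algebra. (2) $M_3$ is residually nilpotent and each quotient $\gamma_c(M_3)/\gamma_{c+1}(M_3)$, $c\ge 1$, is torsion-free. That is, $M_3$ is a Magnus group.
   Context: All Lie algebras are over $\mathbb{Z}$. For a group $G$, $(a,b)=a^{-1}b^{-1}ab$, and $\gamma_c(G)$ is the $c$-th term of the lower central series ($\gamma_1(G)=G$). The associated graded Lie algebra of $G$ is $\mathrm{gr}(G)=\bigoplus_{c\ge1}\gamma_c(G)/\gamma_{c+1}(G)$ with bracket $[a\gamma_{c+1}(G),b\gamma_{d+1}(G)]=(a,b)\gamma_{c+d+1}(G)$ for $a\in\gamma_c(G)$, $b\in\gamma_d(G)$, extended linearly. $G$ is residually nilpotent if $\bigcap_{c\ge1}\gamma_c(G)=\{1\}$. A Magnus group is a residually nilpotent group all of whose lower central quotients $\gamma_c(G)/\gamma_{c+1}(G)$ are torsion-free. Let $F_3$ be a free group with free generators $g_1,g_2,g_3$. For $i\ne j$ in $\{1,2,3\}$ let $\chi_{ij}\in\mathrm{Aut}(F_3)$ be the automorphism with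 $g_i\mapsto g_i(g_i,g_j)=g_j^{-1}g_ig_j$ fixing the other generators. The McCool group (basis-conjugating automorphism group) $M_3$ is the subgroup of $\mathrm{Aut}(F_3)$ generated by all $\chi_{ij}$, $i\neq j$. *)

theory Defs
  imports "HOL-Algebra.Algebra"
begin

section \<open>Lower central series, torsion, Magnus groups\<close>

definition commutator :: "('a, 'm) monoid_scheme \<Rightarrow> 'a \<Rightarrow> 'a \<Rightarrow> 'a" where
  "commutator G a b = inv\<^bsub>G\<^esub> a \<otimes>\<^bsub>G\<^esub> inv\<^bsub>G\<^esub> b \<otimes>\<^bsub>G\<^esub> a \<otimes>\<^bsub>G\<^esub> b"

text \<open>The series is indexed from 1; the value at 0 is junk and is never used.\<close>

fun lower_central :: "('a, 'm) monoid_scheme \<Rightarrow> nat \<Rightarrow> 'a set" where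
  "lower_central G 0 = carrier G"
| "lower_central G (Suc 0) = carrier G"
| "lower_central G (Suc (Suc c)) =
     generate G {commutator G a b | a b. a \<in> lower_central G (Suc c) \<and> b \<in> carrier G}"

definition lower_central_quotient :: "('a, 'm) monoid_scheme \<Rightarrow> nat \<Rightarrow> 'a set monoid" where
  "lower_central_quotient G c = (G\<lparr>carrier := lower_central G c\<rparr>) Mod lower_central G (Suc c)"

definition torsion_free :: "('a, 'm) monoid_scheme \<Rightarrow> bool" where
  "torsion_free G \<longleftrightarrow>
     (\<forall>x\<in>carrier G. \<forall>n::nat. n > 0 \<longrightarrow> x [^]\<^bsub>G\<^esub> n = \<one>\<^bsub>G\<^esub> \<longrightarrow> x = \<one>\<^bsub>G\<^esub>)"

definition residually_nilpotent :: "('a, 'm) monoid_scheme \<Rightarrow> bool" where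
  "residually_nilpotent G \<longleftrightarrow> (\<Inter>c\<in>{1..}. lower_central G c) = {\<one>\<^bsub>G\<^esub>}"

definition magnus_group :: "('a, 'm) monoid_scheme \<Rightarrow> bool" where
  "magnus_group G \<longleftrightarrow>
     group G \<and> residually_nilpotent G \<and> (\<forall>c\<ge>1. torsion_free (lower_central_quotient G c))"


section \<open>Lie algebras over the integers\<close>

text \<open>
  The underlying \<open>\<int>\<close>-module is an abelian group, written multiplicatively so that
  \<^const>\<open>sum_group\<close>, \<^const>\<open>FactGroup\<close>, \<^const>\<open>hom\<close> and \<^const>\<open>iso\<close> apply to it directly; the
  scalar multiple of \<open>x\<close> by an integer \<open>k\<close> is \<open>x [^] k\<close>, and every group homomorphism is
  \<open>\<int>\<close>-linear.
\<close>

record 'a lie_ring = "'a monoid" +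
  bracket :: "'a \<Rightarrow> 'a \<Rightarrow> 'a"

locale lie_algebra = comm_group L for L :: "('a, 'm) lie_ring_scheme" (structure) +
  assumes bracket_closed [simp]:
      "\<lbrakk>x \<in> carrier L; y \<in> carrier L\<rbrakk> \<Longrightarrow> bracket L x y \<in> carrier L"
    and bracket_left:
      "\<lbrakk>x \<in> carrier L; y \<in> carrier L; z \<in> carrier L\<rbrakk>
       \<Longrightarrow> bracket L (x \<otimes> y) z = bracket L x z \<otimes> bracket L y z"
    and bracket_right:
      "\<lbrakk>x \<in> carrier L; y \<in> carrier L; z \<in> carrier L\<rbrakk>
       \<Longrightarrow> bracket L x (y \<otimes> z) = bracket L x y \<otimes> bracket L x z"
    and bracket_alt: "x \<in> carrier L \<Longrightarrow> bracket L x x = \<one>"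
    and jacobi:
      "\<lbrakk>x \<in> carrier L; y \<in> carrier L; z \<in> carrier L\<rbrakk>
       \<Longrightarrow> bracket L x (bracket L y z) \<otimes> bracket L y (bracket L z x)
           \<otimes> bracket L z (bracket L x y) = \<one>"

definition lie_hom ::
  "('a, 'm) lie_ring_scheme \<Rightarrow> ('b, 'n) lie_ring_scheme \<Rightarrow> ('a \<Rightarrow> 'b) set" where
  "lie_hom L M = {\<phi> \<in> hom L M.
     \<forall>x\<in>carrier L. \<forall>y\<in>carrier L. \<phi> (bracket L x y) = bracket M (\<phi> x) (\<phi> y)}"

definition lie_isomorphic ::
  "('a, 'm) lie_ring_scheme \<Rightarrow> ('b, 'n) lie_ring_scheme \<Rightarrow> bool" where
  "lie_isomorphic L M \<longleftrightarrow> (\<exists>\<phi>\<in>lie_hom L M. bij_betw \<phi> (carrier L) (carrier M))"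

text \<open>By antisymmetry a one-sided ideal is two-sided.\<close>

definition lie_ideal :: "'a set \<Rightarrow> ('a, 'm) lie_ring_scheme \<Rightarrow> bool" where
  "lie_ideal J L \<longleftrightarrow> subgroup J L \<and> (\<forall>x\<in>carrier L. \<forall>y\<in>J. bracket L x y \<in> J)"

definition lie_quotient :: "('a, 'm) lie_ring_scheme \<Rightarrow> 'a set \<Rightarrow> 'a set lie_ring" where
  "lie_quotient L J =
     \<lparr>carrier = carrier (L Mod J), monoid.mult = monoid.mult (L Mod J), one = one (L Mod J),
      bracket = (\<lambda>A B. \<Union>a\<in>A. \<Union>b\<in>B. J #>\<^bsub>L\<^esub> bracket L a b)\<rparr>"


section \<open>The associated graded Lie algebra of a group\<close>

text \<open>
  The bracket of two homogeneous elements; it takes values in the quotient of degree \<open>c + d\<close>.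
  The union is over all representatives and all its members coincide.
\<close>

definition gr_bracket ::
  "('a, 'm) monoid_scheme \<Rightarrow> nat \<Rightarrow> nat \<Rightarrow> 'a set \<Rightarrow> 'a set \<Rightarrow> 'a set" where
  "gr_bracket G c d A B =
     (\<Union>a\<in>A. \<Union>b\<in>B. lower_central G (Suc (c + d)) #>\<^bsub>G\<^esub> commutator G a b)"

definition associated_graded :: "('a, 'm) monoid_scheme \<Rightarrow> (nat \<Rightarrow> 'a set) lie_ring" where
  "associated_graded G =
     (let S = sum_group {1..} (lower_central_quotient G) in
      \<lparr>carrier = carrier S, monoid.mult = monoid.mult S, one = one S,
       bracket = (\<lambda>x y. \<lambda>e\<in>{1..}.
         finprod (lower_central_quotient G e)
           (\<lambda>c. gr_bracket G c (e - c) (x c) (y (e - c))) {1..<e})\<rparr>)"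


section \<open>Free Lie algebras\<close>

datatype 'x lie_term =
    Gen 'x
  | Zero
  | Plus "'x lie_term" "'x lie_term"
  | Neg "'x lie_term"
  | Br "'x lie_term" "'x lie_term"

inductive lie_cong :: "'x lie_term \<Rightarrow> 'x lie_term \<Rightarrow> bool" where
  lie_cong_refl: "lie_cong s s"
| lie_cong_sym: "lie_cong s t \<Longrightarrow> lie_cong t s"
| lie_cong_trans: "lie_cong s t \<Longrightarrow> lie_cong t u \<Longrightarrow> lie_cong s u"
| lie_cong_Plus: "lie_cong s s' \<Longrightarrow> lie_cong t t' \<Longrightarrow> lie_cong (Plus s t) (Plus s' t')"
| lie_cong_Neg: "lie_cong s s' \<Longrightarrow> lie_cong (Neg s) (Neg s')"
| lie_cong_Br: "lie_cong s s' \<Longrightarrow> lie_cong t t' \<Longrightarrow> lie_cong (Br s t) (Br s' t')"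
| lie_cong_Plus_assoc: "lie_cong (Plus (Plus s t) u) (Plus s (Plus t u))"
| lie_cong_Plus_comm: "lie_cong (Plus s t) (Plus t s)"
| lie_cong_Plus_Zero: "lie_cong (Plus Zero s) s"
| lie_cong_Plus_Neg: "lie_cong (Plus (Neg s) s) Zero"
| lie_cong_Br_left: "lie_cong (Br (Plus s t) u) (Plus (Br s u) (Br t u))"
| lie_cong_Br_right: "lie_cong (Br s (Plus t u)) (Plus (Br s t) (Br s u))"
| lie_cong_Br_alt: "lie_cong (Br s s) Zero"
| lie_cong_Jacobi: "lie_cong (Plus (Plus (Br s (Br t u)) (Br t (Br u s))) (Br u (Br s t))) Zero"

quotient_type 'x flie = "'x lie_term" / lie_cong
  by (rule equivpI) (auto intro!: reflpI sympI transpI intro: lie_cong.intros)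

lift_definition fl_gen :: "'x \<Rightarrow> 'x flie" is Gen .
lift_definition fl_zero :: "'x flie" is Zero .
lift_definition fl_plus :: "'x flie \<Rightarrow> 'x flie \<Rightarrow> 'x flie" is Plus by (rule lie_cong_Plus)
lift_definition fl_neg :: "'x flie \<Rightarrow> 'x flie" is Neg by (rule lie_cong_Neg)
lift_definition fl_br :: "'x flie \<Rightarrow> 'x flie \<Rightarrow> 'x flie" is Br by (rule lie_cong_Br)

definition free_lie :: "'x set \<Rightarrow> 'x flie lie_ring" where
  "free_lie S = \<lparr>carrier = abs_flie ` {t. set_lie_term t \<subseteq> S},
                 monoid.mult = fl_plus, one = fl_zero, bracket = fl_br\<rparr>"

lemma carrier_free_lie: "carrier (free_lie S) = abs_flie ` {t. set_lie_term t \<subseteq> S}"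
  and mult_free_lie: "monoid.mult (free_lie S) = fl_plus"
  and one_free_lie: "one (free_lie S) = fl_zero"
  and bracket_free_lie: "bracket (free_lie S) = fl_br"
  by (simp_all add: free_lie_def)

lemmas free_lie_simps = mult_free_lie one_free_lie bracket_free_lie

lemma fl_gen_closed: "x \<in> S \<Longrightarrow> fl_gen x \<in> carrier (free_lie S)"
  by (auto simp: carrier_free_lie fl_gen.abs_eq intro!: image_eqI[OF refl])

lemma fl_zero_closed: "fl_zero \<in> carrier (free_lie S)"
  by (auto simp: carrier_free_lie fl_zero.abs_eq intro!: image_eqI[OF refl])

lemma fl_plus_closed:
  assumes "x \<in> carrier (free_lie S)" "y \<in> carrier (free_lie S)"
  shows "fl_plus x y \<in> carrier (free_lie S)"
proof -
  obtain s t where "x = abs_flie s" "y = abs_flie t" "set_lie_term s \<subseteq> S" "set_lie_term t \<subseteq> S"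
    using assms by (auto simp: carrier_free_lie)
  then show ?thesis
    by (auto simp: carrier_free_lie fl_plus.abs_eq intro!: image_eqI[where x = "Plus s t"])
qed

lemma fl_br_closed:
  assumes "x \<in> carrier (free_lie S)" "y \<in> carrier (free_lie S)"
  shows "fl_br x y \<in> carrier (free_lie S)"
proof -
  obtain s t where "x = abs_flie s" "y = abs_flie t" "set_lie_term s \<subseteq> S" "set_lie_term t \<subseteq> S"
    using assms by (auto simp: carrier_free_lie)
  then show ?thesis
    by (auto simp: carrier_free_lie fl_br.abs_eq intro!: image_eqI[where x = "Br s t"])
qed

lemma fl_neg_closed:
  assumes "x \<in> carrier (free_lie S)"
  shows "fl_neg x \<in> carrier (free_lie S)"
proof -
  obtain s where "x = abs_flie s" "set_lie_term s \<subseteq> S"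
    using assms by (auto simp: carrier_free_lie)
  then show ?thesis
    by (auto simp: carrier_free_lie fl_neg.abs_eq intro!: image_eqI[where x = "Neg s"])
qed

lemma lie_algebra_free_lie: "lie_algebra (free_lie (S :: 'x set))"
proof -
  have cg: "comm_group (free_lie S)"
  proof (rule comm_groupI)
    fix x y z assume "x \<in> carrier (free_lie S)" "y \<in> carrier (free_lie S)"
    then show "x \<otimes>\<^bsub>free_lie S\<^esub> y \<in> carrier (free_lie S)"
      by (simp add: free_lie_simps fl_plus_closed)
    show "x \<otimes>\<^bsub>free_lie S\<^esub> y \<otimes>\<^bsub>free_lie S\<^esub> z = x \<otimes>\<^bsub>free_lie S\<^esub> (y \<otimes>\<^bsub>free_lie S\<^esub> z)"
      unfolding free_lie_simps by transfer (rule lie_cong_Plus_assoc)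
    show "x \<otimes>\<^bsub>free_lie S\<^esub> y = y \<otimes>\<^bsub>free_lie S\<^esub> x"
      unfolding free_lie_simps by transfer (rule lie_cong_Plus_comm)
    show "\<one>\<^bsub>free_lie S\<^esub> \<otimes>\<^bsub>free_lie S\<^esub> x = x"
      unfolding free_lie_simps by transfer (rule lie_cong_Plus_Zero)
    have "fl_plus (fl_neg x) x = fl_zero"
      by transfer (rule lie_cong_Plus_Neg)
    then show "\<exists>y\<in>carrier (free_lie S). y \<otimes>\<^bsub>free_lie S\<^esub> x = \<one>\<^bsub>free_lie S\<^esub>"
      using fl_neg_closed[OF \<open>x \<in> _\<close>] by (auto simp: free_lie_simps)
  qed (simp add: free_lie_simps fl_zero_closed)
  have left: "fl_br (fl_plus x y) z = fl_plus (fl_br x z) (fl_br y z)"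
    and right: "fl_br x (fl_plus y z) = fl_plus (fl_br x y) (fl_br x z)"
    and alt: "fl_br x x = fl_zero"
    and jac: "fl_plus (fl_plus (fl_br x (fl_br y z)) (fl_br y (fl_br z x))) (fl_br z (fl_br x y))
              = fl_zero" for x y z :: "'x flie"
    by (transfer, rule lie_cong_Br_left, transfer, rule lie_cong_Br_right,
        transfer, rule lie_cong_Br_alt, transfer, rule lie_cong_Jacobi)
  show ?thesis
    by (intro lie_algebra.intro lie_algebra_axioms.intro cg)
      (simp_all add: free_lie_simps fl_br_closed left right alt jac)
qed

primrec lie_eval :: "('a, 'm) lie_ring_scheme \<Rightarrow> ('x \<Rightarrow> 'a) \<Rightarrow> 'x lie_term \<Rightarrow> 'a" where
  "lie_eval L f (Gen x) = f x"
| "lie_eval L f Zero = \<one>\<^bsub>L\<^esub>"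
| "lie_eval L f (Plus s t) = lie_eval L f s \<otimes>\<^bsub>L\<^esub> lie_eval L f t"
| "lie_eval L f (Neg s) = inv\<^bsub>L\<^esub> lie_eval L f s"
| "lie_eval L f (Br s t) = bracket L (lie_eval L f s) (lie_eval L f t)"

context lie_algebra
begin

lemma lie_eval_closed:
  assumes "\<And>x. f x \<in> carrier L"
  shows "lie_eval L f t \<in> carrier L"
  by (induction t) (simp_all add: assms)

lemma lie_eval_cong:
  assumes f: "\<And>x. f x \<in> carrier L" and "lie_cong s t"
  shows "lie_eval L f s = lie_eval L f t"
  using assms(2)
proof induction
  case (lie_cong_Plus_comm s t)
  then show ?case by (simp add: lie_eval_closed[OF f] m_comm)
next
  case (lie_cong_Jacobi s t u)
  then show ?case by (simp add: lie_eval_closed[OF f] jacobi)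
qed (simp_all add: lie_eval_closed[OF f] m_assoc bracket_left bracket_right bracket_alt)

end

theorem free_lie_universal:
  fixes f :: "'x \<Rightarrow> 'a"
  assumes "lie_algebra L" and f: "\<And>x. x \<in> S \<Longrightarrow> f x \<in> carrier L"
  shows "\<exists>!\<phi>. \<phi> \<in> lie_hom (free_lie S) L \<and> \<phi> \<in> extensional (carrier (free_lie S))
              \<and> (\<forall>x\<in>S. \<phi> (fl_gen x) = f x)"
proof -
  interpret L: lie_algebra L by fact
  interpret F: lie_algebra "free_lie S" by (rule lie_algebra_free_lie)
  define f' where "f' x = (if x \<in> S then f x else \<one>\<^bsub>L\<^esub>)" for x
  have f': "f' x \<in> carrier L" for x
    by (simp add: f'_def f)
  define \<psi> where "\<psi> x = lie_eval L f' (rep_flie x)" for x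
  have rep: "lie_cong (rep_flie (abs_flie t)) t" for t :: "'x lie_term"
    by (rule rep_abs_rsp_left[OF Quotient3_flie lie_cong_refl])
  have abs: "\<psi> (abs_flie t) = lie_eval L f' t" for t
    unfolding \<psi>_def by (rule L.lie_eval_cong[OF f' rep])
  have plus: "\<psi> (fl_plus x y) = \<psi> x \<otimes>\<^bsub>L\<^esub> \<psi> y"
    and br: "\<psi> (fl_br x y) = bracket L (\<psi> x) (\<psi> y)" for x y
    by (induct x, induct y, simp add: fl_plus.abs_eq fl_br.abs_eq abs)+
  have gen: "\<psi> (fl_gen x) = f' x" for x
    by (simp add: fl_gen.abs_eq abs)
  have clo: "\<psi> x \<in> carrier L" for x
    by (simp add: \<psi>_def L.lie_eval_closed f')
  define \<phi> where "\<phi> = restrict \<psi> (carrier (free_lie S))"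
  show ?thesis
  proof (rule ex1I)
    show "\<phi> \<in> lie_hom (free_lie S) L \<and> \<phi> \<in> extensional (carrier (free_lie S))
              \<and> (\<forall>x\<in>S. \<phi> (fl_gen x) = f x)"
      by (auto simp: lie_hom_def hom_def \<phi>_def fl_gen_closed fl_plus_closed fl_br_closed
          free_lie_simps plus br gen f'_def clo)
  next
    fix \<chi>
    assume \<chi>: "\<chi> \<in> lie_hom (free_lie S) L \<and> \<chi> \<in> extensional (carrier (free_lie S))
              \<and> (\<forall>x\<in>S. \<chi> (fl_gen x) = f x)"
    then interpret h: group_hom "free_lie S" L \<chi>
      by (auto simp: lie_hom_def group_hom_def group_hom_axioms_def F.group_axioms L.group_axioms)
    have "\<chi> (abs_flie t) = lie_eval L f' t" if "set_lie_term t \<subseteq> S" for t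
      using that
    proof (induction t)
      case (Gen x)
      then show ?case using \<chi> by (simp add: f'_def flip: fl_gen.abs_eq)
    next
      case Zero
      then show ?case using h.hom_one by (simp add: free_lie_simps flip: fl_zero.abs_eq)
    next
      case (Plus s t)
      have "abs_flie s \<in> carrier (free_lie S)" "abs_flie t \<in> carrier (free_lie S)"
        using Plus.prems by (auto simp: carrier_free_lie)
      from h.hom_mult[OF this] Plus show ?case
        by (simp add: free_lie_simps fl_plus.abs_eq)
    next
      case (Neg s)
      have s: "abs_flie s \<in> carrier (free_lie S)"
        using Neg.prems by (auto simp: carrier_free_lie)
      have "fl_plus (fl_neg (abs_flie s)) (abs_flie s) = fl_zero"
        by transfer (rule lie_cong_Plus_Neg)
      then have "inv\<^bsub>free_lie S\<^esub> (abs_flie s) = fl_neg (abs_flie s)"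
        using s by (intro F.inv_equality) (auto simp: free_lie_simps fl_neg_closed)
      with h.hom_inv[OF s] Neg show ?case
        by (simp add: fl_neg.abs_eq)
    next
      case (Br s t)
      have "abs_flie s \<in> carrier (free_lie S)" "abs_flie t \<in> carrier (free_lie S)"
        using Br.prems by (auto simp: carrier_free_lie)
      with \<chi> have "\<chi> (bracket (free_lie S) (abs_flie s) (abs_flie t))
                   = bracket L (\<chi> (abs_flie s)) (\<chi> (abs_flie t))"
        unfolding lie_hom_def by blast
      with Br show ?case
        by (simp add: free_lie_simps fl_br.abs_eq)
    qed
    then show "\<chi> = \<phi>"
      using \<chi> by (intro extensionalityI[of _ "carrier (free_lie S)"])
        (auto simp: \<phi>_def carrier_free_lie abs)
  qed
qed

text \<open>
  A basis can be taken inside the carrier, so letting \<open>B\<close> range over sets of elements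
  of \<open>L\<close> loses no generality.
\<close>

definition is_free_lie :: "('a, 'm) lie_ring_scheme \<Rightarrow> bool" where
  "is_free_lie L \<longleftrightarrow> (\<exists>B :: 'a set. lie_isomorphic (free_lie B) L)"


section \<open>Free groups\<close>

text \<open>The letter \<open>(x, True)\<close> stands for \<open>x\<close> and \<open>(x, False)\<close> for its inverse.\<close>

inductive word_eq :: "('x \<times> bool) list \<Rightarrow> ('x \<times> bool) list \<Rightarrow> bool" where
  word_eq_refl: "word_eq u u"
| word_eq_sym: "word_eq u v \<Longrightarrow> word_eq v u"
| word_eq_trans: "word_eq u v \<Longrightarrow> word_eq v w \<Longrightarrow> word_eq u w"
| word_eq_cancel: "word_eq (u @ [(x, b), (x, \<not> b)] @ v) (u @ v)"

lemma word_eq_append_left: "word_eq u v \<Longrightarrow> word_eq (w @ u) (w @ v)"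
proof (induction rule: word_eq.induct)
  case (word_eq_cancel u x b v)
  show ?case using word_eq.intros(4)[of "w @ u" x b v] by simp
qed (blast intro: word_eq.intros)+

lemma word_eq_append_right: "word_eq u v \<Longrightarrow> word_eq (u @ w) (v @ w)"
proof (induction rule: word_eq.induct)
  case (word_eq_cancel u x b v)
  show ?case using word_eq.intros(4)[of u x b "v @ w"] by simp
qed (blast intro: word_eq.intros)+

lemma word_eq_append: "word_eq u u' \<Longrightarrow> word_eq v v' \<Longrightarrow> word_eq (u @ v) (u' @ v')"
  by (blast intro: word_eq_trans word_eq_append_left word_eq_append_right)

quotient_type 'x fgroup = "('x \<times> bool) list" / word_eq
  by (rule equivpI) (auto intro!: reflpI sympI transpI intro: word_eq.intros)

lift_definition fg_gen :: "'x \<Rightarrow> 'x fgroup" is "\<lambda>x. [(x, True)]" .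
lift_definition fg_one :: "'x fgroup" is "[]" .
lift_definition fg_mult :: "'x fgroup \<Rightarrow> 'x fgroup \<Rightarrow> 'x fgroup" is append
  by (rule word_eq_append)

definition free_group :: "'x set \<Rightarrow> 'x fgroup monoid" where
  "free_group S = \<lparr>carrier = abs_fgroup ` lists (S \<times> UNIV), monoid.mult = fg_mult, one = fg_one\<rparr>"

lemma carrier_free_group: "carrier (free_group S) = abs_fgroup ` lists (S \<times> UNIV)"
  and mult_free_group: "monoid.mult (free_group S) = fg_mult"
  and one_free_group: "one (free_group S) = fg_one"
  by (simp_all add: free_group_def)

lemmas free_group_simps = mult_free_group one_free_group

lemma fg_gen_closed: "x \<in> S \<Longrightarrow> fg_gen x \<in> carrier (free_group S)"
  by (auto simp: carrier_free_group fg_gen.abs_eq intro!: image_eqI[OF refl])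

lemma fg_one_closed: "fg_one \<in> carrier (free_group S)"
  by (auto simp: carrier_free_group fg_one.abs_eq intro!: image_eqI[OF refl])

lemma fg_mult_closed:
  assumes "x \<in> carrier (free_group S)" "y \<in> carrier (free_group S)"
  shows "fg_mult x y \<in> carrier (free_group S)"
proof -
  obtain u v where "x = abs_fgroup u" "y = abs_fgroup v"
      "u \<in> lists (S \<times> UNIV)" "v \<in> lists (S \<times> UNIV)"
    using assms by (auto simp: carrier_free_group)
  then show ?thesis
    by (auto simp: carrier_free_group fg_mult.abs_eq intro!: image_eqI[where x = "u @ v"])
qed

lemma word_eq_inverse: "word_eq (map (\<lambda>(x, b). (x, \<not> b)) (rev w) @ w) []"
proof (induction w)
  case Nil
  show ?case by (simp add: word_eq_refl)
next
  case (Cons l w)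
  obtain x b where l: "l = (x, b)" by fastforce
  have "word_eq (map (\<lambda>(x, b). (x, \<not> b)) (rev w) @ [(x, \<not> b), (x, \<not> \<not> b)] @ w)
          (map (\<lambda>(x, b). (x, \<not> b)) (rev w) @ w)"
    by (rule word_eq_cancel)
  with Cons.IH show ?case
    by (auto simp: l intro: word_eq_trans)
qed

lemma group_free_group: "group (free_group S)"
proof (rule groupI)
  fix x y z assume x: "x \<in> carrier (free_group S)"
  show "x \<otimes>\<^bsub>free_group S\<^esub> y \<otimes>\<^bsub>free_group S\<^esub> z = x \<otimes>\<^bsub>free_group S\<^esub> (y \<otimes>\<^bsub>free_group S\<^esub> z)"
    unfolding free_group_simps by transfer (simp add: word_eq_refl)
  show "\<one>\<^bsub>free_group S\<^esub> \<otimes>\<^bsub>free_group S\<^esub> x = x"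
    unfolding free_group_simps by transfer (simp add: word_eq_refl)
  obtain w where w: "x = abs_fgroup w" "w \<in> lists (S \<times> UNIV)"
    using x by (auto simp: carrier_free_group)
  let ?v = "map (\<lambda>(x, b). (x, \<not> b)) (rev w)"
  have "abs_fgroup ?v \<in> carrier (free_group S)"
    using w(2) unfolding carrier_free_group by (intro imageI) (auto simp: in_lists_conv_set)
  moreover have "fg_mult (abs_fgroup ?v) x = fg_one"
    by (simp add: w(1) fg_mult.abs_eq fg_one.abs_eq fgroup.abs_eq_iff word_eq_inverse)
  ultimately show "\<exists>y\<in>carrier (free_group S). y \<otimes>\<^bsub>free_group S\<^esub> x = \<one>\<^bsub>free_group S\<^esub>"
    by (auto simp: free_group_simps)
qed (simp_all add: free_group_simps fg_one_closed fg_mult_closed)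

lemma generate_fg_gen: "generate (free_group S) (fg_gen ` S) = carrier (free_group S)"
proof
  interpret F: group "free_group S" by (rule group_free_group)
  show "generate (free_group S) (fg_gen ` S) \<subseteq> carrier (free_group S)"
    by (rule F.generate_incl) (auto simp: fg_gen_closed)
  have "abs_fgroup w \<in> generate (free_group S) (fg_gen ` S)" if "w \<in> lists (S \<times> UNIV)" for w
    using that
  proof (induction w)
    case Nil
    show ?case
      using generate.one[of "free_group S"] by (simp add: free_group_simps flip: fg_one.abs_eq)
  next
    case (Cons l w)
    obtain x b where l: "l = (x, b)" "x \<in> S" using Cons.hyps by auto
    have i: "abs_fgroup [(x, False)] = inv\<^bsub>free_group S\<^esub> (fg_gen x)"
    proof (rule F.inv_equality[symmetric])
      show "abs_fgroup [(x, False)] \<otimes>\<^bsub>free_group S\<^esub> fg_gen x = \<one>\<^bsub>free_group S\<^esub>"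
        using word_eq_inverse[of "[(x, True)]"]
        by (simp add: free_group_simps fg_gen.abs_eq fg_mult.abs_eq fg_one.abs_eq fgroup.abs_eq_iff)
    qed (use l in \<open>auto simp: carrier_free_group fg_gen.abs_eq\<close>)
    have "abs_fgroup [l] \<in> generate (free_group S) (fg_gen ` S)"
      using l i by (cases b) (auto intro: generate.incl generate.inv simp flip: fg_gen.abs_eq)
    from generate.eng[OF this Cons.IH] show ?case
      by (simp add: free_group_simps fg_mult.abs_eq)
  qed
  then show "carrier (free_group S) \<subseteq> generate (free_group S) (fg_gen ` S)"
    by (auto simp: carrier_free_group)
qed

lemma hom_free_group_eqI:
  assumes "group H" "\<phi> \<in> hom (free_group S) H" "\<psi> \<in> hom (free_group S) H"
    and gen: "\<And>x. x \<in> S \<Longrightarrow> \<phi> (fg_gen x) = \<psi> (fg_gen x)"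
    and "w \<in> carrier (free_group S)"
  shows "\<phi> w = \<psi> w"
proof -
  interpret F: group "free_group S" by (rule group_free_group)
  interpret H: group H by fact
  interpret \<phi>: group_hom "free_group S" H \<phi> by unfold_locales (rule assms)
  interpret \<psi>: group_hom "free_group S" H \<psi> by unfold_locales (rule assms)
  have sub: "fg_gen ` S \<subseteq> carrier (free_group S)" by (auto simp: fg_gen_closed)
  have "w \<in> generate (free_group S) (fg_gen ` S)"
    using assms by (simp add: generate_fg_gen)
  then show ?thesis
  proof induction
    case (eng h1 h2)
    then show ?case by (simp add: F.generate_in_carrier[OF sub])
  qed (use sub in \<open>auto simp: gen\<close>)
qed

primrec word_eval :: "('a, 'm) monoid_scheme \<Rightarrow> ('x \<Rightarrow> 'a) \<Rightarrow> ('x \<times> bool) list \<Rightarrow> 'a" where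
  "word_eval H f [] = \<one>\<^bsub>H\<^esub>"
| "word_eval H f (l # w) =
     (if snd l then f (fst l) else inv\<^bsub>H\<^esub> f (fst l)) \<otimes>\<^bsub>H\<^esub> word_eval H f w"

context group
begin

lemma word_eval_closed:
  assumes "\<And>x. f x \<in> carrier G"
  shows "word_eval G f w \<in> carrier G"
  by (induction w) (simp_all add: assms)

lemma word_eval_append:
  assumes f: "\<And>x. f x \<in> carrier G"
  shows "word_eval G f (u @ v) = word_eval G f u \<otimes> word_eval G f v"
  by (induction u) (simp_all add: f word_eval_closed[OF f] m_assoc)

lemma word_eval_cong:
  assumes f: "\<And>x. f x \<in> carrier G" and "word_eq u v"
  shows "word_eval G f u = word_eval G f v"
  using assms(2)
proof induction
  case (word_eq_cancel u x b v)
  have "word_eval G f ([(x, b), (x, \<not> b)] @ v) = word_eval G f v"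
    by (simp add: f word_eval_closed[OF f] flip: m_assoc)
  then show ?case by (simp only: word_eval_append[OF f])
qed simp_all

end

theorem free_group_universal:
  fixes f :: "'x \<Rightarrow> 'a"
  assumes "group H" and f: "\<And>x. x \<in> S \<Longrightarrow> f x \<in> carrier H"
  shows "\<exists>!\<phi>. \<phi> \<in> hom (free_group S) H \<and> \<phi> \<in> extensional (carrier (free_group S))
              \<and> (\<forall>x\<in>S. \<phi> (fg_gen x) = f x)"
proof -
  interpret H: group H by fact
  define f' where "f' x = (if x \<in> S then f x else \<one>\<^bsub>H\<^esub>)" for x
  have f': "f' x \<in> carrier H" for x
    by (simp add: f'_def f)
  define \<psi> where "\<psi> x = word_eval H f' (rep_fgroup x)" for x
  have rep: "word_eq (rep_fgroup (abs_fgroup t)) t" for t :: "('x \<times> bool) list"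
    by (rule rep_abs_rsp_left[OF Quotient3_fgroup word_eq_refl])
  have abs: "\<psi> (abs_fgroup t) = word_eval H f' t" for t
    unfolding \<psi>_def by (rule H.word_eval_cong[OF f' rep])
  have mult: "\<psi> (fg_mult x y) = \<psi> x \<otimes>\<^bsub>H\<^esub> \<psi> y" for x y
    by (induct x, induct y, simp add: fg_mult.abs_eq abs H.word_eval_append f')
  have gen: "\<psi> (fg_gen x) = f' x" for x
    by (simp add: fg_gen.abs_eq abs f')
  have clo: "\<psi> x \<in> carrier H" for x
    by (simp add: \<psi>_def H.word_eval_closed f')
  define \<phi> where "\<phi> = restrict \<psi> (carrier (free_group S))"
  have \<phi>: "\<phi> \<in> hom (free_group S) H \<and> \<phi> \<in> extensional (carrier (free_group S))
              \<and> (\<forall>x\<in>S. \<phi> (fg_gen x) = f x)"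
    by (auto simp: hom_def \<phi>_def fg_gen_closed fg_mult_closed free_group_simps mult gen f'_def clo)
  show ?thesis
  proof (rule ex1I[where a = \<phi>])
    show "\<phi> \<in> hom (free_group S) H \<and> \<phi> \<in> extensional (carrier (free_group S))
              \<and> (\<forall>x\<in>S. \<phi> (fg_gen x) = f x)" by (rule \<phi>)
  next
    fix \<chi>
    assume \<chi>: "\<chi> \<in> hom (free_group S) H \<and> \<chi> \<in> extensional (carrier (free_group S))
              \<and> (\<forall>x\<in>S. \<chi> (fg_gen x) = f x)"
    show "\<chi> = \<phi>"
      by (rule extensionalityI[of _ "carrier (free_group S)"])
        (use \<phi> \<chi> hom_free_group_eqI[OF \<open>group H\<close>, of \<chi> S \<phi>] in auto)
  qed
qed


section \<open>McCool groups\<close>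

definition basis_conj :: "nat \<Rightarrow> nat \<Rightarrow> nat \<Rightarrow> nat fgroup \<Rightarrow> nat fgroup" where
  "basis_conj n i j =
     (let F = free_group {1..n} in
      THE \<chi>. \<chi> \<in> auto F
        \<and> \<chi> (fg_gen i) = fg_gen i \<otimes>\<^bsub>F\<^esub> commutator F (fg_gen i) (fg_gen j)
        \<and> (\<forall>k\<in>{1..n} - {i}. \<chi> (fg_gen k) = fg_gen k))"

definition mccool_group :: "nat \<Rightarrow> (nat fgroup \<Rightarrow> nat fgroup) monoid" where
  "mccool_group n =
     subgroup_generated (AutoGroup (free_group {1..n}))
       {basis_conj n i j | i j. i \<in> {1..n} \<and> j \<in> {1..n} \<and> i \<noteq> j}"

text \<open>The description above determines a unique automorphism.\<close>

lemma basis_conj_ex1: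
  assumes ij: "i \<in> S" "j \<in> S" "i \<noteq> j" and F: "F = free_group S"
  shows "\<exists>!\<chi>. \<chi> \<in> auto F
        \<and> \<chi> (fg_gen i) = fg_gen i \<otimes>\<^bsub>F\<^esub> commutator F (fg_gen i) (fg_gen j)
        \<and> (\<forall>k\<in>S - {i}. \<chi> (fg_gen k) = fg_gen k)"
proof -
  interpret F: group F unfolding F by (rule group_free_group)
  have [simp]: "x \<in> S \<Longrightarrow> fg_gen x \<in> carrier F" for x
    unfolding F by (rule fg_gen_closed)
  define g where "g = fg_gen j"
  have g [simp]: "g \<in> carrier F" using ij by (simp add: g_def)
  have conj: "fg_gen i \<otimes>\<^bsub>F\<^esub> commutator F (fg_gen i) (fg_gen j) = inv\<^bsub>F\<^esub> g \<otimes>\<^bsub>F\<^esub> fg_gen i \<otimes>\<^bsub>F\<^esub> g"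
    using ij by (simp add: commutator_def g_def flip: F.m_assoc)
  have ex: "\<exists>\<phi>. \<phi> \<in> hom F F \<and> \<phi> \<in> extensional (carrier F)
              \<and> (\<forall>x\<in>S. \<phi> (fg_gen x) = (if x = i then inv\<^bsub>F\<^esub> a \<otimes>\<^bsub>F\<^esub> fg_gen i \<otimes>\<^bsub>F\<^esub> a else fg_gen x))"
    if "a \<in> carrier F" for a
  proof -
    have "(if x = i then inv\<^bsub>F\<^esub> a \<otimes>\<^bsub>F\<^esub> fg_gen i \<otimes>\<^bsub>F\<^esub> a else fg_gen x) \<in> carrier F" if "x \<in> S" for x
      using that ij \<open>a \<in> carrier F\<close> by simp
    from free_group_universal[OF F.group_axioms this, of S] show ?thesis
      unfolding F[symmetric] by (rule ex1_implies_ex)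
  qed
  obtain \<phi> where \<phi>: "\<phi> \<in> hom F F" "\<phi> \<in> extensional (carrier F)"
      "\<And>x. x \<in> S \<Longrightarrow> \<phi> (fg_gen x) = (if x = i then inv\<^bsub>F\<^esub> g \<otimes>\<^bsub>F\<^esub> fg_gen i \<otimes>\<^bsub>F\<^esub> g else fg_gen x)"
    using ex[OF g] by blast
  obtain \<psi> where \<psi>: "\<psi> \<in> hom F F"
      "\<And>x. x \<in> S \<Longrightarrow> \<psi> (fg_gen x)
              = (if x = i then inv\<^bsub>F\<^esub> (inv\<^bsub>F\<^esub> g) \<otimes>\<^bsub>F\<^esub> fg_gen i \<otimes>\<^bsub>F\<^esub> inv\<^bsub>F\<^esub> g else fg_gen x)"
    using ex[OF F.inv_closed[OF g]] by blast
  interpret \<phi>: group_hom F F \<phi> by unfold_locales (rule \<phi>)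
  interpret \<psi>: group_hom F F \<psi> by unfold_locales (rule \<psi>)
  have g': "\<phi> g = g" "\<psi> g = g" using ij by (simp_all add: g_def \<phi> \<psi>)
  have idh: "(\<lambda>x. x) \<in> hom F F" by (simp add: hom_def)
  have cancel: "inv\<^bsub>F\<^esub> a \<otimes>\<^bsub>F\<^esub> (a \<otimes>\<^bsub>F\<^esub> x \<otimes>\<^bsub>F\<^esub> inv\<^bsub>F\<^esub> a) \<otimes>\<^bsub>F\<^esub> a = x"
    if "a \<in> carrier F" "x \<in> carrier F" for a x
    using that by (simp add: F.m_assoc) (simp flip: F.m_assoc)
  have "\<psi> (\<phi> (fg_gen x)) = fg_gen x" if "x \<in> S" for x
  proof (cases "x = i")
    case True
    then show ?thesis using ij cancel[OF g, of "fg_gen i"] by (simp add: \<phi>(3) \<psi>(2) g')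
  next
    case False
    then show ?thesis using that by (simp add: \<phi>(3) \<psi>(2))
  qed
  then have "(\<psi> \<circ> \<phi>) w = w" if "w \<in> carrier F" for w
    using hom_free_group_eqI[OF F.group_axioms, of "\<psi> \<circ> \<phi>" S "\<lambda>x. x" w]
      that idh hom_compose[OF \<phi>(1) \<psi>(1)]
    unfolding F[symmetric] by simp
  moreover have "\<phi> (\<psi> (fg_gen x)) = fg_gen x" if "x \<in> S" for x
  proof (cases "x = i")
    case True
    then show ?thesis using ij cancel[OF F.inv_closed[OF g], of "fg_gen i"] by (simp add: \<phi>(3) \<psi>(2) g')
  next
    case False
    then show ?thesis using that by (simp add: \<phi>(3) \<psi>(2))
  qed
  then have "(\<phi> \<circ> \<psi>) w = w" if "w \<in> carrier F" for w
    using hom_free_group_eqI[OF F.group_axioms, of "\<phi> \<circ> \<psi>" S "\<lambda>x. x" w]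
      that idh hom_compose[OF \<psi>(1) \<phi>(1)]
    unfolding F[symmetric] by simp
  ultimately have "bij_betw \<phi> (carrier F) (carrier F)"
    by (intro bij_betw_byWitness[where f' = \<psi>]) auto
  then have aut: "\<phi> \<in> auto F"
    using \<phi> by (simp add: auto_def Bij_def)
  show ?thesis
  proof (rule ex1I)
    show "\<phi> \<in> auto F
        \<and> \<phi> (fg_gen i) = fg_gen i \<otimes>\<^bsub>F\<^esub> commutator F (fg_gen i) (fg_gen j)
        \<and> (\<forall>k\<in>S - {i}. \<phi> (fg_gen k) = fg_gen k)"
      using aut \<phi>(3) ij unfolding conj by auto
  next
    fix \<chi>
    assume \<chi>: "\<chi> \<in> auto F
        \<and> \<chi> (fg_gen i) = fg_gen i \<otimes>\<^bsub>F\<^esub> commutator F (fg_gen i) (fg_gen j)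
        \<and> (\<forall>k\<in>S - {i}. \<chi> (fg_gen k) = fg_gen k)"
    then have h: "\<chi> \<in> hom F F" "\<chi> \<in> extensional (carrier F)"
      by (auto simp: auto_def Bij_def)
    have gens: "\<chi> (fg_gen x) = \<phi> (fg_gen x)" if "x \<in> S" for x
      using \<chi> \<phi>(3)[OF that] that unfolding conj by (cases "x = i") auto
    show "\<chi> = \<phi>"
      using h(2) \<phi>(2)
    proof (rule extensionalityI)
      fix w assume "w \<in> carrier F"
      with hom_free_group_eqI[OF F.group_axioms, of \<chi> S \<phi> w] h(1) \<phi>(1) gens
      show "\<chi> w = \<phi> w"
        unfolding F[symmetric] by blast
    qed
  qed
qed

lemma group_mccool_group: "group (mccool_group n)"
  unfolding mccool_group_def
  by (intro group.group_subgroup_generated group.AutoGroup group_free_group)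

end

theory Submission
  imports Defs "HOL-Library.Product_Plus" "HOL-Library.Countable" "HOL-Library.Multiset"
begin

text \<open>
  Why the theorem holds. For \<open>g\<close> in \<open>F\<^sub>3\<close> let \<open>inner g\<close> be the conjugation \<open>x \<mapsto> g x g\<inverse>\<close>. Since
  \<open>\<chi>\<^sub>i\<^sub>j \<chi>\<^sub>k\<^sub>j\<close> is inner for \<open>{i, j, k} = {1, 2, 3}\<close>, the group \<open>M\<^sub>3\<close> is generated by the inner automorphisms
  and by one automorphism \<open>beta j\<close> for each \<open>j\<close>. A ping-pong argument on triples of integers
  (\<open>ping_pong\<close>, \<open>psi_inner_trivial\<close>) shows that the \<open>beta j\<close> generate a free group which meets the inner
  automorphisms trivially, so \<open>M\<^sub>3\<close> is a semidirect product of two free groups of rank \<open>3\<close>, and the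
  factor generated by the \<open>beta j\<close> acts trivially on the abelianization of the other one.

  The graded Lie algebra is then the corresponding semidirect product \<open>Q\<close> of two free Lie rings. Let \<open>L\<close> be
  free on \<open>a\<^sub>1, a\<^sub>2, a\<^sub>3, b\<^sub>1, b\<^sub>2, b\<^sub>3\<close>, and let \<open>lam\<close> map \<open>L\<close> onto \<open>gr(M\<^sub>3)\<close>, sending \<open>a\<^sub>j\<close> and \<open>b\<^sub>j\<close> to the
  classes of \<open>inner g\<^sub>j\<close> and \<open>beta j\<close>. Nine commutator relations between these generators show that \<open>lam\<close>
  factors through \<open>semi_proj : L \<rightarrow> Q\<close> (\<open>lam_section\<close>). Two invariants make the resulting map
  \<open>Q \<rightarrow> gr(M\<^sub>3)\<close> injective. The projection of \<open>M\<^sub>3\<close> to the free group of the \<open>beta j\<close>, followed by the Magnus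
  embedding, recovers the component in the \<open>b\<^sub>j\<close> from the leading term of a power series. The Johnson filtration,
  which contains the lower central series, recovers the component \<open>u\<close> in the \<open>a\<^sub>j\<close>: if \<open>inner g\<close> lies too deep
  in it, the leading term \<open>u\<close> of \<open>g\<close> commutes with all variables and hence vanishes. So \<open>gr(M\<^sub>3) \<cong> Q\<close>, and
  residual nilpotence follows because the Johnson filtration intersects trivially.

  Three facts on free Lie rings over \<open>\<int>\<close> enter. Lazard elimination describes the kernel of a projection that kills
  part of the generators as a free Lie ring; used twice it shows that the kernel of \<open>semi_proj\<close> is free
  (\<open>ker_semi_proj_free\<close>). Iterated elimination shows that free Lie rings are torsion-free
  (\<open>flie_torsion_free\<close>), which makes \<open>Q\<close> and thus \<open>gr(M\<^sub>3)\<close> torsion-free. Finally, by the theorem of Dynkin,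
  Specht and Wever the map from the free Lie ring to noncommutative power series has torsion kernel, so it is
  injective (\<open>nc_lie_inj_homog\<close>).
\<close>

section \<open>Free Lie rings as additive groups\<close>

instantiation flie :: (type) ab_group_add
begin
definition zero_flie :: "'a flie" where "zero_flie = fl_zero"
definition plus_flie :: "'a flie \<Rightarrow> 'a flie \<Rightarrow> 'a flie" where "plus_flie = fl_plus"
definition uminus_flie :: "'a flie \<Rightarrow> 'a flie" where "uminus_flie = fl_neg"
definition minus_flie :: "'a flie \<Rightarrow> 'a flie \<Rightarrow> 'a flie" where "minus_flie x y = fl_plus x (fl_neg y)"
instance
proof
  fix a b c :: "'a flie"
  show "a + b + c = a + (b + c)"
    unfolding plus_flie_def by transfer (rule lie_cong_Plus_assoc)
  show "a + b = b + a"
    unfolding plus_flie_def by transfer (rule lie_cong_Plus_comm)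
  show "0 + a = a"
    unfolding plus_flie_def zero_flie_def by transfer (rule lie_cong_Plus_Zero)
  show "- a + a = 0"
    unfolding plus_flie_def zero_flie_def uminus_flie_def by transfer (rule lie_cong_Plus_Neg)
  show "a - b = a + - b"
    by (simp add: plus_flie_def minus_flie_def uminus_flie_def)
qed
end

notation fl_br (infixl "\<diamondop>" 70)

lemma br_add_left: "(x + y) \<diamondop> z = x \<diamondop> z + y \<diamondop> z"
  unfolding plus_flie_def by transfer (rule lie_cong_Br_left)

lemma br_add_right: "x \<diamondop> (y + z) = x \<diamondop> y + x \<diamondop> z"
  unfolding plus_flie_def by transfer (rule lie_cong_Br_right)

lemma br_self [simp]: "x \<diamondop> x = 0"
  unfolding zero_flie_def by transfer (rule lie_cong_Br_alt)

lemma br_Jacobi: "x \<diamondop> (y \<diamondop> z) + y \<diamondop> (z \<diamondop> x) + z \<diamondop> (x \<diamondop> y) = 0"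
  unfolding plus_flie_def zero_flie_def by transfer (rule lie_cong_Jacobi)

lemma br_zero_left [simp]: "0 \<diamondop> x = 0"
  using br_add_left[of 0 0 x] by simp

lemma br_zero_right [simp]: "x \<diamondop> 0 = 0"
  using br_add_right[of x 0 0] by simp

lemma br_minus_left [simp]: "(- x) \<diamondop> y = - (x \<diamondop> y)"
  by (metis add_eq_0_iff br_add_left br_zero_left ab_group_add_class.ab_left_minus)

lemma br_minus_right [simp]: "x \<diamondop> (- y) = - (x \<diamondop> y)"
  by (metis add_eq_0_iff br_add_right br_zero_right ab_group_add_class.ab_left_minus)

lemma br_anti: "x \<diamondop> y = - (y \<diamondop> x)"
proof -
  have "(x + y) \<diamondop> (x + y) = 0" by (rule br_self)
  then have "x \<diamondop> y + y \<diamondop> x = 0"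
    by (simp add: br_add_left br_add_right del: br_self) (simp add: add.commute)
  then show ?thesis by (simp add: eq_neg_iff_add_eq_0)
qed

lemma br_derivation: "x \<diamondop> (y \<diamondop> z) = (x \<diamondop> y) \<diamondop> z + y \<diamondop> (x \<diamondop> z)"
  using br_Jacobi[of x y z] br_anti[of z x] br_anti[of z "x \<diamondop> y"]
  by (simp add: add_eq_0_iff algebra_simps)

lemma br_diff_left: "(x - y) \<diamondop> z = x \<diamondop> z - y \<diamondop> z"
  using br_add_left[of x "- y" z] by simp

lemma br_diff_right: "x \<diamondop> (y - z) = x \<diamondop> y - x \<diamondop> z"
  using br_add_right[of x y "- z"] by simp

lemma br_sum_left: "sum f A \<diamondop> y = (\<Sum>a\<in>A. f a \<diamondop> y)"
  by (induction A rule: infinite_finite_induct) (auto simp: br_add_left)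

lemma br_sum_right: "y \<diamondop> sum f A = (\<Sum>a\<in>A. y \<diamondop> f a)"
  by (induction A rule: infinite_finite_induct) (auto simp: br_add_right)

lemma abs_flie_simps:
  "abs_flie (Gen x) = fl_gen x" "abs_flie Zero = 0" "abs_flie (Plus s t) = abs_flie s + abs_flie t"
  "abs_flie (Neg s) = - abs_flie s" "abs_flie (Br s t) = abs_flie s \<diamondop> abs_flie t"
  by (simp_all add: fl_gen.abs_eq zero_flie_def fl_zero.abs_eq plus_flie_def fl_plus.abs_eq
      uminus_flie_def fl_neg.abs_eq fl_br.abs_eq)

lemma flie_term_cases: obtains t where "u = abs_flie t"
  by (metis Quotient3_abs_rep[OF Quotient3_flie])

lemma flie_induct [case_names Gen Zero Plus Neg Br]:
  assumes "\<And>x. P (fl_gen x)" "P 0" "\<And>u v. P u \<Longrightarrow> P v \<Longrightarrow> P (u + v)"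
    "\<And>u. P u \<Longrightarrow> P (- u)" "\<And>u v. P u \<Longrightarrow> P v \<Longrightarrow> P (u \<diamondop> v)"
  shows "P u"
proof -
  obtain t where "u = abs_flie t" by (rule flie_term_cases)
  moreover have "P (abs_flie t)" by (induction t) (simp_all add: abs_flie_simps assms)
  ultimately show ?thesis by simp
qed

lemma lie_cong_rep_abs: "lie_cong (rep_flie (abs_flie t)) t"
  by (rule rep_abs_rsp_left[OF Quotient3_flie lie_cong_refl])

lemma lie_cong_iff: "lie_cong s t \<longleftrightarrow> abs_flie s = abs_flie t"
  by (simp add: flie.abs_eq_iff)

section \<open>Universal maps, derivations and actions\<close>

text \<open>The universal property as a function on the whole type \<open>'x flie\<close>, so that only the target needs
  carrier conditions.\<close>

definition fl_ev :: "('a, 'm) lie_ring_scheme \<Rightarrow> ('x \<Rightarrow> 'a) \<Rightarrow> 'x flie \<Rightarrow> 'a" where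
  "fl_ev L f u = lie_eval L f (rep_flie u)"

context lie_algebra
begin

lemma fl_ev_abs:
  assumes "\<And>x. f x \<in> carrier L"
  shows "fl_ev L f (abs_flie t) = lie_eval L f t"
  unfolding fl_ev_def by (rule lie_eval_cong[OF assms lie_cong_rep_abs])

lemma fl_ev_simps:
  assumes f: "\<And>x. f x \<in> carrier L"
  shows "fl_ev L f u \<in> carrier L"
    and "fl_ev L f (fl_gen x) = f x" and "fl_ev L f 0 = \<one>"
    and "fl_ev L f (u + v) = fl_ev L f u \<otimes> fl_ev L f v"
    and "fl_ev L f (- u) = inv (fl_ev L f u)"
    and "fl_ev L f (u \<diamondop> v) = bracket L (fl_ev L f u) (fl_ev L f v)"
proof -
  obtain s t where [simp]: "u = abs_flie s" "v = abs_flie t" by (metis flie_term_cases)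
  show "fl_ev L f u \<in> carrier L"
    by (simp add: fl_ev_abs f lie_eval_closed)
  show "fl_ev L f (fl_gen x) = f x" "fl_ev L f 0 = \<one>"
    "fl_ev L f (u + v) = fl_ev L f u \<otimes> fl_ev L f v"
    "fl_ev L f (- u) = inv (fl_ev L f u)"
    "fl_ev L f (u \<diamondop> v) = bracket L (fl_ev L f u) (fl_ev L f v)"
    by (simp_all add: fl_ev_abs f flip: abs_flie_simps)
qed

end

definition lie_of :: "('a::ab_group_add \<Rightarrow> 'a \<Rightarrow> 'a) \<Rightarrow> 'a lie_ring" where
  "lie_of br = \<lparr>carrier = UNIV, monoid.mult = (+), one = 0, bracket = br\<rparr>"

lemma lie_of_simps [simp]:
  "carrier (lie_of br) = UNIV" "monoid.mult (lie_of br) = (+)" "one (lie_of br) = 0"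
  "bracket (lie_of br) = br"
  by (simp_all add: lie_of_def)

locale lie_bracket =
  fixes br :: "'a::ab_group_add \<Rightarrow> 'a \<Rightarrow> 'a"
  assumes add_left: "br (x + y) z = br x z + br y z"
    and add_right: "br x (y + z) = br x y + br x z"
    and self: "br x x = 0"
    and Jacobi: "br x (br y z) + br y (br z x) + br z (br x y) = 0"
begin

lemma comm_group_lie_of: "comm_group (lie_of br)"
  by (rule comm_groupI) (auto simp: algebra_simps intro: exI[of _ "- x" for x])

sublocale L: lie_algebra "lie_of br"
  by (intro lie_algebra.intro lie_algebra_axioms.intro comm_group_lie_of)
    (simp_all add: add_left add_right self Jacobi)

lemma inv_lie_of [simp]: "inv\<^bsub>lie_of br\<^esub> x = - x"
  by (rule L.inv_equality) simp_all

definition ev :: "('x \<Rightarrow> 'a) \<Rightarrow> 'x flie \<Rightarrow> 'a" where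
  "ev f = fl_ev (lie_of br) f"

lemma ev_simps [simp]:
  "ev f (fl_gen x) = f x" "ev f 0 = 0" "ev f (u + v) = ev f u + ev f v" "ev f (- u) = - ev f u"
  "ev f (u \<diamondop> v) = br (ev f u) (ev f v)"
  unfolding ev_def by (simp_all add: L.fl_ev_simps)

lemma ev_diff [simp]: "ev f (u - v) = ev f u - ev f v"
  using ev_simps(3)[of f u "- v"] by simp

lemma ev_sum: "ev f (sum g A) = (\<Sum>a\<in>A. ev f (g a))"
  by (induction A rule: infinite_finite_induct) auto

end

global_interpretation flie: lie_bracket "(\<diamondop>)"
  defines fl_lift = flie.ev
  by unfold_locales (simp_all add: br_add_left br_add_right br_Jacobi)

definition fl_map :: "('x \<Rightarrow> 'y) \<Rightarrow> 'x flie \<Rightarrow> 'y flie" where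
  "fl_map f = fl_lift (\<lambda>x. fl_gen (f x))"

lemma fl_map_simps [simp]:
  "fl_map f (fl_gen x) = fl_gen (f x)" "fl_map f 0 = 0" "fl_map f (u + v) = fl_map f u + fl_map f v"
  "fl_map f (- u) = - fl_map f u" "fl_map f (u \<diamondop> v) = fl_map f u \<diamondop> fl_map f v"
  "fl_map f (u - v) = fl_map f u - fl_map f v"
  by (simp_all add: fl_map_def)

lemma fl_lift_fl_map [simp]: "fl_lift f (fl_map g u) = fl_lift (\<lambda>x. f (g x)) u"
  by (induction u rule: flie_induct) simp_all

lemma fl_lift_gen: "fl_lift fl_gen u = u"
  by (induction u rule: flie_induct) simp_all

lemma fl_map_inverse: "(\<And>x. g (f x) = x) \<Longrightarrow> fl_map g (fl_map f u) = u"
  by (induction u rule: flie_induct) simp_all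

primrec der_term :: "('x \<Rightarrow> 'x flie) \<Rightarrow> 'x lie_term \<Rightarrow> 'x flie" where
  "der_term d (Gen x) = d x"
| "der_term d Zero = 0"
| "der_term d (Plus s t) = der_term d s + der_term d t"
| "der_term d (Neg s) = - der_term d s"
| "der_term d (Br s t) = der_term d s \<diamondop> abs_flie t + abs_flie s \<diamondop> der_term d t"

text \<open>The identities of a Lie ring stay valid for pairs of an element and its derivative, since they are
  multilinear up to the alternating law, which becomes antisymmetry.\<close>

lemma der_term_cong: "lie_cong s t \<Longrightarrow> der_term d s = der_term d t"
proof (induction rule: lie_cong.induct)
  case (lie_cong_Br_alt s)
  show ?case using br_anti[of "der_term d s" "abs_flie s"] by simp
next
  case (lie_cong_Jacobi s t u)
  have "a' \<diamondop> (b \<diamondop> c) + a \<diamondop> (b' \<diamondop> c + b \<diamondop> c') + (b' \<diamondop> (c \<diamondop> a) + b \<diamondop> (c' \<diamondop> a + c \<diamondop> a'))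
        + (c' \<diamondop> (a \<diamondop> b) + c \<diamondop> (a' \<diamondop> b + a \<diamondop> b')) = 0" for a b c a' b' c' :: "'a flie"
  proof -
    have "?thesis \<longleftrightarrow> (a' \<diamondop> (b \<diamondop> c) + b \<diamondop> (c \<diamondop> a') + c \<diamondop> (a' \<diamondop> b))
      + (a \<diamondop> (b' \<diamondop> c) + b' \<diamondop> (c \<diamondop> a) + c \<diamondop> (a \<diamondop> b'))
      + (a \<diamondop> (b \<diamondop> c') + b \<diamondop> (c' \<diamondop> a) + c' \<diamondop> (a \<diamondop> b)) = 0"
      by (simp only: br_add_left br_add_right ac_simps)
    then show ?thesis by (simp only: br_Jacobi add_0)
  qed
  then show ?case by (simp add: abs_flie_simps)
qed (simp_all add: br_add_left br_add_right abs_flie_simps algebra_simps lie_cong_iff)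

definition der :: "('x \<Rightarrow> 'x flie) \<Rightarrow> 'x flie \<Rightarrow> 'x flie" where
  "der d u = der_term d (rep_flie u)"

lemma der_abs: "der d (abs_flie t) = der_term d t"
  unfolding der_def by (rule der_term_cong[OF lie_cong_rep_abs])

lemma der_simps [simp]:
  "der d (fl_gen x) = d x" "der d 0 = 0" "der d (u + v) = der d u + der d v"
  "der d (- u) = - der d u" "der d (u \<diamondop> v) = der d u \<diamondop> v + u \<diamondop> der d v"
proof -
  obtain s t where [simp]: "u = abs_flie s" "v = abs_flie t" by (metis flie_term_cases)
  show "der d (fl_gen x) = d x" "der d 0 = 0" "der d (u + v) = der d u + der d v"
    "der d (- u) = - der d u" "der d (u \<diamondop> v) = der d u \<diamondop> v + u \<diamondop> der d v"
    by (simp_all add: der_abs flip: abs_flie_simps)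
qed

text \<open>As the acting Lie ring is free, the derivations of its generators can be prescribed at will.\<close>

primrec act_term :: "('y \<Rightarrow> 'p \<Rightarrow> 'p flie) \<Rightarrow> 'y lie_term \<Rightarrow> 'p flie \<Rightarrow> 'p flie" where
  "act_term d (Gen y) u = der (d y) u"
| "act_term d Zero u = 0"
| "act_term d (Plus s t) u = act_term d s u + act_term d t u"
| "act_term d (Neg s) u = - act_term d s u"
| "act_term d (Br s t) u = act_term d s (act_term d t u) - act_term d t (act_term d s u)"

lemma act_term_additive:
  "act_term d t (u + v) = act_term d t u + act_term d t v" "act_term d t (- u) = - act_term d t u"
  "act_term d t 0 = 0"
  by (induction t arbitrary: u v) (simp_all add: algebra_simps)

lemma act_term_diff: "act_term d t (u - v) = act_term d t u - act_term d t v"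
  using act_term_additive(1)[of d t u "- v"] by (simp add: act_term_additive)

lemma act_term_cong: "lie_cong s t \<Longrightarrow> act_term d s u = act_term d t u"
proof (induction arbitrary: u rule: lie_cong.induct)
qed (simp_all add: act_term_additive act_term_diff algebra_simps)

definition act :: "('y \<Rightarrow> 'p \<Rightarrow> 'p flie) \<Rightarrow> 'y flie \<Rightarrow> 'p flie \<Rightarrow> 'p flie" where
  "act d v u = act_term d (rep_flie v) u"

lemma act_abs: "act d (abs_flie t) u = act_term d t u"
  unfolding act_def by (rule act_term_cong[OF lie_cong_rep_abs])

lemma act_simps [simp]:
  "act d (fl_gen y) u = der (d y) u" "act d 0 u = 0" "act d (v + w) u = act d v u + act d w u"
  "act d (- v) u = - act d v u" "act d (v \<diamondop> w) u = act d v (act d w u) - act d w (act d v u)"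
  "act d v 0 = 0" "act d v (u + u') = act d v u + act d v u'" "act d v (- u) = - act d v u"
proof -
  obtain s t where [simp]: "v = abs_flie s" "w = abs_flie t" by (metis flie_term_cases)
  show "act d (fl_gen y) u = der (d y) u" "act d 0 u = 0" "act d (v + w) u = act d v u + act d w u"
  "act d (- v) u = - act d v u" "act d (v \<diamondop> w) u = act d v (act d w u) - act d w (act d v u)"
    by (simp_all add: act_abs flip: abs_flie_simps)
  show "act d v 0 = 0" "act d v (u + u') = act d v u + act d v u'" "act d v (- u) = - act d v u"
    by (simp_all add: act_def act_term_additive)
qed

lemma act_diff [simp]: "act d v (u - u') = act d v u - act d v u'"
  using act_simps(7)[of d v u "- u'"] by simp

lemma act_br: "act d v (u \<diamondop> u') = act d v u \<diamondop> u' + u \<diamondop> act d v u'"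
proof (induction v arbitrary: u u' rule: flie_induct)
qed (simp_all add: br_add_left br_add_right br_diff_left br_diff_right algebra_simps)

definition semi_br ::
    "('y \<Rightarrow> 'p \<Rightarrow> 'p flie) \<Rightarrow> 'p flie \<times> 'y flie \<Rightarrow> 'p flie \<times> 'y flie \<Rightarrow> 'p flie \<times> 'y flie" where
  "semi_br d x y = (fst x \<diamondop> fst y + act d (snd x) (fst y) - act d (snd y) (fst x), snd x \<diamondop> snd y)"

text \<open>Besides the Jacobi identity for \<open>A\<close>, \<open>B\<close>, \<open>C\<close>, the derivation rule leaves three pairs
  \<open>x \<diamondop> y + y \<diamondop> x\<close>; the terms with two operators cancel because brackets act as commutators.\<close>

lemma semi_Jacobi_fst:
  fixes A B C :: "'p flie"
  shows "A \<diamondop> (B \<diamondop> C + act d b C - act d c B) + act d a (B \<diamondop> C + act d b C - act d c B) - act d (b \<diamondop> c) A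
    + (B \<diamondop> (C \<diamondop> A + act d c A - act d a C) + act d b (C \<diamondop> A + act d c A - act d a C) - act d (c \<diamondop> a) B)
    + (C \<diamondop> (A \<diamondop> B + act d a B - act d b A) + act d c (A \<diamondop> B + act d a B - act d b A) - act d (a \<diamondop> b) C) = 0"
proof -
  have "?thesis \<longleftrightarrow> (A \<diamondop> (B \<diamondop> C) + B \<diamondop> (C \<diamondop> A) + C \<diamondop> (A \<diamondop> B))
      + (act d a B \<diamondop> C + C \<diamondop> act d a B) + (act d b C \<diamondop> A + A \<diamondop> act d b C)
      + (act d c A \<diamondop> B + B \<diamondop> act d c A) = 0"
    by (simp add: br_add_right br_diff_right act_br algebra_simps)
  moreover have "x \<diamondop> y + y \<diamondop> x = 0" for x y :: "'p flie"
    by (subst br_anti) simp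
  ultimately show ?thesis by (simp only: br_Jacobi) simp
qed

lemma lie_bracket_semi_br: "lie_bracket (semi_br d)"
proof
  fix x y z
  show "semi_br d x x = 0" by (simp add: semi_br_def prod_eq_iff)
  show "semi_br d x (semi_br d y z) + semi_br d y (semi_br d z x) + semi_br d z (semi_br d x y) = 0"
    unfolding prod_eq_iff semi_br_def
    by (simp only: fst_conv snd_conv fst_add snd_add fst_zero snd_zero semi_Jacobi_fst br_Jacobi)
  show "semi_br d (x + y) z = semi_br d x z + semi_br d y z"
    by (simp add: semi_br_def prod_eq_iff br_add_left)
  show "semi_br d x (y + z) = semi_br d x y + semi_br d x z"
    by (simp add: semi_br_def prod_eq_iff br_add_right)
qed

global_interpretation semi: lie_bracket "semi_br d" for d :: "'y \<Rightarrow> 'p \<Rightarrow> 'p flie"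
  defines semi_ev = semi.ev
  by (rule lie_bracket_semi_br)

lemma fl_map_sum: "fl_map f (sum g A) = (\<Sum>a\<in>A. fl_map f (g a))"
  by (induction A rule: infinite_finite_induct) simp_all

section \<open>Lazard elimination\<close>

text \<open>The ideal generated by \<open>'x\<close> in the free Lie ring on \<open>'x + 'y\<close> is free on the elements
  \<open>ad y\<^sub>1 \<cdots> ad y\<^sub>k x\<close>, encoded as pairs \<open>([y\<^sub>1, \<dots>, y\<^sub>k], x)\<close>. Indeed, let \<open>y\<close> act on the free Lie ring on such pairs by
  the derivation that prefixes words with \<open>y\<close>. The semidirect product with the free Lie ring on \<open>'y\<close> is generated by
  the \<open>([], x)\<close> and the \<open>y\<close>, and \<open>elim\<close> and \<open>elim_emb\<close> show that it is free on them.\<close>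

definition prefix_der :: "'y \<Rightarrow> 'y list \<times> 'x \<Rightarrow> ('y list \<times> 'x) flie" where
  "prefix_der y p = fl_gen (y # fst p, snd p)"

definition ad_word :: "'y list \<Rightarrow> ('x + 'y) flie \<Rightarrow> ('x + 'y) flie" where
  "ad_word w u = foldr (\<lambda>y. (\<diamondop>) (fl_gen (Inr y))) w u"

definition elim_emb :: "('y list \<times> 'x) flie \<Rightarrow> ('x + 'y) flie" where
  "elim_emb = fl_lift (\<lambda>(w, x). ad_word w (fl_gen (Inl x)))"

definition elim :: "('x + 'y) flie \<Rightarrow> ('y list \<times> 'x) flie \<times> 'y flie" where
  "elim = semi_ev prefix_der (case_sum (\<lambda>x. (fl_gen ([], x), 0)) (\<lambda>y. (0, fl_gen y)))"

definition kill_left :: "('x + 'y) flie \<Rightarrow> 'y flie" where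
  "kill_left = fl_lift (case_sum (\<lambda>_. 0) fl_gen)"

lemma ad_word_simps [simp]: "ad_word [] u = u" "ad_word (y # w) u = fl_gen (Inr y) \<diamondop> ad_word w u"
  by (simp_all add: ad_word_def)

lemma elim_emb_simps [simp]:
  "elim_emb (fl_gen (w, x)) = ad_word w (fl_gen (Inl x))" "elim_emb 0 = 0"
  "elim_emb (u + v) = elim_emb u + elim_emb v" "elim_emb (- u) = - elim_emb u"
  "elim_emb (u - v) = elim_emb u - elim_emb v"
  "elim_emb (u \<diamondop> v) = elim_emb u \<diamondop> elim_emb v"
  by (simp_all add: elim_emb_def)

lemma elim_simps [simp]:
  "elim (fl_gen (Inl x)) = (fl_gen ([], x), 0)" "elim (fl_gen (Inr y)) = (0, fl_gen y)"
  "elim 0 = 0" "elim (u + v) = elim u + elim v" "elim (- u) = - elim u"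
  "elim (u \<diamondop> v) = semi_br prefix_der (elim u) (elim v)"
  by (simp_all add: elim_def)

lemma kill_left_simps [simp]:
  "kill_left (fl_gen (Inl x)) = 0" "kill_left (fl_gen (Inr y)) = fl_gen y" "kill_left 0 = 0"
  "kill_left (u + v) = kill_left u + kill_left v" "kill_left (- u) = - kill_left u"
  "kill_left (u \<diamondop> v) = kill_left u \<diamondop> kill_left v"
  by (simp_all add: kill_left_def)

lemma elim_emb_der: "elim_emb (der (prefix_der y) u) = fl_gen (Inr y) \<diamondop> elim_emb u"
proof (induction u rule: flie_induct)
  case (Br u v)
  then show ?case by (simp add: br_derivation[of "fl_gen (Inr y)"])
qed (auto simp: prefix_der_def br_add_right)

lemma elim_emb_act: "elim_emb (act prefix_der v u) = fl_map Inr v \<diamondop> elim_emb u"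
proof (induction v arbitrary: u rule: flie_induct)
  case (Br v w)
  then show ?case
    using br_derivation[of "fl_map Inr v" "fl_map Inr w" "elim_emb u"] by simp
qed (simp_all add: elim_emb_der br_add_left)

text \<open>The composite fixes generators and respects brackets, since \<open>elim_emb_act\<close> translates the mixed summands of a
  bracket in the semidirect product.\<close>

lemma elim_inverse:
  fixes z :: "('x + 'y) flie"
  shows "elim_emb (fst (elim z)) + fl_map Inr (snd (elim z)) = z"
proof (induction z rule: flie_induct)
  case (Gen x)
  then show ?case by (cases x) simp_all
next
  case (Br u v)
  define a b c d :: "('x + 'y) flie" where "a = elim_emb (fst (elim u))" "b = fl_map Inr (snd (elim u))"
    "c = elim_emb (fst (elim v))" "d = fl_map Inr (snd (elim v))"
  have "elim_emb (fst (elim (u \<diamondop> v))) + fl_map Inr (snd (elim (u \<diamondop> v)))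
      = a \<diamondop> c + b \<diamondop> c - d \<diamondop> a + b \<diamondop> d"
    by (simp add: semi_br_def elim_emb_act a_b_c_d_def)
  also have "\<dots> = (a + b) \<diamondop> (c + d)"
    using br_anti[of a d] by (simp add: br_add_left br_add_right algebra_simps)
  finally show ?case using Br by (simp add: a_b_c_d_def)
qed (simp_all add: algebra_simps)

lemma elim_ad_word: "elim (ad_word w (fl_gen (Inl x))) = (fl_gen (w, x), 0)"
  by (induction w) (simp_all add: semi_br_def prefix_der_def)

lemma elim_elim_emb: "elim (elim_emb u) = (u, 0)"
proof (induction u rule: flie_induct)
  case (Gen p)
  then show ?case by (cases p) (simp add: elim_ad_word)
qed (simp_all add: prod_eq_iff semi_br_def)

lemma snd_elim: "snd (elim z) = kill_left z"
proof (induction z rule: flie_induct)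
  case (Gen x)
  then show ?case by (cases x) simp_all
qed (simp_all add: semi_br_def)

theorem elim_emb_inj: "inj elim_emb"
  by (metis elim_elim_emb fst_conv injI)

theorem elim_emb_range: "range elim_emb = {z. kill_left z = 0}"
proof safe
  fix u :: "('y list \<times> 'x) flie"
  show "kill_left (elim_emb u) = 0"
    by (simp add: elim_elim_emb flip: snd_elim)
next
  fix z :: "('x + 'y) flie" assume "kill_left z = 0"
  then have "z = elim_emb (fst (elim z))"
    using elim_inverse[of z] by (simp add: snd_elim)
  then show "z \<in> range elim_emb" by blast
qed

section \<open>Free Lie rings are torsion-free\<close>

inductive weight_le :: "('x \<Rightarrow> nat) \<Rightarrow> 'x set \<Rightarrow> nat \<Rightarrow> 'x flie \<Rightarrow> bool" for w S where
  weight_le_gen: "x \<in> S \<Longrightarrow> w x \<le> n \<Longrightarrow> weight_le w S n (fl_gen x)"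
| weight_le_zero: "weight_le w S n 0"
| weight_le_add: "weight_le w S n u \<Longrightarrow> weight_le w S n v \<Longrightarrow> weight_le w S n (u + v)"
| weight_le_neg: "weight_le w S n u \<Longrightarrow> weight_le w S n (- u)"
| weight_le_br: "weight_le w S m u \<Longrightarrow> weight_le w S n v \<Longrightarrow> m + n \<le> k
    \<Longrightarrow> weight_le w S k (u \<diamondop> v)"

lemma weight_le_mono: "weight_le w S n u \<Longrightarrow> n \<le> m \<Longrightarrow> S \<subseteq> S' \<Longrightarrow> weight_le w S' m u"
proof (induction arbitrary: m rule: weight_le.induct)
  case (weight_le_br m u n v k)
  show ?case
    by (rule weight_le.weight_le_br[OF weight_le_br.IH(1)[OF order.refl] weight_le_br.IH(2)[OF order.refl]])
      (use weight_le_br.prems weight_le_br.hyps in auto)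
qed (auto intro: weight_le.intros)

lemma weight_le_map:
  assumes "weight_le w S n u" "\<And>x. x \<in> S \<Longrightarrow> f x \<in> S' \<and> w' (f x) = w x"
  shows "weight_le w' S' n (fl_map f u)"
  using assms(1) by induction (auto intro: weight_le.intros simp: assms(2))

lemma weight_le_eq_0:
  assumes "weight_le w S n u" "n \<le> N" "\<And>x. x \<in> S \<Longrightarrow> w x > N"
  shows "u = 0"
  using assms(1,2)
proof induction
  case (weight_le_gen x n)
  then show ?case using assms(3)[of x] by simp
qed auto

lemma weight_le_exists: "\<exists>S n. finite S \<and> weight_le (\<lambda>_. 1) S n u"
proof (induction u rule: flie_induct)
  case (Gen x)
  have "weight_le (\<lambda>_. 1) {x} 1 (fl_gen x)" by (intro weight_le.intros) auto
  then show ?case by blast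
next
  case (Plus u v)
  then obtain S n S' n' where *: "finite S" "weight_le (\<lambda>_. 1) S n u"
    "finite S'" "weight_le (\<lambda>_. 1) S' n' v" by blast
  have "weight_le (\<lambda>_. 1) (S \<union> S') (n + n') (u + v)"
    by (rule weight_le_add; rule weight_le_mono) (use * in auto)
  then show ?case using * by (meson finite_UnI)
next
  case (Br u v)
  then obtain S n S' n' where *: "finite S" "weight_le (\<lambda>_. 1) S n u"
    "finite S'" "weight_le (\<lambda>_. 1) S' n' v" by blast
  have "weight_le (\<lambda>_. 1) (S \<union> S') n u" "weight_le (\<lambda>_. 1) (S \<union> S') n' v"
    using * by (auto elim!: weight_le_mono)
  then have "weight_le (\<lambda>_. 1) (S \<union> S') (n + n') (u \<diamondop> v)"
    by (rule weight_le_br) simp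
  then show ?case using * by (meson finite_UnI)
qed (auto intro: weight_le.intros)

lemma unit_br [simp]: "u \<diamondop> v = (0 :: unit flie)"
proof -
  define g :: "unit flie" where "g = fl_gen ()"
  have g: "u \<diamondop> g = 0" for u
  proof (induction u rule: flie_induct)
    case (Br u v)
    then show ?case using br_derivation[of u v g] by simp
  qed (simp_all add: br_add_left g_def)
  show ?thesis
  proof (induction v arbitrary: u rule: flie_induct)
    case (Br v w)
    then show ?case using br_derivation[of u v w] by simp
  qed (simp_all add: br_add_right g flip: g_def)
qed

lemma unit_flie_torsion_free:
  assumes "(\<Sum>i<m. u) = 0" "m > (0 :: nat)"
  shows "u = (0 :: unit flie)"
proof -
  interpret int: lie_bracket "\<lambda>_ _. 0 :: int" by unfold_locales auto
  have "\<exists>(a::nat) (b::nat). u = (\<Sum>i<a. fl_gen ()) - (\<Sum>i<b. fl_gen ())" for u :: "unit flie"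
  proof (induction u rule: flie_induct)
    case (Gen x)
    show ?case by (intro exI[of _ 1] exI[of _ 0]) simp
  next
    case (Plus u v)
    then obtain a b c d :: nat where
      "u = (\<Sum>i<a. fl_gen ()) - (\<Sum>i<b. fl_gen ())" "v = (\<Sum>i<c. fl_gen ()) - (\<Sum>i<d. fl_gen ())"
      by blast
    moreover have "(\<Sum>i<a+b. g) = (\<Sum>i<a. g) + (\<Sum>i<b. g)" for a b :: nat and g :: "unit flie"
      by (induction b) (simp_all add: algebra_simps)
    ultimately have "u + v = (\<Sum>i<(a + c). fl_gen ()) - (\<Sum>i<(b + d). fl_gen ())"
      by (simp only: add_diff_add)
    then show ?case by blast
  next
    case (Neg u)
    then show ?case by (metis minus_diff_eq)
  qed (auto intro: exI[of _ 0])
  then obtain a b :: nat where u: "u = (\<Sum>i<a. fl_gen ()) - (\<Sum>i<b. fl_gen ())" by blast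
  have "int.ev (\<lambda>_. 1) (\<Sum>i<m. u) = 0" using assms by simp
  then have "int m * (int a - int b) = 0"
    by (simp add: int.ev_sum u)
  then show ?thesis using assms(2) u by simp
qed

text \<open>Eliminating \<open>x\<close> replaces every other generator \<open>s\<close> by the elements \<open>ad(x)\<^sup>k s\<close>, which get the weight
  \<open>k w(x) + w(s)\<close>. Bounds on weights survive because acting with \<open>x\<close> costs exactly \<open>w(x)\<close>, and this is
  available whenever the component along \<open>x\<close> is nonzero.\<close>

lemma elim_weight_le:
  fixes x :: 'x and w :: "'x \<Rightarrow> nat"
  defines "r \<equiv> \<lambda>s. if s = x then Inr () else Inl s"
    and "w2 \<equiv> \<lambda>p. length (fst p) * w x + w (snd p)"
  defines "S2 \<equiv> \<lambda>S N. {p. snd p \<in> S - {x} \<and> w2 p \<le> N}"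
  assumes "weight_le w S n u" "n \<le> N"
  shows "weight_le w2 (S2 S N) n (fst (elim (fl_map r u)))
    \<and> (snd (elim (fl_map r u)) \<noteq> 0 \<longrightarrow> w x \<le> n)"
  using assms(4,5)
proof (induction)
  case (weight_le_gen s n)
  then show ?case
    by (auto simp: r_def w2_def S2_def intro: weight_le.intros)
next
  case (weight_le_br m u n v k)
  define a b c d where ab: "a = fst (elim (fl_map r u))" "b = snd (elim (fl_map r u))"
    "c = fst (elim (fl_map r v))" "d = snd (elim (fl_map r v))"
  have IH: "weight_le w2 (S2 S N) m a" "weight_le w2 (S2 S N) n c" "b \<noteq> 0 \<Longrightarrow> w x \<le> m" "d \<noteq> 0 \<Longrightarrow> w x \<le> n"
    using weight_le_br by (auto simp: ab)
  have der: "weight_le w2 (S2 S N) (n + w x) (der (prefix_der ()) v)"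
    if "weight_le w2 (S2 S N) n v" "n + w x \<le> N" for n v
    using that
  proof (induction)
    case (weight_le_gen p n)
    then show ?case
      by (auto simp: prefix_der_def w2_def S2_def intro!: weight_le.intros)
  next
    case (weight_le_br m u n v k)
    have "weight_le w2 (S2 S N) (k + w x) (der (prefix_der ()) u \<diamondop> v)"
      by (rule weight_le.weight_le_br[where m = "m + w x" and n = n])
        (use weight_le_br in auto)
    moreover have "weight_le w2 (S2 S N) (k + w x) (u \<diamondop> der (prefix_der ()) v)"
      by (rule weight_le.weight_le_br[where m = m and n = "n + w x"])
        (use weight_le_br in auto)
    ultimately show ?case by (simp add: weight_le_add)
  qed (auto intro: weight_le.intros)
  have act: "weight_le w2 (S2 S N) (n + w x) (act prefix_der z v)"
    if "weight_le w2 (S2 S N) n v" "n + w x \<le> N" for n v z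
    using that
  proof (induction z arbitrary: v rule: flie_induct)
    case (Br u v)
    then show ?case by (simp add: weight_le_zero del: act_simps(5))
  qed (auto intro: weight_le.intros der)
  have act': "weight_le w2 (S2 S N) k (act prefix_der z v)"
    if "weight_le w2 (S2 S N) l v" "z \<noteq> 0 \<Longrightarrow> l + w x \<le> k" for l v z
  proof (cases "z = 0")
    case False
    then show ?thesis
      using act[OF that(1), of z] that(2) weight_le_br.prems by (auto elim!: weight_le_mono)
  qed (simp add: weight_le_zero)
  have "weight_le w2 (S2 S N) k (act prefix_der b c)"
    by (rule act'[OF IH(2)]) (use IH weight_le_br.hyps in auto)
  moreover have "weight_le w2 (S2 S N) k (act prefix_der d a)"
    by (rule act'[OF IH(1)]) (use IH weight_le_br.hyps in auto)
  moreover have "weight_le w2 (S2 S N) k (a \<diamondop> c)"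
    by (rule weight_le.weight_le_br[OF IH(1,2)]) (use weight_le_br.hyps in auto)
  ultimately have "weight_le w2 (S2 S N) k (a \<diamondop> c + act prefix_der b c + - act prefix_der d a)"
    by (intro weight_le_add weight_le_neg)
  then show ?case by (simp add: semi_br_def ab)
qed (auto intro: weight_le.intros)

text \<open>Elimination of a generator \<open>x\<close> is an additive isomorphism onto \<open>\<int> \<oplus> L'\<close> with \<open>L'\<close> free on the
  \<open>ad(x)\<^sup>k s\<close>, so a torsion element yields one of \<open>L'\<close> within the same weight bound \<open>N\<close>. Only finitely many new
  generators have weight at most \<open>N\<close>. Compared with the old ones \<open>x\<close> has disappeared, and the additional
  ones, those with \<open>k \<ge> 1\<close>, are heavier than \<open>x\<close>; hence the multiset of the numbers \<open>N + 1 - weight\<close> decreases.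
  When no generator of weight at most \<open>N\<close> is left, the element is \<open>0\<close>. Generators are natural numbers, into which the pairs
  \<open>(k, s)\<close> are encoded again, so that the induction stays inside one type.\<close>

lemma torsion_free_weighted:
  fixes S :: "nat set"
  assumes "finite S" "\<And>x. w x > 0" "weight_le w S N u" "(\<Sum>i<m. u) = 0" "m > (0 :: nat)"
  shows "u = 0"
proof -
  define M where "M = image_mset (\<lambda>x. Suc N - w x) (mset_set {x \<in> S. w x \<le> N})"
  have wf: "wf (Multiset.mult less_than)" by (rule wf_mult[OF wf_less_than])
  from wf assms(1-4) M_def show ?thesis
  proof (induction M arbitrary: S w u rule: wf_induct_rule)
    case (less M S w u)
    show ?case
    proof (cases "\<exists>x\<in>S. w x \<le> N")
      case False
      then show ?thesis using weight_le_eq_0[OF less.prems(3) order.refl] by force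
    next
      case True
      then obtain x where x: "x \<in> S" "w x \<le> N" by blast
      define r where "r = (\<lambda>s. if s = x then Inr () else Inl s)"
      define w2 where "w2 = (\<lambda>p :: unit list \<times> nat. length (fst p) * w x + w (snd p))"
      define S2 where "S2 = {p. snd p \<in> S - {x} \<and> w2 p \<le> N}"
      define u2 where "u2 = fst (elim (fl_map r u))"
      have wle: "weight_le w2 S2 N u2"
        using elim_weight_le[OF less.prems(3) order.refl, of x] by (simp add: r_def w2_def S2_def u2_def)
      have add: "elim (fl_map r (\<Sum>i<m. u)) = (\<Sum>i<m. elim (fl_map r u))" for m :: nat
        by (induction m) simp_all
      have "(\<Sum>i<m. elim (fl_map r u)) = 0" using less.prems(4) add by (metis elim_simps(3) fl_map_simps(2))
      then have s0: "(\<Sum>i<m. u2) = 0" "(\<Sum>i<m. snd (elim (fl_map r u))) = 0"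
        unfolding u2_def prod_eq_iff by (simp_all add: fst_sum snd_sum)
      have "length (fst p) \<le> N" if "p \<in> S2" for p
      proof -
        have "length (fst p) * 1 \<le> length (fst p) * w x"
          using less.prems(2)[of x] by (intro mult_le_mono2) simp
        also have "\<dots> \<le> N" using that by (simp add: S2_def w2_def)
        finally show ?thesis by simp
      qed
      moreover have "ws = replicate (length ws) ()" for ws :: "unit list"
        by (simp add: replicate_eqI)
      ultimately have sub: "S2 \<subseteq> (\<lambda>(k, s). (replicate k (), s)) ` ({..N} \<times> S)"
        by (force simp: S2_def image_iff)
      then have fin2: "finite S2" using less.prems(1) by (auto intro: finite_subset)
      define w' :: "nat \<Rightarrow> nat" where "w' = (\<lambda>n. w2 (from_nat n))"
      define S' where "S' = to_nat ` S2"
      have wle': "weight_le w' S' N (fl_map to_nat u2)"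
        using wle by (rule weight_le_map) (auto simp: S'_def w'_def)
      \<comment> \<open>\<open>R0\<close> is the part common to the old and the new multiset, \<open>K\<close> the new rest.\<close>
      define R0 where "R0 = image_mset (\<lambda>x. Suc N - w x) (mset_set {s \<in> S - {x}. w s \<le> N})"
      have e1: "{s \<in> S. w s \<le> N} = insert x {s \<in> S - {x}. w s \<le> N}" using x by auto
      have old: "image_mset (\<lambda>x. Suc N - w x) (mset_set {x \<in> S. w x \<le> N}) = R0 + {# Suc N - w x #}"
        unfolding e1 using less.prems(1) by (subst mset_set.insert) (auto simp: R0_def)
      define K where "K = image_mset (\<lambda>p. Suc N - w2 p) (mset_set {p \<in> S2. fst p \<noteq> []})"
      have e2: "S2 = (Pair []) ` {s \<in> S - {x}. w s \<le> N} \<union> {p \<in> S2. fst p \<noteq> []}"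
        by (auto simp: S2_def w2_def)
      have "mset_set S2 = mset_set ((Pair []) ` {s \<in> S - {x}. w s \<le> N}) + mset_set {p \<in> S2. fst p \<noteq> []}"
        by (subst e2, rule mset_set_Union) (use fin2 less.prems(1) in auto)
      also have "mset_set ((Pair ([] :: unit list)) ` {s \<in> S - {x}. w s \<le> N})
          = image_mset (Pair []) (mset_set {s \<in> S - {x}. w s \<le> N})"
        by (rule image_mset_mset_set[symmetric]) (auto simp: inj_on_def)
      finally have new2: "image_mset (\<lambda>p. Suc N - w2 p) (mset_set S2) = R0 + K"
        by (simp add: R0_def K_def w2_def multiset.map_comp comp_def)
      have e3: "{s \<in> S'. w' s \<le> N} = to_nat ` S2"
        by (auto simp: S'_def w'_def S2_def)
      have "mset_set (to_nat ` S2) = image_mset to_nat (mset_set S2)"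
        by (rule image_mset_mset_set[symmetric]) (auto simp: inj_on_def)
      then have new: "image_mset (\<lambda>x. Suc N - w' x) (mset_set {s \<in> S'. w' s \<le> N}) = R0 + K"
        unfolding e3 new2[symmetric] by (simp add: w'_def multiset.map_comp comp_def)
      have "\<forall>k\<in>#K. \<exists>j\<in>#{# Suc N - w x #}. (k, j) \<in> less_than"
      proof
        fix k assume "k \<in># K"
        then obtain p where p: "p \<in> S2" "fst p \<noteq> []" "k = Suc N - w2 p"
          using fin2 by (auto simp: K_def)
        then have "1 * w x \<le> length (fst p) * w x"
          by (intro mult_le_mono1) (cases "fst p", auto)
        then have "w x < w2 p" using less.prems(2)[of "snd p"] unfolding w2_def by linarith
        then show "\<exists>j\<in>#{# Suc N - w x #}. (k, j) \<in> less_than" using p x by auto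
      qed
      then have lt: "(R0 + K, R0 + {# Suc N - w x #}) \<in> Multiset.mult less_than"
        by (intro one_step_implies_mult) auto
      have "fl_map to_nat u2 = 0"
      proof (rule less.IH[of _ S' w', OF _ _ _ _ _ refl])
        show "(image_mset (\<lambda>x. Suc N - w' x) (mset_set {x \<in> S'. w' x \<le> N}),
            M) \<in> Multiset.mult less_than"
          unfolding new old less.prems(5) by (rule lt)
        show "finite S'" using fin2 by (simp add: S'_def)
        show "w' y > 0" for y using less.prems(2) by (simp add: w'_def w2_def)
        show "(\<Sum>i<m. fl_map to_nat u2) = 0"
          using s0(1) by (simp flip: fl_map_sum)
      qed (rule wle')+
      then have "u2 = 0" using fl_map_inverse[of from_nat to_nat u2] by simp
      moreover have "snd (elim (fl_map r u)) = 0"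
        by (rule unit_flie_torsion_free[OF s0(2) assms(5)])
      ultimately have "fl_map r u = 0"
        using elim_inverse[of "fl_map r u"] by (simp add: u2_def)
      moreover have "fl_map (case_sum id (\<lambda>_. x)) (fl_map r u) = u"
        by (rule fl_map_inverse) (simp add: r_def)
      ultimately show ?thesis by simp
    qed
  qed
qed

theorem flie_torsion_free:
  fixes u :: "'x::countable flie"
  assumes "(\<Sum>i<m. u) = 0" "m > (0 :: nat)"
  shows "u = 0"
proof -
  let ?v = "fl_map to_nat u"
  obtain S n where S: "finite S" "weight_le (\<lambda>_. 1) S n ?v" using weight_le_exists by blast
  have "(\<Sum>i<m. ?v) = 0"
    using assms by (simp flip: fl_map_sum)
  then have "?v = 0" using torsion_free_weighted[OF S(1) _ S(2)] assms(2) by simp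
  then show ?thesis using fl_map_inverse[of from_nat to_nat u] by simp
qed

section \<open>Homogeneous elements\<close>

inductive homog :: "nat \<Rightarrow> 'x flie \<Rightarrow> bool" where
  homog_gen: "homog 1 (fl_gen x)"
| homog_zero: "homog n 0"
| homog_add: "homog n u \<Longrightarrow> homog n v \<Longrightarrow> homog n (u + v)"
| homog_neg: "homog n u \<Longrightarrow> homog n (- u)"
| homog_br: "homog m u \<Longrightarrow> homog n v \<Longrightarrow> homog (m + n) (u \<diamondop> v)"

lemma homog_0: "homog n u \<Longrightarrow> n = 0 \<Longrightarrow> u = 0"
  by (induction rule: homog.induct) auto

lemma homog_decomposition:
  fixes u :: "'x flie"
  shows "\<exists>N f. (\<forall>n. homog n (f n)) \<and> u = (\<Sum>n\<le>N. f n)"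
proof -
  define D where "D u \<longleftrightarrow> (\<exists>N f. (\<forall>n. homog n (f n)) \<and> u = (\<Sum>n\<le>N. f n))" for u :: "'x flie"
  have single: "D u" if "homog n u" for n u
  proof -
    have "u = (\<Sum>k\<le>n. if k = n then u else 0)" by simp
    moreover have "homog k (if k = n then u else 0)" for k
      using that by (simp add: homog_zero)
    ultimately show ?thesis unfolding D_def
      by (intro exI[of _ n] exI[of _ "\<lambda>k. if k = n then u else 0"]) auto
  qed
  have add: "D (u + v)" if uv: "D u" "D v" for u v
  proof -
    obtain N f M g where f: "\<And>n. homog n (f n)" "u = (\<Sum>n\<le>N. f n)"
      and g: "\<And>n. homog n (g n)" "v = (\<Sum>n\<le>M. g n)"
      using uv unfolding D_def by metis
    let ?f = "\<lambda>n. if n \<le> N then f n else 0" and ?g = "\<lambda>n. if n \<le> M then g n else 0"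
    have "u = (\<Sum>n\<le>N + M. ?f n)" "v = (\<Sum>n\<le>N + M. ?g n)"
      unfolding f(2) g(2) by (auto intro!: sum.mono_neutral_cong_left split: if_splits)
    then have "u + v = (\<Sum>n\<le>N + M. ?f n + ?g n)" by (simp add: sum.distrib)
    moreover have "homog n (?f n + ?g n)" for n
      using f(1) g(1) by (auto intro: homog.intros)
    ultimately show ?thesis unfolding D_def
      by (intro exI[of _ "N + M"] exI[of _ "\<lambda>n. ?f n + ?g n"]) auto
  qed
  have sum: "D (\<Sum>i\<in>I. h i)" if "\<And>i. i \<in> I \<Longrightarrow> D (h i)" for I :: "nat set" and h
    using that by (induction I rule: infinite_finite_induct) (auto intro: add single homog_zero)
  have "D u"
  proof (induction u rule: flie_induct)
    case (Neg u)
    then obtain N f where "\<And>n. homog n (f n)" "u = (\<Sum>n\<le>N. f n)" unfolding D_def by metis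
    moreover have "D (\<Sum>n\<le>N. - f n)"
      by (intro sum single homog_neg) (rule calculation)
    ultimately show ?case by (simp add: sum_negf)
  next
    case (Br u v)
    then obtain N f M g where f: "\<And>n. homog n (f n)" "u = (\<Sum>n\<le>N. f n)"
      and g: "\<And>n. homog n (g n)" "v = (\<Sum>n\<le>M. g n)"
      unfolding D_def by metis
    have "D (\<Sum>j\<le>M. \<Sum>i\<le>N. f i \<diamondop> g j)"
      by (rule sum, rule sum, rule single, rule homog_br, rule f(1), rule g(1))
    then show ?case by (simp add: f g br_sum_left br_sum_right)
  qed (auto intro: add single homog.intros)
  then show ?thesis by (simp add: D_def)
qed

section \<open>Kernels that are free\<close>

text \<open>The generators \<open>([], x)\<close> are mapped to free generators, so \<open>h\<close> is a retraction, with section \<open>s\<close>. Replacing each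
  other generator \<open>z\<close> by \<open>z - s (h z)\<close> gives free generators again, the change being triangular, and \<open>h\<close> kills
  the new ones. Its kernel is therefore the ideal they generate, which is free by elimination.\<close>

lemma ker_retraction_free:
  fixes h :: "'y list \<times> 'x \<Rightarrow> 'x flie"
  assumes h: "\<And>x. h ([], x) = fl_gen x"
  shows "\<exists>f :: 'x list \<times> ('y \<times> 'y list \<times> 'x) \<Rightarrow> ('y list \<times> 'x) flie.
    inj (fl_lift f) \<and> range (fl_lift f) = {u. fl_lift h u = 0}"
proof -
  define s :: "'x flie \<Rightarrow> ('y list \<times> 'x) flie" where "s = fl_map (\<lambda>x. ([], x))"
  define t :: "(('y \<times> 'y list \<times> 'x) + 'x) flie \<Rightarrow> ('y list \<times> 'x) flie" where
    "t = fl_lift (case_sum (\<lambda>(b, w, x). fl_gen (b # w, x) - s (h (b # w, x))) (\<lambda>x. fl_gen ([], x)))"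
  define t' :: "('y list \<times> 'x) flie \<Rightarrow> (('y \<times> 'y list \<times> 'x) + 'x) flie" where
    "t' = fl_lift (\<lambda>(w, x). case w of [] \<Rightarrow> fl_gen (Inr x)
        | b # w \<Rightarrow> fl_gen (Inl (b, w, x)) + fl_map Inr (h (b # w, x)))"
  have t_map: "t (fl_map Inr v) = s v" for v
    by (induction v rule: flie_induct) (simp_all add: t_def s_def)
  have t'_s: "t' (s v) = fl_map Inr v" for v
    by (induction v rule: flie_induct) (simp_all add: t'_def s_def)
  have h_s: "fl_lift h (s v) = v" for v
    by (simp add: s_def h fl_lift_gen)
  have t_add: "t (u + v) = t u + t v" for u v
    by (simp add: t_def)
  have tt': "t (t' u) = u" for u
  proof (induction u rule: flie_induct)
    case (Gen p)
    then show ?case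
      by (cases p; cases "fst p") (simp_all add: t'_def t_add t_map, simp_all add: t_def)
  qed (simp_all add: t_def t'_def)
  have t'_diff: "t' (u - v) = t' u - t' v" for u v
    by (simp add: t'_def)
  have t't: "t' (t u) = u" for u
  proof (induction u rule: flie_induct)
    case (Gen p)
    then show ?case
      by (cases p) (auto simp add: t_def t'_diff t'_s, simp_all add: t'_def)
  qed (simp_all add: t_def t'_def)
  have ht: "fl_lift h (t u) = kill_left u" for u
  proof (induction u rule: flie_induct)
    case (Gen p)
    then show ?case by (cases p) (auto simp: t_def h_s h)
  qed (simp_all add: t_def)
  define f :: "'x list \<times> ('y \<times> 'y list \<times> 'x) \<Rightarrow> ('y list \<times> 'x) flie" where
    "f i = t (elim_emb (fl_gen i))" for i
  have f: "fl_lift f u = t (elim_emb u)" for u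
    by (induction u rule: flie_induct) (simp_all add: f_def, simp_all add: t_def)
  have "inj (fl_lift f)"
    unfolding f inj_def by (metis t't elim_emb_inj injD)
  moreover have "range (fl_lift f) = {u. fl_lift h u = 0}"
  proof safe
    fix v :: "('x list \<times> 'y \<times> 'y list \<times> 'x) flie"
    have "kill_left (elim_emb v) = 0" using elim_emb_range by blast
    then show "fl_lift h (fl_lift f v) = 0" by (simp add: f ht)
  next
    fix u assume "fl_lift h u = 0"
    then have "kill_left (t' u) = 0" using ht[of "t' u"] by (simp add: tt')
    then obtain v where "t' u = elim_emb v" using elim_emb_range by blast
    then have "u = fl_lift f v" unfolding f by (metis tt')
    then show "u \<in> range (fl_lift f)" by blast
  qed
  ultimately show ?thesis by blast
qed

definition semi_proj :: "('b \<Rightarrow> 'a \<Rightarrow> 'a flie) \<Rightarrow> ('a + 'b) flie \<Rightarrow> 'a flie \<times> 'b flie" where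
  "semi_proj d = semi_ev d (case_sum (\<lambda>a. (fl_gen a, 0)) (\<lambda>b. (0, fl_gen b)))"

lemma semi_proj_simps [simp]:
  "semi_proj d (fl_gen (Inl a)) = (fl_gen a, 0)" "semi_proj d (fl_gen (Inr b)) = (0, fl_gen b)"
  "semi_proj d 0 = 0" "semi_proj d (u + v) = semi_proj d u + semi_proj d v"
  "semi_proj d (- u) = - semi_proj d u"
  "semi_proj d (u \<diamondop> v) = semi_br d (semi_proj d u) (semi_proj d v)"
  by (simp_all add: semi_proj_def)

lemma snd_semi_proj: "snd (semi_proj d z) = kill_left z"
proof (induction z rule: flie_induct)
  case (Gen x)
  then show ?case by (cases x) simp_all
qed (simp_all add: semi_br_def)

text \<open>The kernel lies in the ideal generated by \<open>'a\<close>, which elimination describes as free on pairs \<open>(w, a)\<close>. There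
  the projection sends \<open>(w, a)\<close> to the result of acting on \<open>a\<close> with the letters of \<open>w\<close>; this fixes the generators
  \<open>([], a)\<close>, and the preceding lemma applies.\<close>

theorem ker_semi_proj_free:
  fixes d :: "'b \<Rightarrow> 'a \<Rightarrow> 'a flie"
  shows "\<exists>f :: 'a list \<times> ('b \<times> 'b list \<times> 'a) \<Rightarrow> ('a + 'b) flie.
    inj (fl_lift f) \<and> range (fl_lift f) = {z. semi_proj d z = 0}"
proof -
  define h where "h = (\<lambda>(w, a). foldr (\<lambda>b. der (d b)) w (fl_gen a))"
  obtain f :: "'a list \<times> ('b \<times> 'b list \<times> 'a) \<Rightarrow> ('b list \<times> 'a) flie" where
    f: "inj (fl_lift f)" "range (fl_lift f) = {u. fl_lift h u = 0}"
    using ker_retraction_free[of h] by (auto simp: h_def)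
  have word: "semi_proj d (ad_word w (fl_gen (Inl a))) = (h (w, a), 0)" for w a
    by (induction w) (simp_all add: h_def semi_br_def)
  have emb: "semi_proj d (elim_emb u) = (fl_lift h u, 0)" for u
  proof (induction u rule: flie_induct)
    case (Gen p)
    then show ?case by (cases p) (simp add: word)
  qed (simp_all add: prod_eq_iff semi_br_def)
  define g where "g i = elim_emb (f i)" for i
  have g: "fl_lift g u = elim_emb (fl_lift f u)" for u
    by (induction u rule: flie_induct) (simp_all add: g_def)
  have "inj (fl_lift g)"
    unfolding g inj_def by (metis f(1) elim_emb_inj injD)
  moreover have "range (fl_lift g) = {z. semi_proj d z = 0}"
  proof safe
    fix v
    have "fl_lift h (fl_lift f v) = 0" using f(2) by blast
    then show "semi_proj d (fl_lift g v) = 0" by (simp add: g emb prod_eq_iff)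
  next
    fix z assume z: "semi_proj d z = 0"
    then have "kill_left z = 0" by (simp flip: snd_semi_proj[of d])
    then obtain u where u: "z = elim_emb u" using elim_emb_range by blast
    then have "fl_lift h u = 0" using z emb[of u] by (simp add: prod_eq_iff)
    then obtain v where "u = fl_lift f v" using f(2) by blast
    then show "z \<in> range (fl_lift g)" using u g by (metis rangeI)
  qed
  ultimately show ?thesis by blast
qed

section \<open>Noncommutative power series\<close>

typedef 'x ncps = "UNIV :: ('x list \<Rightarrow> int) set" morphisms nc_coeff Abs_ncps
  by simp

lemma nc_coeff_Abs [simp]: "nc_coeff (Abs_ncps f) = f"
  by (simp add: Abs_ncps_inverse)

lemma ncps_eqI: "(\<And>w. nc_coeff f w = nc_coeff g w) \<Longrightarrow> f = g"
  by (metis ext nc_coeff_inject)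

text \<open>The coefficient of a word in a product, by recursion on the word: with \<open>(\<partial>\<^sub>x f) v = f (x v)\<close> one has
  \<open>(f g)(x w) = f(1) g(x w) + ((\<partial>\<^sub>x f) g)(w)\<close>. The laws of the product become inductions over words in which the left
  factor varies.\<close>

primrec conv_at :: "'x list \<Rightarrow> ('x list \<Rightarrow> int) \<Rightarrow> ('x list \<Rightarrow> int) \<Rightarrow> int" where
  "conv_at [] f g = f [] * g []"
| "conv_at (x # w) f g = f [] * g (x # w) + conv_at w (\<lambda>v. f (x # v)) g"

lemma conv_at_add_left: "conv_at w (\<lambda>v. f v + f' v) g = conv_at w f g + conv_at w f' g"
  by (induction w arbitrary: f f') (simp_all add: algebra_simps)

lemma conv_at_add_right: "conv_at w f (\<lambda>v. g v + g' v) = conv_at w f g + conv_at w f g'"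
  by (induction w arbitrary: f) (simp_all add: algebra_simps)

lemma conv_at_scale_left: "conv_at w (\<lambda>v. c * f v) g = c * conv_at w f g"
  by (induction w arbitrary: f) (simp_all add: algebra_simps)

lemma conv_at_zero_left: "conv_at w (\<lambda>_. 0) g = 0"
  by (induction w) simp_all

lemma conv_at_assoc:
  "conv_at w (\<lambda>v. conv_at v f g) h = conv_at w f (\<lambda>v. conv_at v g h)"
proof (induction w arbitrary: f)
  case (Cons x w)
  show ?case
    by (simp add: conv_at_add_left conv_at_scale_left Cons algebra_simps)
qed simp

lemma conv_at_one_left: "conv_at w (\<lambda>v. if v = [] then 1 else 0) g = g w"
  by (cases w) (simp_all add: conv_at_zero_left)

lemma conv_at_one_right: "conv_at w f (\<lambda>v. if v = [] then 1 else 0) = f w"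
  by (induction w arbitrary: f) simp_all

instantiation ncps :: (type) ring_1
begin
definition "0 = Abs_ncps (\<lambda>_. 0)"
definition "1 = Abs_ncps (\<lambda>v. if v = [] then 1 else 0)"
definition "f + g = Abs_ncps (\<lambda>w. nc_coeff f w + nc_coeff g w)"
definition "- f = Abs_ncps (\<lambda>w. - nc_coeff f w)"
definition "f - g = Abs_ncps (\<lambda>w. nc_coeff f w - nc_coeff g w)"
definition "f * g = Abs_ncps (\<lambda>w. conv_at w (nc_coeff f) (nc_coeff g))"

lemma nc_coeff_simps [simp]:
  "nc_coeff 0 w = 0" "nc_coeff (f + g) w = nc_coeff f w + nc_coeff g w"
  "nc_coeff (- f) w = - nc_coeff f w" "nc_coeff (f - g) w = nc_coeff f w - nc_coeff g w"
  and nc_coeff_one: "nc_coeff 1 w = (if w = [] then 1 else 0)"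
  and nc_coeff_mult: "nc_coeff (f * g) w = conv_at w (nc_coeff f) (nc_coeff g)"
  by (simp_all add: zero_ncps_def one_ncps_def plus_ncps_def uminus_ncps_def minus_ncps_def
      times_ncps_def)

instance
proof
  fix a b c :: "'a ncps"
  show "a * b * c = a * (b * c)"
    by (rule ncps_eqI) (simp add: nc_coeff_mult[abs_def] conv_at_assoc)
  show "1 * a = a" "a * 1 = a"
    by (rule ncps_eqI, simp add: nc_coeff_mult nc_coeff_one[abs_def] conv_at_one_left conv_at_one_right)+
  show "(a + b) * c = a * c + b * c" "a * (b + c) = a * b + a * c"
    by (rule ncps_eqI, simp add: nc_coeff_mult nc_coeff_simps(2)[abs_def] conv_at_add_left conv_at_add_right)+
  show "(0 :: 'a ncps) \<noteq> 1"
    by (metis nc_coeff_one nc_coeff_simps(1) zero_neq_one)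
qed (rule ncps_eqI; simp)+

end

lemma nc_coeff_mult_Nil [simp]: "nc_coeff (f * g) [] = nc_coeff f [] * nc_coeff g []"
  by (simp add: nc_coeff_mult)

definition nc_var :: "'x \<Rightarrow> 'x ncps" where
  "nc_var x = Abs_ncps (\<lambda>w. if w = [x] then 1 else 0)"

lemma nc_coeff_var: "nc_coeff (nc_var x) w = (if w = [x] then 1 else 0)"
  by (simp add: nc_var_def)

lemma nc_var_mult_coeff:
  "nc_coeff (nc_var y * a) w = (case w of [] \<Rightarrow> 0 | x # v \<Rightarrow> if x = y then nc_coeff a v else 0)"
proof (cases w)
  case (Cons x v)
  have "(\<lambda>v. nc_coeff (nc_var y) (x # v)) = (\<lambda>v. if x = y then if v = [] then 1 else 0 else 0)"
    by (auto simp: nc_coeff_var)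
  then show ?thesis
    by (cases "x = y") (simp_all add: Cons nc_coeff_mult conv_at_one_left conv_at_zero_left nc_coeff_var)
qed (simp add: nc_coeff_var)

lemma mult_nc_var_coeff:
  "nc_coeff (a * nc_var y) (w @ [x]) = (if x = y then nc_coeff a w else 0)"
proof -
  have "conv_at (w @ [x]) f (nc_coeff (nc_var y)) = (if x = y then f w else 0)" for f
    by (induction w arbitrary: f) (auto simp: nc_coeff_var)
  then show ?thesis by (simp add: nc_coeff_mult)
qed

text \<open>\<open>low n f\<close> says that \<open>f\<close> has no terms of degree below \<open>n\<close>, \<open>pure n f\<close> that it is homogeneous of degree \<open>n\<close>.\<close>

definition low :: "nat \<Rightarrow> 'x ncps \<Rightarrow> bool" where
  "low n f \<longleftrightarrow> (\<forall>w. length w < n \<longrightarrow> nc_coeff f w = 0)"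

definition pure :: "nat \<Rightarrow> 'x ncps \<Rightarrow> bool" where
  "pure n f \<longleftrightarrow> (\<forall>w. length w \<noteq> n \<longrightarrow> nc_coeff f w = 0)"

lemma conv_at_low:
  assumes "\<And>v. length v < m \<Longrightarrow> f v = 0" "\<And>v. length v < n \<Longrightarrow> g v = 0" "length w < m + n"
  shows "conv_at w f g = 0"
  using assms(1,3)
proof (induction w arbitrary: f m)
  case Nil
  then show ?case using assms(2)[of "[]"] by (cases m) auto
next
  case (Cons x w)
  have "f [] * g (x # w) = 0"
    using Cons.prems assms(2)[of "x # w"] by (cases m) auto
  moreover have "conv_at w (\<lambda>v. f (x # v)) g = 0"
    by (rule Cons.IH[of "m - 1"]) (use Cons.prems in auto)
  ultimately show ?case by simp
qed

lemma conv_at_top: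
  assumes "\<And>v. length v < m \<Longrightarrow> f v = 0" "\<And>v. length v < n \<Longrightarrow> g v = 0" "length w = m + n"
  shows "conv_at w f g = f (take m w) * g (drop m w)"
  using assms(1,3)
proof (induction m arbitrary: f w)
  case 0
  show ?case
  proof (cases w)
    case (Cons x v)
    have "conv_at v (\<lambda>v. f (x # v)) g = 0"
      by (rule conv_at_low[of 0 _ n]) (use 0 Cons assms(2) in auto)
    then show ?thesis by (simp add: Cons)
  qed simp
next
  case (Suc m)
  then obtain x v where w: "w = x # v" by (cases w) auto
  have "f [] = 0" using Suc.prems(1)[of "[]"] by simp
  then show ?case using Suc by (simp add: w)
qed

lemma low_mult: "low m f \<Longrightarrow> low n g \<Longrightarrow> low (m + n) (f * g)"
  by (auto simp: low_def nc_coeff_mult intro: conv_at_low[of m _ n])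

lemma low_mult_top:
  "low m f \<Longrightarrow> low n g \<Longrightarrow> length w = m + n
    \<Longrightarrow> nc_coeff (f * g) w = nc_coeff f (take m w) * nc_coeff g (drop m w)"
  by (auto simp: low_def nc_coeff_mult intro: conv_at_top[of m _ n])

lemma low_simps [intro]:
  "low n f \<Longrightarrow> low n g \<Longrightarrow> low n (f + g)" "low n f \<Longrightarrow> low n (- f)"
  "low n f \<Longrightarrow> low n g \<Longrightarrow> low n (f - g)" "low 0 f" "low n 0" "pure n f \<Longrightarrow> low n f"
  by (auto simp: low_def pure_def)

lemma low_mono: "low n f \<Longrightarrow> m \<le> n \<Longrightarrow> low m f"
  by (auto simp: low_def)

lemma low_Suc_iff: "low (Suc n) f \<longleftrightarrow> low n f \<and> (\<forall>w. length w = n \<longrightarrow> nc_coeff f w = 0)"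
  by (auto simp: low_def less_Suc_eq)

lemma pure_mult:
  fixes f g :: "'x ncps"
  assumes "pure m f" "pure n g"
  shows "pure (m + n) (f * g)"
proof -
  have "conv_at w f g = 0" if "\<And>v. length v \<noteq> m \<Longrightarrow> f v = 0" "\<And>v. length v \<noteq> n \<Longrightarrow> g v = 0"
    "length w \<noteq> m + n" for f g :: "'x list \<Rightarrow> int" and w
    using that(1,3)
  proof (induction w arbitrary: f m)
    case Nil
    then show ?case using that(2)[of "[]"] by (cases m) auto
  next
    case (Cons x w)
    have "f [] * g (x # w) = 0"
      using Cons.prems that(2)[of "x # w"] by (cases m) auto
    moreover have "conv_at w (\<lambda>v. f (x # v)) g = 0"
    proof (cases m)
      case 0
      then have "(\<lambda>v. f (x # v)) = (\<lambda>_. 0)" using Cons.prems by auto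
      then show ?thesis by (simp add: conv_at_zero_left)
    next
      case (Suc k)
      show ?thesis by (rule Cons.IH[of k]) (use Suc Cons.prems in auto)
    qed
    ultimately show ?case by simp
  qed
  then show ?thesis using assms
    by (simp add: pure_def nc_coeff_mult)
qed

section \<open>The free Lie ring inside the power series\<close>

lemma lie_bracket_commutator: "lie_bracket (\<lambda>a b. a * b - b * a :: 'a::ring_1)"
  by unfold_locales (simp_all add: algebra_simps)

global_interpretation nc: lie_bracket "\<lambda>a b. a * b - b * a :: 'x ncps"
  defines nc_ev = nc.ev
  by (rule lie_bracket_commutator)

definition nc_lie :: "'x flie \<Rightarrow> 'x ncps" where
  "nc_lie = nc_ev nc_var"

lemma nc_lie_simps [simp]:
  "nc_lie (fl_gen x) = nc_var x" "nc_lie 0 = 0" "nc_lie (u + v) = nc_lie u + nc_lie v"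
  "nc_lie (- u) = - nc_lie u" "nc_lie (u \<diamondop> v) = nc_lie u * nc_lie v - nc_lie v * nc_lie u"
  "nc_lie (sum f A) = (\<Sum>a\<in>A. nc_lie (f a))"
  by (simp_all add: nc_lie_def nc.ev_sum)

lemma homog_pure: "homog n u \<Longrightarrow> pure n (nc_lie u)"
proof (induction rule: homog.induct)
  case (homog_br m u n v)
  then have "pure (m + n) (nc_lie u * nc_lie v)" "pure (m + n) (nc_lie v * nc_lie u)"
    using pure_mult[of n "nc_lie v" m "nc_lie u"] by (auto intro: pure_mult simp: add.commute)
  then show ?case by (simp add: pure_def)
qed (auto simp: pure_def nc_coeff_var)

definition zmul :: "int \<Rightarrow> 'x flie \<Rightarrow> 'x flie" where
  "zmul k u = (if k \<ge> 0 then \<Sum>i<nat k. u else - (\<Sum>i<nat (- k). u))"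

lemma zmul_simps [simp]: "zmul 0 u = 0" "zmul 1 u = u" "zmul k 0 = 0"
  by (simp_all add: zmul_def)

lemma zmul_succ: "zmul (k + 1) u = zmul k u + u"
proof -
  consider "k \<ge> 0" | "k = -1" | "k < -1" by linarith
  then show ?thesis
  proof cases
    case 1
    then have "nat (k + 1) = Suc (nat k)" by simp
    then show ?thesis using 1 by (simp add: zmul_def)
  next
    case 3
    then have "nat (- k) = Suc (nat (- (k + 1)))" by simp
    then show ?thesis using 3 by (simp add: zmul_def)
  qed (simp add: zmul_def)
qed

lemma zmul_add: "zmul (j + k) u = zmul j u + zmul k u"
proof (induction k rule: int_induct[where k = 0])
  case (step1 k)
  then show ?case using zmul_succ[of "j + k" u] zmul_succ[of k u] by (simp add: algebra_simps)
next
  case (step2 k)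
  then show ?case
    using zmul_succ[of "j + (k - 1)" u] zmul_succ[of "k - 1" u] by (simp add: algebra_simps)
qed simp

lemma zmul_neg: "zmul (- k) u = - zmul k u"
  using zmul_add[of "- k" k u] by (simp add: eq_neg_iff_add_eq_0)

lemma br_zmul: "x \<diamondop> zmul k u = zmul k (x \<diamondop> u)"
  by (simp add: zmul_def br_sum_right)

fun word_br :: "'x list \<Rightarrow> 'x flie" where
  "word_br [] = 0"
| "word_br [x] = fl_gen x"
| "word_br (x # w) = fl_gen x \<diamondop> word_br w"

text \<open>The Dynkin operator in degree \<open>n\<close>: every word is replaced by its right-normed bracket. The value of
  \<open>word_br\<close> at the empty word is a default that only degree \<open>0\<close> sees.\<close>

definition dynkin :: "nat \<Rightarrow> ('x::finite) ncps \<Rightarrow> 'x flie" where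
  "dynkin n f = (\<Sum>w | length w = n. zmul (nc_coeff f w) (word_br w))"

lemma finite_words: "finite {w :: 'x::finite list. length w = n}"
  using finite_lists_length_eq[of "UNIV :: 'x set" n] by simp

lemma dynkin_simps [simp]:
  "dynkin n 0 = 0" "dynkin n (f + g) = dynkin n f + dynkin n g" "dynkin n (- f) = - dynkin n f"
  "dynkin n (f - g) = dynkin n f - dynkin n g"
proof -
  show add: "dynkin n (f + g) = dynkin n f + dynkin n g" for f g
    by (simp add: dynkin_def zmul_add sum.distrib)
  show neg: "dynkin n (- f) = - dynkin n f" for f
    by (simp add: dynkin_def zmul_neg sum_negf)
  show "dynkin n (f - g) = dynkin n f - dynkin n g"
    using add[of f "- g"] neg[of g] by simp
qed (simp add: dynkin_def)

lemma dynkin_var: "dynkin (Suc 0) (nc_var x) = fl_gen x"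
proof -
  have "dynkin (Suc 0) (nc_var x) = (\<Sum>w\<in>{[x]}. zmul (nc_coeff (nc_var x) w) (word_br w))"
    unfolding dynkin_def
    by (rule sum.mono_neutral_right) (auto simp: nc_coeff_var finite_words simp del: One_nat_def)
  then show ?thesis by (simp add: nc_coeff_var)
qed

lemma dynkin_var_mult:
  assumes "n > 0"
  shows "dynkin (Suc n) (nc_var x * a) = fl_gen x \<diamondop> dynkin n a"
proof -
  have "dynkin (Suc n) (nc_var x * a)
      = (\<Sum>w\<in>(#) x ` {w. length w = n}. zmul (nc_coeff (nc_var x * a) w) (word_br w))"
    unfolding dynkin_def
  proof (rule sum.mono_neutral_right)
    show "\<forall>w\<in>{w. length w = Suc n} - (#) x ` {w. length w = n}.
        zmul (nc_coeff (nc_var x * a) w) (word_br w) = 0"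
      by (auto simp: nc_var_mult_coeff length_Suc_conv)
  qed (auto simp: finite_words)
  also have "\<dots> = (\<Sum>w | length w = n. zmul (nc_coeff a w) (word_br (x # w)))"
    by (subst sum.reindex) (auto simp: nc_var_mult_coeff)
  also have "\<dots> = (\<Sum>w | length w = n. fl_gen x \<diamondop> zmul (nc_coeff a w) (word_br w))"
  proof (rule sum.cong)
    fix w :: "'a list" assume "w \<in> {w. length w = n}"
    then obtain y v where "w = y # v" using assms by (cases w) auto
    then show "zmul (nc_coeff a w) (word_br (x # w)) = fl_gen x \<diamondop> zmul (nc_coeff a w) (word_br w)"
      by (simp add: br_zmul)
  qed simp
  finally show ?thesis by (simp add: dynkin_def br_sum_right)
qed

text \<open>Left multiplication by a Lie element turns into bracketing with it: for a variable by construction of right-normed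
  brackets, and the Jacobi identity passes this on to brackets. The degree \<open>n\<close> is positive because the empty word
  has no bracket.\<close>

lemma dynkin_lie_mult:
  "homog m u \<Longrightarrow> n > 0 \<Longrightarrow> dynkin (m + n) (nc_lie u * a) = u \<diamondop> dynkin n a"
proof (induction arbitrary: n a rule: homog.induct)
  case (homog_gen x)
  then show ?case by (simp add: dynkin_var_mult)
next
  case (homog_br m u n' v)
  have "dynkin (m + n' + n) (nc_lie u * (nc_lie v * a)) = u \<diamondop> (v \<diamondop> dynkin n a)"
    using homog_br.IH(1)[of "n' + n" "nc_lie v * a"] homog_br.IH(2)[of n a] homog_br.prems
    by (simp add: add.assoc)
  moreover have "dynkin (m + n' + n) (nc_lie v * (nc_lie u * a)) = v \<diamondop> (u \<diamondop> dynkin n a)"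
    using homog_br.IH(2)[of "m + n" "nc_lie u * a"] homog_br.IH(1)[of n a] homog_br.prems
    by (simp add: ac_simps)
  ultimately show ?case
    using br_derivation[of u v "dynkin n a"] by (simp add: left_diff_distrib mult.assoc)
qed (simp_all add: distrib_right br_add_left)

text \<open>The theorem of Dynkin, Specht and Wever.\<close>

theorem dynkin_lie: "homog n u \<Longrightarrow> dynkin n (nc_lie u) = (\<Sum>i<n. u)"
proof (induction rule: homog.induct)
  case (homog_gen x)
  then show ?case by (simp add: dynkin_var)
next
  case (homog_br m u n v)
  show ?case
  proof (cases "m = 0 \<or> n = 0")
    case True
    then have "u \<diamondop> v = 0" using homog_br homog_0 by fastforce
    then show ?thesis by (simp del: nc_lie_simps(5))
  next
    case False
    have "dynkin (m + n) (nc_lie u * nc_lie v) = u \<diamondop> (\<Sum>i<n. v)"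
      using dynkin_lie_mult[OF homog_br.hyps(1), of n "nc_lie v"] homog_br.IH False by simp
    moreover have "dynkin (m + n) (nc_lie v * nc_lie u) = v \<diamondop> (\<Sum>i<m. u)"
      using dynkin_lie_mult[OF homog_br.hyps(2), of m "nc_lie u"] homog_br.IH False
      by (simp add: add.commute)
    moreover have "(\<Sum>i<m + n. u \<diamondop> v) = (\<Sum>i<n. u \<diamondop> v) + (\<Sum>i<m. u \<diamondop> v)"
      by (induction n) (simp_all add: algebra_simps)
    ultimately show ?thesis
      by (simp add: br_sum_right br_anti[of v u] sum_negf)
  qed
qed (simp_all add: sum.distrib sum_negf)

text \<open>A multiple of \<open>u\<close> vanishes by the previous theorem, and free Lie rings are torsion-free.\<close>

theorem nc_lie_inj_homog:
  fixes u :: "'x::finite flie"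
  assumes "homog n u" "nc_lie u = 0"
  shows "u = 0"
proof (cases "n = 0")
  case True
  then show ?thesis using assms homog_0 by blast
next
  case False
  have "(\<Sum>i<n. u) = 0" using dynkin_lie[OF assms(1)] assms(2) by simp
  then show ?thesis using flie_torsion_free False by blast
qed

text \<open>If \<open>y\<close> differs from the last letter of \<open>w\<close>, the word \<open>y w\<close> has in \<open>y u\<close> the coefficient that \<open>w\<close> has in \<open>u\<close>,
  and in \<open>u y\<close> the coefficient \<open>0\<close>.\<close>

lemma nc_lie_centre:
  fixes u :: "'x flie"
  assumes "homog n u" "n > 0" and comm: "\<And>x. nc_var x * nc_lie u = nc_lie u * nc_var x"
    and two: "\<And>x :: 'x. \<exists>y. y \<noteq> x"
  shows "nc_lie u = 0"
proof (rule ncps_eqI)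
  fix w
  show "nc_coeff (nc_lie u) w = nc_coeff 0 w"
  proof (cases "length w = n")
    case True
    then obtain v x where w: "w = v @ [x]" using assms(2) by (cases w rule: rev_cases) auto
    obtain y where "y \<noteq> x" using two by blast
    then have "nc_coeff (nc_lie u * nc_var y) ((y # v) @ [x]) = 0"
      by (subst mult_nc_var_coeff) simp
    moreover have "nc_coeff (nc_var y * nc_lie u) ((y # v) @ [x]) = nc_coeff (nc_lie u) w"
      by (simp add: nc_var_mult_coeff w)
    ultimately show ?thesis by (simp add: comm)
  next
    case False
    then show ?thesis using homog_pure[OF assms(1)] by (simp add: pure_def)
  qed
qed

section \<open>The group of power series with constant term one\<close>

definition nc_units :: "'x ncps monoid" where
  "nc_units = \<lparr>carrier = {a. nc_coeff a [] = 1 \<and> (\<exists>b. nc_coeff b [] = 1 \<and> a * b = 1 \<and> b * a = 1)},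
    monoid.mult = (*), one = 1\<rparr>"

lemma nc_units_simps [simp]: "monoid.mult nc_units = (*)" "one nc_units = 1"
  by (simp_all add: nc_units_def)

lemma group_nc_units: "group nc_units"
proof (rule groupI)
  fix a b :: "'a ncps" assume "a \<in> carrier nc_units" "b \<in> carrier nc_units"
  then obtain a' b' where *: "nc_coeff a [] = 1" "nc_coeff b [] = 1" "nc_coeff a' [] = 1"
    "nc_coeff b' [] = 1" "a * a' = 1" "a' * a = 1" "b * b' = 1" "b' * b = 1"
    by (auto simp: nc_units_def)
  have "a * b * (b' * a') = a * (b * b') * a'" "b' * a' * (a * b) = b' * (a' * a) * b"
    by (simp_all add: mult.assoc)
  with * show "a \<otimes>\<^bsub>nc_units\<^esub> b \<in> carrier nc_units"
    by (auto simp: nc_units_def intro!: exI[of _ "b' * a'"])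
  show "\<exists>y\<in>carrier nc_units. y \<otimes>\<^bsub>nc_units\<^esub> a = \<one>\<^bsub>nc_units\<^esub>"
    using * by (intro bexI[of _ a']) (auto simp: nc_units_def)
qed (auto simp: nc_units_def nc_coeff_one mult.assoc intro!: exI[of _ 1])

definition nc_low :: "nat \<Rightarrow> 'x ncps set" where
  "nc_low n = {a \<in> carrier nc_units. low n (a - 1)}"

text \<open>\<open>leads n a u\<close> says that \<open>a\<close> is \<open>1\<close> plus the Lie element \<open>u\<close> of degree \<open>n\<close> plus terms of higher degree. Group
  operations on series then correspond to Lie operations on their leading terms.\<close>

definition leads :: "nat \<Rightarrow> 'x ncps \<Rightarrow> 'x flie \<Rightarrow> bool" where
  "leads n a u \<longleftrightarrow> a \<in> nc_low n \<and> (\<forall>w. length w = n \<longrightarrow> nc_coeff (a - 1) w = nc_coeff (nc_lie u) w)"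

lemma leads_iff: "homog n u \<Longrightarrow> leads n a u \<longleftrightarrow> a \<in> carrier nc_units \<and> low (Suc n) (a - 1 - nc_lie u)"
  using homog_pure[of n u] by (auto simp: leads_def nc_low_def low_def pure_def less_Suc_eq)

lemma nc_units_inv:
  fixes a :: "'x ncps"
  assumes "a \<in> carrier nc_units"
  shows "inv\<^bsub>nc_units\<^esub> a \<in> carrier nc_units" "a * inv\<^bsub>nc_units\<^esub> a = 1" "inv\<^bsub>nc_units\<^esub> a * a = 1"
proof -
  interpret U: group "nc_units :: 'x ncps monoid" by (rule group_nc_units)
  show "inv\<^bsub>nc_units\<^esub> a \<in> carrier nc_units" "a * inv\<^bsub>nc_units\<^esub> a = 1" "inv\<^bsub>nc_units\<^esub> a * a = 1"
    using U.inv_closed[OF assms] U.r_inv[OF assms] U.l_inv[OF assms] by simp_all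
qed

lemma nc_units_low_1: "a \<in> carrier nc_units \<Longrightarrow> low (Suc 0) (a - 1)"
  by (auto simp: nc_units_def low_def nc_coeff_one)

lemma nc_units_mult_low:
  assumes "a \<in> carrier nc_units" "low n f"
  shows "low n (a * f)" "low (Suc n) (a * f - f)"
proof -
  have "low (Suc n) ((a - 1) * f)"
    using low_mult[OF nc_units_low_1[OF assms(1)] assms(2)] by simp
  moreover have "(a - 1) * f = a * f - f" by (simp add: algebra_simps)
  ultimately show *: "low (Suc n) (a * f - f)" by simp
  show "low n (a * f)" using low_simps(1)[OF low_mono[OF *, of n] assms(2)] by simp
qed

lemma leads_gen:
  assumes "1 + nc_var x \<in> carrier nc_units"
  shows "leads 1 (1 + nc_var x) (fl_gen x)"
  using assms by (auto simp: leads_def nc_low_def low_def nc_coeff_var)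

lemma leads_one: "leads n 1 0"
  using group.is_monoid[OF group_nc_units, THEN monoid.one_closed]
  by (auto simp: leads_def nc_low_def low_def)

lemma leads_mult:
  assumes "leads n a u" "leads n b v" "homog n u" "homog n v" "n > 0"
  shows "leads n (a * b) (u + v)"
proof -
  have ab: "a \<in> carrier nc_units" "b \<in> carrier nc_units"
    and l: "low (Suc n) (a - 1 - nc_lie u)" "low (Suc n) (b - 1 - nc_lie v)"
    using assms by (auto simp: leads_iff)
  have "low n (b - 1)" using assms by (simp add: leads_def nc_low_def)
  from nc_units_mult_low(2)[OF ab(1) this]
  have "low (Suc n) (a * (b - 1) - (b - 1))" .
  then have "low (Suc n) ((a * (b - 1) - (b - 1)) + (a - 1 - nc_lie u) + (b - 1 - nc_lie v))"
    by (rule low_simps(1)[OF low_simps(1)[OF _ l(1)] l(2)])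
  moreover have "a * b - 1 - nc_lie (u + v)
      = (a * (b - 1) - (b - 1)) + (a - 1 - nc_lie u) + (b - 1 - nc_lie v)"
    by (simp add: algebra_simps)
  ultimately have "low (Suc n) (a * b - 1 - nc_lie (u + v))" by (simp only:)
  moreover have "a * b \<in> carrier nc_units"
    using group.is_monoid[OF group_nc_units, THEN monoid.m_closed, OF ab] by simp
  ultimately show ?thesis using assms by (simp add: leads_iff homog_add)
qed

lemma leads_inv:
  assumes "leads n a u" "homog n u"
  shows "leads n (inv\<^bsub>nc_units\<^esub> a) (- u)"
proof -
  have a: "a \<in> carrier nc_units" and l: "low (Suc n) (a - 1 - nc_lie u)"
    using assms by (auto simp: leads_iff)
  let ?b = "inv\<^bsub>nc_units\<^esub> a"
  have "low n (a - 1)" using assms by (simp add: leads_def nc_low_def)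
  from nc_units_mult_low(2)[OF nc_units_inv(1)[OF a] this]
  have "low (Suc n) (?b * (a - 1) - (a - 1))" .
  moreover have "?b * (a - 1) = 1 - ?b" using nc_units_inv[OF a] by (simp add: right_diff_distrib)
  then have "?b - 1 - nc_lie (- u) = - (?b * (a - 1) - (a - 1)) - (a - 1 - nc_lie u)"
    by simp
  ultimately have "low (Suc n) (?b - 1 - nc_lie (- u))" using l by (simp only:) blast
  then show ?thesis using assms nc_units_inv(1)[OF a] by (simp add: leads_iff homog_neg)
qed

text \<open>The commutator \<open>c\<close> satisfies \<open>a b - b a = b a (c - 1)\<close>, and multiplying by \<open>(b a)\<inverse>\<close>, a series with constant
  term \<open>1\<close>, does not change leading terms.\<close>

lemma nc_commutator:
  assumes "a \<in> carrier nc_units" "b \<in> carrier nc_units"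
  defines "c \<equiv> commutator nc_units a b" and "q \<equiv> (a - 1) * (b - 1) - (b - 1) * (a - 1)"
  shows "c \<in> carrier nc_units" "low n q \<Longrightarrow> low n (c - 1) \<and> low (Suc n) (c - 1 - q)"
proof -
  let ?a = "inv\<^bsub>nc_units\<^esub> a" and ?b = "inv\<^bsub>nc_units\<^esub> b"
  note ia = nc_units_inv[OF assms(1)] and ib = nc_units_inv[OF assms(2)]
  have c: "c = ?a * ?b * a * b" by (simp add: c_def commutator_def)
  have closed: "x * y \<in> carrier nc_units" if "x \<in> carrier nc_units" "y \<in> carrier nc_units" for x y :: "'a ncps"
    using group.is_monoid[OF group_nc_units, THEN monoid.m_closed, OF that] by simp
  show "c \<in> carrier nc_units" unfolding c by (intro closed ia ib assms)
  have ba: "?a * ?b \<in> carrier nc_units" by (intro closed ia ib)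
  \<comment> \<open>The product \<open>a\<inverse> b\<inverse>\<close> is the inverse of \<open>b a\<close>.\<close>
  have "(?a * ?b) * (b * a) = 1"
    using ia ib by (metis mult.assoc mult_1_right)
  then have "c - 1 = (?a * ?b) * (a * b - b * a)"
    by (simp add: c right_diff_distrib mult.assoc)
  also have "a * b - b * a = q" by (simp add: q_def algebra_simps)
  finally show "low n (c - 1) \<and> low (Suc n) (c - 1 - q)" if "low n q"
    using nc_units_mult_low[OF ba that] by simp
qed

lemma nc_low_commutator:
  assumes "a \<in> nc_low m" "b \<in> nc_low n"
  shows "commutator nc_units a b \<in> nc_low (m + n)"
proof -
  have "low (m + n) ((a - 1) * (b - 1))" "low (m + n) ((b - 1) * (a - 1))"
    using assms low_mult[of n "b - 1" m "a - 1"] by (auto simp: nc_low_def low_mult add.commute)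
  then show ?thesis
    using nc_commutator(1)[of a b] nc_commutator(2)[of a b "m + n"] assms by (auto simp: nc_low_def)
qed

lemma leads_commutator:
  fixes u v :: "'x flie"
  assumes "leads m a u" "leads n b v" "homog m u" "homog n v"
  shows "leads (m + n) (commutator nc_units a b) (u \<diamondop> v)"
proof -
  have top: "nc_coeff ((a - 1) * (b - 1)) w = nc_coeff (nc_lie u * nc_lie v) w"
    if "leads m a u" "leads n b v" "homog m u" "homog n v" "length w = m + n" for m n a b w and u v :: "'x flie"
    using that homog_pure[of m u] homog_pure[of n v]
    by (simp add: leads_def nc_low_def low_mult_top[of m _ n] low_simps(6))
  let ?q = "(a - 1) * (b - 1) - (b - 1) * (a - 1)"
  have "low (m + n) ((a - 1) * (b - 1))" "low (m + n) ((b - 1) * (a - 1))"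
    using assms low_mult[of n "b - 1" m "a - 1"] by (auto simp: nc_low_def leads_def low_mult add.commute)
  then have q: "low (m + n) ?q" by auto
  have mem: "a \<in> carrier nc_units" "b \<in> carrier nc_units"
    using assms by (auto simp: leads_def nc_low_def)
  have "nc_coeff (commutator nc_units a b - 1) w = nc_coeff (nc_lie (u \<diamondop> v)) w" if "length w = m + n" for w
    using nc_commutator(2)[OF mem q] that top[OF assms that] top[OF assms(2,1,4,3), of w]
    by (simp add: low_Suc_iff add.commute)
  then show ?thesis
    using nc_commutator[OF mem] q by (auto simp: leads_def nc_low_def)
qed

lemma subgroup_nc_low: "subgroup (nc_low n) nc_units"
proof (rule group.subgroupI[OF group_nc_units])
  show "nc_low n \<subseteq> carrier nc_units" by (auto simp: nc_low_def)
  show "(nc_low n :: 'a ncps set) \<noteq> {}"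
    using leads_one[of n] by (auto simp: leads_def)
next
  fix a b :: "'a ncps" assume a: "a \<in> nc_low n" and b: "b \<in> nc_low n"
  have "inv\<^bsub>nc_units\<^esub> a * (a - 1) = 1 - inv\<^bsub>nc_units\<^esub> a"
    using nc_units_inv[of a] a by (simp add: right_diff_distrib nc_low_def)
  moreover have "low n (inv\<^bsub>nc_units\<^esub> a * (a - 1))"
    using a by (intro nc_units_mult_low nc_units_inv) (auto simp: nc_low_def)
  ultimately have "low n (- (1 - inv\<^bsub>nc_units\<^esub> a))" by (metis low_simps(2))
  then show "inv\<^bsub>nc_units\<^esub> a \<in> nc_low n"
    using a nc_units_inv(1)[of a] by (simp add: nc_low_def)
  have "low n (a * (b - 1))" using a b by (intro nc_units_mult_low) (auto simp: nc_low_def)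
  then have "low n (a * (b - 1) + (a - 1))"
    by (rule low_simps(1)) (use a in \<open>simp add: nc_low_def\<close>)
  moreover have "a * b - 1 = a * (b - 1) + (a - 1)" by (simp add: algebra_simps)
  ultimately have "low n (a * b - 1)" by (simp only:)
  then show "a \<otimes>\<^bsub>nc_units\<^esub> b \<in> nc_low n"
    using group.is_monoid[OF group_nc_units, THEN monoid.m_closed, of a b] a b by (simp add: nc_low_def)
qed

section \<open>Commutator calculus\<close>

context group
begin

lemma cancel_left [simp]:
  "x \<in> carrier G \<Longrightarrow> y \<in> carrier G \<Longrightarrow> inv x \<otimes> (x \<otimes> y) = y"
  "x \<in> carrier G \<Longrightarrow> y \<in> carrier G \<Longrightarrow> x \<otimes> (inv x \<otimes> y) = y"
  by (simp_all flip: m_assoc)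

lemma commutator_closed [simp]:
  "a \<in> carrier G \<Longrightarrow> b \<in> carrier G \<Longrightarrow> commutator G a b \<in> carrier G"
  by (simp add: commutator_def)

lemma commutator_inv:
  "a \<in> carrier G \<Longrightarrow> b \<in> carrier G \<Longrightarrow> inv (commutator G a b) = commutator G b a"
  by (simp add: commutator_def inv_mult_group m_assoc)

lemma commutator_mult_left:
  assumes [simp]: "a \<in> carrier G" "a' \<in> carrier G" "b \<in> carrier G"
  shows "commutator G (a \<otimes> a') b = inv a' \<otimes> commutator G a b \<otimes> a' \<otimes> commutator G a' b"
  by (simp add: commutator_def inv_mult_group m_assoc)

lemma commutator_mult_right:
  assumes [simp]: "a \<in> carrier G" "b \<in> carrier G" "b' \<in> carrier G"
  shows "commutator G a (b \<otimes> b') = commutator G a b' \<otimes> (inv b' \<otimes> commutator G a b \<otimes> b')"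
  by (simp add: commutator_def inv_mult_group m_assoc)

lemma commutator_inv_right:
  assumes [simp]: "a \<in> carrier G" "b \<in> carrier G"
  shows "commutator G a (inv b) = b \<otimes> inv (commutator G a b) \<otimes> inv b"
  by (simp add: commutator_def inv_mult_group m_assoc)

lemma Hall_Witt:
  assumes [simp]: "a \<in> carrier G" "b \<in> carrier G" "c \<in> carrier G"
  shows "inv b \<otimes> commutator G (commutator G a (inv b)) c \<otimes> b
    \<otimes> (inv c \<otimes> commutator G (commutator G b (inv c)) a \<otimes> c)
    \<otimes> (inv a \<otimes> commutator G (commutator G c (inv a)) b \<otimes> a) = \<one>"
  by (simp add: commutator_def inv_mult_group m_assoc)

lemma conj_commutator:
  assumes [simp]: "g \<in> carrier G" "a \<in> carrier G" "b \<in> carrier G"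
  shows "g \<otimes> commutator G a b \<otimes> inv g
    = commutator G (g \<otimes> a \<otimes> inv g) (g \<otimes> b \<otimes> inv g)"
  by (simp add: commutator_def inv_mult_group m_assoc)

lemma lower_central_normal: "lower_central G c \<lhd> G"
proof (induction c rule: lower_central.induct[of "\<lambda>_ c. lower_central G c \<lhd> G" G, simplified])
  fix c
  assume "lower_central G (Suc c) \<lhd> G"
  then interpret N: normal "lower_central G (Suc c)" G .
  let ?S = "{commutator G a b |a b. a \<in> lower_central G (Suc c) \<and> b \<in> carrier G}"
  have S: "?S \<subseteq> carrier G" using N.subset by auto
  have conj: "g \<otimes> h \<otimes> inv g \<in> generate G ?S" if g: "g \<in> carrier G" and h: "h \<in> generate G ?S" for g h
    using h
  proof induction
    case one
    then show ?case using g generate.one by simp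
  next
    case (incl h)
    then obtain a b where ab: "h = commutator G a b" "a \<in> lower_central G (Suc c)" "b \<in> carrier G"
      by blast
    then have "g \<otimes> h \<otimes> inv g = commutator G (g \<otimes> a \<otimes> inv g) (g \<otimes> b \<otimes> inv g)"
      using g N.subset by (auto intro: conj_commutator)
    then show ?case
      using ab g N.inv_op_closed2 by (auto intro!: generate.incl)
  next
    case (inv h)
    then obtain a b where ab: "h = commutator G a b" "a \<in> lower_central G (Suc c)" "b \<in> carrier G"
      by blast
    then have a: "a \<in> carrier G" using N.subset by auto
    have "g \<otimes> inv h \<otimes> inv g = inv (commutator G (g \<otimes> a \<otimes> inv g) (g \<otimes> b \<otimes> inv g))"
      using g a ab by (simp flip: conj_commutator) (simp add: inv_mult_group m_assoc)
    then show ?case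
      using ab g N.inv_op_closed2 by (auto intro!: generate.inv)
  next
    case (eng h1 h2)
    have "h1 \<in> carrier G" "h2 \<in> carrier G"
      using eng generate_in_carrier[OF S] by auto
    then have "g \<otimes> (h1 \<otimes> h2) \<otimes> inv g = (g \<otimes> h1 \<otimes> inv g) \<otimes> (g \<otimes> h2 \<otimes> inv g)"
      using g by (simp add: m_assoc)
    then show ?case using generate.eng[OF eng.IH] by simp
  qed
  show "generate G ?S \<lhd> G"
    unfolding normal_inv_iff using generate_is_subgroup[OF S] conj by blast
qed (rule normal_self)+

lemma lower_central_subgroup: "subgroup (lower_central G c) G"
  using lower_central_normal normal_imp_subgroup by blast

lemma lower_central_carrier: "a \<in> lower_central G c \<Longrightarrow> a \<in> carrier G"
  using subgroup.subset[OF lower_central_subgroup] by blast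

lemma lower_central_closed:
  "a \<in> lower_central G c \<Longrightarrow> b \<in> lower_central G c \<Longrightarrow> a \<otimes> b \<in> lower_central G c"
  "a \<in> lower_central G c \<Longrightarrow> inv a \<in> lower_central G c"
  "\<one> \<in> lower_central G c"
  "g \<in> carrier G \<Longrightarrow> a \<in> lower_central G c \<Longrightarrow> inv g \<otimes> a \<otimes> g \<in> lower_central G c"
  "g \<in> carrier G \<Longrightarrow> a \<in> lower_central G c \<Longrightarrow> g \<otimes> a \<otimes> inv g \<in> lower_central G c"
  using lower_central_subgroup[of c] lower_central_normal[of c]
  by (auto simp: subgroup_def intro: normal.inv_op_closed1 normal.inv_op_closed2)

lemma lower_central_one [simp]: "lower_central G 1 = carrier G"
  by simp

lemma lower_central_commutator_carrier:
  "c \<ge> 1 \<Longrightarrow> a \<in> lower_central G c \<Longrightarrow> b \<in> carrier G \<Longrightarrow> commutator G a b \<in> lower_central G (Suc c)"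
  by (cases c) (auto intro: generate.incl)

lemma lower_central_Suc_minimal:
  assumes "c \<ge> 1" "subgroup N G"
    "\<And>a b. a \<in> lower_central G c \<Longrightarrow> b \<in> carrier G \<Longrightarrow> commutator G a b \<in> N"
  shows "lower_central G (Suc c) \<subseteq> N"
proof -
  obtain c' where c: "c = Suc c'" using assms(1) by (cases c) auto
  show ?thesis
    unfolding c lower_central.simps by (rule generate_subgroup_incl[OF _ assms(2)]) (use assms(3) c in auto)
qed

lemma lower_central_Suc_subset: "lower_central G (Suc c) \<subseteq> lower_central G c"
proof (cases "c = 0")
  case False
  then show ?thesis
  proof (intro lower_central_Suc_minimal lower_central_subgroup)
    fix a b assume ab: "a \<in> lower_central G c" "b \<in> carrier G"
    then have "commutator G a b = inv a \<otimes> (inv b \<otimes> a \<otimes> b)"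
      using lower_central_carrier by (simp add: commutator_def m_assoc)
    then show "commutator G a b \<in> lower_central G c"
      using ab by (simp add: lower_central_closed)
  qed simp
qed simp

lemma lower_central_antimono: "c \<le> d \<Longrightarrow> lower_central G d \<subseteq> lower_central G c"
  by (rule lift_Suc_antimono_le[of "lower_central G"]) (auto simp: lower_central_Suc_subset simp del: lower_central.simps)

text \<open>Induction on \<open>d\<close> by the three subgroups argument: for \<open>b = (x, y)\<close> with \<open>x\<close> in the \<open>d\<close>-th term, the Hall-Witt identity
  expresses \<open>((x, y), a)\<close> by conjugates of \<open>((y\<inverse>, a\<inverse>), x)\<close> and \<open>((a, x\<inverse>), y\<inverse>)\<close>, to which the induction
  hypothesis applies.\<close>

theorem lower_central_commutator:
  assumes "c \<ge> 1" "d \<ge> 1" "a \<in> lower_central G c" "b \<in> lower_central G d"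
  shows "commutator G a b \<in> lower_central G (c + d)"
  using assms(2,1,3,4)
proof (induction d arbitrary: a b c rule: nat_induct_at_least)
  case base
  then show ?case using lower_central_commutator_carrier[of c a b] by simp
next
  case (Suc d)
  let ?N = "lower_central G (c + Suc d)"
  note carr = lower_central_carrier and cl = lower_central_closed
  have c1: "1 \<le> c" and ac: "a \<in> lower_central G c" using Suc.prems by auto
  have a: "a \<in> carrier G" using Suc carr by blast
  define B where "B = {b \<in> carrier G. commutator G a b \<in> ?N}"
  have "subgroup B G"
  proof (rule subgroupI)
    show "B \<noteq> {}"
      using a cl(3) by (auto simp: B_def commutator_def intro!: exI[of _ \<one>])
    fix b b' assume b: "b \<in> B" "b' \<in> B"
    show "inv b \<in> B"
      using b a cl(5)[OF _ cl(2)] by (auto simp: B_def commutator_inv_right)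
    show "b \<otimes> b' \<in> B"
      using b a by (auto simp: B_def commutator_mult_right intro!: cl)
  qed (auto simp: B_def)
  moreover have "commutator G x y \<in> B" if x: "x \<in> lower_central G d" and y: "y \<in> carrier G" for x y
  proof -
    have xc: "x \<in> carrier G" using x carr by blast
    have "commutator G (inv y) (inv a) \<in> lower_central G (Suc c)"
      using lower_central_commutator_carrier[OF c1 cl(2)[OF ac], of "inv y"] y a
        cl(2) commutator_inv[of "inv a" "inv y"] by fastforce
    then have 1: "commutator G (commutator G (inv y) (inv a)) x \<in> ?N"
      using Suc.IH[of "Suc c" "commutator G (inv y) (inv a)" x] x by simp
    have "commutator G (inv x) a \<in> carrier G" using xc a by simp
    have "commutator G a (inv x) \<in> lower_central G (c + d)"
      using Suc.IH[OF c1 ac cl(2)[OF x]] .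
    then have 2: "commutator G (commutator G a (inv x)) (inv y) \<in> ?N"
      using lower_central_commutator_carrier[of "c + d" _ "inv y"] y Suc by simp
    \<comment> \<open>Two of the three factors of the Hall-Witt product lie in the normal subgroup, hence so does the third.\<close>
    let ?p = "inv (inv y) \<otimes> commutator G (commutator G x (inv (inv y))) a \<otimes> inv y"
    let ?q = "inv a \<otimes> commutator G (commutator G (inv y) (inv a)) x \<otimes> a"
    let ?r = "inv x \<otimes> commutator G (commutator G a (inv x)) (inv y) \<otimes> x"
    have "?p \<otimes> ?q \<otimes> ?r = \<one>" using Hall_Witt[of x "inv y" a] xc y a by simp
    moreover have qr: "?q \<in> ?N" "?r \<in> ?N" using 1 2 a xc cl by blast+
    moreover have "?p \<in> carrier G" using xc y a by simp
    ultimately have "?p = inv (?q \<otimes> ?r)"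
      using carr by (intro inv_equality[symmetric]) (auto simp: m_assoc)
    then have "?p \<in> ?N" using qr cl by metis
    then have "inv y \<otimes> ?p \<otimes> y \<in> ?N" using y cl by blast
    moreover have "inv y \<otimes> ?p \<otimes> y = commutator G (commutator G x y) a"
      using y xc a by (simp add: m_assoc)
    ultimately have "inv (commutator G (commutator G x y) a) \<in> ?N" using cl by metis
    then show ?thesis using xc y a by (simp add: B_def commutator_inv)
  qed
  ultimately have "lower_central G (Suc d) \<subseteq> B"
    using Suc by (intro lower_central_Suc_minimal) auto
  then show ?case using Suc by (auto simp: B_def)
qed

end

section \<open>Lower central quotients\<close>

definition lc_class :: "('a, 'm) monoid_scheme \<Rightarrow> nat \<Rightarrow> 'a \<Rightarrow> 'a set" where
  "lc_class G n a = lower_central G (Suc n) #>\<^bsub>G\<^esub> a"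

context group
begin

lemma lc_class_eq_iff:
  assumes "a \<in> carrier G" "b \<in> carrier G"
  shows "lc_class G n a = lc_class G n b \<longleftrightarrow> a \<otimes> inv b \<in> lower_central G (Suc n)"
  unfolding lc_class_def using lower_central_subgroup[of "Suc n"] assms
  by (metis is_group rcos_self repr_independence subgroup.rcos_module)

text \<open>The quotient of two consecutive terms is central, so that the conjugations in commutator identities can be
  dropped.\<close>

lemma lc_class_conj:
  assumes "n \<ge> 1" "z \<in> lower_central G n" "g \<in> carrier G"
  shows "lc_class G n (inv g \<otimes> z \<otimes> g) = lc_class G n z"
proof -
  have z: "z \<in> carrier G" using assms lower_central_carrier by blast
  have "inv g \<otimes> z \<otimes> g \<otimes> inv z = commutator G g (inv z)"
    using z assms by (simp add: commutator_def m_assoc)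
  also have "\<dots> = inv (commutator G (inv z) g)" using z assms by (simp add: commutator_inv)
  also have "\<dots> \<in> lower_central G (Suc n)"
    using assms by (intro lower_central_closed lower_central_commutator_carrier)
  finally show ?thesis using z assms by (simp add: lc_class_eq_iff)
qed

lemma quotient_normal: "lower_central G (Suc n) \<lhd> (G\<lparr>carrier := lower_central G n\<rparr>)"
proof -
  interpret H: group "G\<lparr>carrier := lower_central G n\<rparr>"
    by (rule subgroup_imp_group[OF lower_central_subgroup])
  have "subgroup (lower_central G (Suc n)) (G\<lparr>carrier := lower_central G n\<rparr>)"
    using subgroup_incl[OF lower_central_subgroup lower_central_subgroup lower_central_Suc_subset] .
  moreover have "inv\<^bsub>G\<lparr>carrier := lower_central G n\<rparr>\<^esub> x = inv x" if "x \<in> lower_central G n" for x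
    using m_inv_consistent[OF lower_central_subgroup that] .
  ultimately show ?thesis
    unfolding H.normal_inv_iff using lower_central_closed(5) lower_central_carrier by auto
qed

lemma carrier_quotient:
  "carrier (lower_central_quotient G n) = lc_class G n ` lower_central G n"
  unfolding lower_central_quotient_def carrier_FactGroup
  by (simp add: lc_class_def r_coset_def)

lemma one_quotient: "one (lower_central_quotient G n) = lc_class G n \<one>"
  unfolding lower_central_quotient_def lc_class_def
  using coset_mult_one[OF subgroup.subset[OF lower_central_subgroup]] by simp

lemma mult_quotient:
  assumes "a \<in> lower_central G n" "b \<in> lower_central G n"
  shows "lc_class G n a \<otimes>\<^bsub>lower_central_quotient G n\<^esub> lc_class G n b = lc_class G n (a \<otimes> b)"
  using normal.rcos_sum[OF quotient_normal, of a n b] assms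
  by (simp add: lower_central_quotient_def lc_class_def r_coset_def set_mult_def)

lemma group_quotient: "group (lower_central_quotient G n)"
  unfolding lower_central_quotient_def by (rule normal.factorgroup_is_group[OF quotient_normal])

lemma comm_group_quotient:
  assumes "n \<ge> 1"
  shows "comm_group (lower_central_quotient G n)"
proof (rule group.group_comm_groupI[OF group_quotient])
  fix x y assume "x \<in> carrier (lower_central_quotient G n)" "y \<in> carrier (lower_central_quotient G n)"
  then obtain a b where ab: "x = lc_class G n a" "y = lc_class G n b"
    "a \<in> lower_central G n" "b \<in> lower_central G n" by (auto simp: carrier_quotient)
  then have c: "a \<in> carrier G" "b \<in> carrier G" using lower_central_carrier by auto
  have "inv (b \<otimes> a) \<otimes> (a \<otimes> b) = commutator G a b"
    using c by (simp add: commutator_def inv_mult_group m_assoc)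
  also have "\<dots> \<in> lower_central G (Suc n)"
    using ab c assms lower_central_commutator_carrier by blast
  finally have "(b \<otimes> a) \<otimes> (inv (b \<otimes> a) \<otimes> (a \<otimes> b)) \<otimes> inv (b \<otimes> a) \<in> lower_central G (Suc n)"
    using c by (intro lower_central_closed(5)) auto
  then have "lc_class G n (a \<otimes> b) = lc_class G n (b \<otimes> a)"
    using c by (simp add: lc_class_eq_iff del: cancel_left) (simp add: m_assoc inv_mult_group)
  then show "x \<otimes>\<^bsub>lower_central_quotient G n\<^esub> y = y \<otimes>\<^bsub>lower_central_quotient G n\<^esub> x"
    using ab by (simp add: mult_quotient)
qed

lemma inv_quotient:
  assumes "a \<in> lower_central G n"
  shows "inv\<^bsub>lower_central_quotient G n\<^esub> (lc_class G n a) = lc_class G n (inv a)"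
  using assms lower_central_carrier lower_central_closed(2)[OF assms]
  by (intro group.inv_equality[OF group_quotient])
    (auto simp: mult_quotient one_quotient carrier_quotient)

lemma lc_class_one_iff:
  "a \<in> carrier G \<Longrightarrow> lc_class G n a = one (lower_central_quotient G n) \<longleftrightarrow> a \<in> lower_central G (Suc n)"
  by (simp add: one_quotient lc_class_eq_iff)

lemma commutator_mult_left_class:
  assumes "c \<ge> 1" "d \<ge> 1" "a \<in> lower_central G c" "a' \<in> lower_central G c" "b \<in> lower_central G d"
  shows "lc_class G (c + d) (commutator G (a \<otimes> a') b)
    = lc_class G (c + d) (commutator G a b) \<otimes>\<^bsub>lower_central_quotient G (c + d)\<^esub> lc_class G (c + d) (commutator G a' b)"
proof -
  have [simp]: "a \<in> carrier G" "a' \<in> carrier G" "b \<in> carrier G"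
    using assms lower_central_carrier by blast+
  have m: "commutator G a b \<in> lower_central G (c + d)" "commutator G a' b \<in> lower_central G (c + d)"
    using assms lower_central_commutator by blast+
  then have "lc_class G (c + d) (commutator G (a \<otimes> a') b)
      = lc_class G (c + d) (inv a' \<otimes> commutator G a b \<otimes> a') \<otimes>\<^bsub>lower_central_quotient G (c + d)\<^esub> lc_class G (c + d) (commutator G a' b)"
    by (simp add: commutator_mult_left mult_quotient lower_central_closed)
  then show ?thesis using m assms by (simp add: lc_class_conj)
qed

lemma commutator_inv_class:
  assumes "c \<ge> 1" "d \<ge> 1" "a \<in> lower_central G c" "b \<in> lower_central G d"
  shows "lc_class G (c + d) (commutator G b a)
    = inv\<^bsub>lower_central_quotient G (c + d)\<^esub> (lc_class G (c + d) (commutator G a b))"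
  using assms lower_central_commutator lower_central_carrier
  by (simp add: inv_quotient commutator_inv)

lemma commutator_mult_right_class:
  assumes "c \<ge> 1" "d \<ge> 1" "a \<in> lower_central G c" "b \<in> lower_central G d" "b' \<in> lower_central G d"
  shows "lc_class G (c + d) (commutator G a (b \<otimes> b'))
    = lc_class G (c + d) (commutator G a b) \<otimes>\<^bsub>lower_central_quotient G (c + d)\<^esub> lc_class G (c + d) (commutator G a b')"
proof -
  have [simp]: "a \<in> carrier G" "b' \<in> carrier G" "b \<in> carrier G"
    using assms lower_central_carrier by blast+
  interpret Q: comm_group "lower_central_quotient G (c + d)"
    using assms by (intro comm_group_quotient) simp
  have m: "commutator G a b \<in> lower_central G (c + d)" "commutator G a b' \<in> lower_central G (c + d)"
    using assms lower_central_commutator by blast+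
  then have "lc_class G (c + d) (commutator G a (b \<otimes> b'))
      = lc_class G (c + d) (commutator G a b') \<otimes>\<^bsub>lower_central_quotient G (c + d)\<^esub> lc_class G (c + d) (inv b' \<otimes> commutator G a b \<otimes> b')"
    by (simp add: commutator_mult_right mult_quotient lower_central_closed)
  also have "lc_class G (c + d) (inv b' \<otimes> commutator G a b \<otimes> b') = lc_class G (c + d) (commutator G a b)"
    using m assms by (simp add: lc_class_conj)
  finally show ?thesis using m by (simp add: Q.m_comm carrier_quotient)
qed

lemma commutator_class_left_cong:
  assumes "c \<ge> 1" "d \<ge> 1" "a \<in> lower_central G c" "b \<in> lower_central G d" "h \<in> lower_central G (Suc c)"
  shows "lc_class G (c + d) (commutator G (h \<otimes> a) b) = lc_class G (c + d) (commutator G a b)"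
proof -
  have h: "h \<in> lower_central G c" using assms lower_central_Suc_subset by blast
  have "commutator G h b \<in> lower_central G (Suc (c + d))"
    using assms lower_central_commutator[of "Suc c" d h b] by simp
  then have "lc_class G (c + d) (commutator G h b) = one (lower_central_quotient G (c + d))"
    using lc_class_one_iff lower_central_carrier by blast
  moreover have "commutator G a b \<in> lower_central G (c + d)"
    using assms lower_central_commutator by blast
  ultimately show ?thesis
    using commutator_mult_left_class[OF assms(1,2) h assms(3,4)]
      group.is_monoid[OF group_quotient, THEN monoid.l_one] by (simp add: carrier_quotient)
qed

lemma commutator_class_right_cong:
  assumes "c \<ge> 1" "d \<ge> 1" "a \<in> lower_central G c" "b \<in> lower_central G d" "h \<in> lower_central G (Suc d)"
  shows "lc_class G (c + d) (commutator G a (h \<otimes> b)) = lc_class G (c + d) (commutator G a b)"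
proof -
  have h: "h \<in> lower_central G d" using assms lower_central_Suc_subset by blast
  have "lc_class G (c + d) (commutator G (h \<otimes> b) a) = lc_class G (c + d) (commutator G b a)"
    using commutator_class_left_cong[of d c b a h] assms by (simp add: add.commute)
  then show ?thesis
    using commutator_inv_class[of d c "h \<otimes> b" a] commutator_inv_class[of d c b a] assms h
    by (simp add: add.commute lower_central_closed)
qed

text \<open>The class of a commutator depends on the classes of its entries only, so all members of the union that defines the
  bracket coincide.\<close>

lemma gr_bracket_class:
  assumes "c \<ge> 1" "d \<ge> 1" "a \<in> lower_central G c" "b \<in> lower_central G d"
  shows "gr_bracket G c d (lc_class G c a) (lc_class G d b) = lc_class G (c + d) (commutator G a b)"
proof -
  have "lower_central G (Suc (c + d)) #> commutator G a' b' = lc_class G (c + d) (commutator G a b)"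
    if "a' \<in> lc_class G c a" "b' \<in> lc_class G d b" for a' b'
  proof -
    obtain h k where hk: "a' = h \<otimes> a" "h \<in> lower_central G (Suc c)" "b' = k \<otimes> b" "k \<in> lower_central G (Suc d)"
      using \<open>a' \<in> lc_class G c a\<close> \<open>b' \<in> lc_class G d b\<close> unfolding lc_class_def r_coset_def by blast
    have "h \<otimes> a \<in> lower_central G c"
      using hk assms lower_central_Suc_subset lower_central_closed by blast
    then have "lc_class G (c + d) (commutator G a' b') = lc_class G (c + d) (commutator G (h \<otimes> a) b)"
      unfolding hk by (intro commutator_class_right_cong assms hk)
    also have "\<dots> = lc_class G (c + d) (commutator G a b)"
      by (intro commutator_class_left_cong assms hk)
    finally show ?thesis by (simp add: lc_class_def)
  qed
  moreover have "a \<in> lc_class G c a" "b \<in> lc_class G d b"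
    using assms lower_central_carrier rcos_self[OF _ lower_central_subgroup] by (auto simp: lc_class_def)
  ultimately show ?thesis unfolding gr_bracket_def by blast
qed

text \<open>This is the Hall-Witt identity modulo the next term, where conjugations disappear and an inverse inside a
  commutator becomes an inverse outside. The latter inverse is absorbed by antisymmetry.\<close>

lemma Jacobi_class:
  assumes "c \<ge> 1" "d \<ge> 1" "e \<ge> 1"
    and "a \<in> lower_central G c" "b \<in> lower_central G d" "z \<in> lower_central G e"
  shows "lc_class G (c + d + e) (commutator G a (commutator G b z) \<otimes> commutator G b (commutator G z a)
    \<otimes> commutator G z (commutator G a b)) = one (lower_central_quotient G (c + d + e))"
proof -
  let ?n = "c + d + e"
  let ?Q = "lower_central_quotient G ?n" and ?cl = "lc_class G ?n"
  interpret Q: comm_group ?Q using assms by (intro comm_group_quotient) simp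
  have comm: "?cl (commutator G (commutator G x (inv y)) w) = ?cl (commutator G w (commutator G x y))
      \<and> commutator G (commutator G x (inv y)) w \<in> lower_central G ?n
      \<and> commutator G w (commutator G x y) \<in> lower_central G ?n"
    if xyw: "i \<ge> 1" "j \<ge> 1" "k \<ge> 1" "i + j + k = ?n"
      "x \<in> lower_central G i" "y \<in> lower_central G j" "w \<in> lower_central G k" for i j k x y w
  proof -
    have iy: "inv y \<in> lower_central G j" using xyw lower_central_closed by blast
    have m: "commutator G x (inv y) \<in> lower_central G (i + j)" "commutator G x y \<in> lower_central G (i + j)"
      using xyw iy lower_central_commutator by blast+
    have carr: "x \<in> carrier G" "y \<in> carrier G" "w \<in> carrier G"
      using xyw lower_central_carrier by blast+
    have "lc_class G (i + j) (commutator G x (inv y)) = lc_class G (i + j) (y \<otimes> commutator G y x \<otimes> inv y)"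
      using carr by (simp add: commutator_inv_right commutator_inv)
    also have "\<dots> = lc_class G (i + j) (commutator G y x)"
      using lc_class_conj[of "i + j" "commutator G y x" "inv y"] carr xyw
        lower_central_commutator[of j i y x] by (simp add: add.commute)
    also have "\<dots> = lc_class G (i + j) (inv (commutator G x y))"
      using carr by (simp add: commutator_inv)
    finally have e: "lc_class G (i + j) (commutator G x (inv y)) = lc_class G (i + j) (inv (commutator G x y))" .
    have "?cl (commutator G (commutator G x (inv y)) w)
        = gr_bracket G (i + j) k (lc_class G (i + j) (commutator G x (inv y))) (lc_class G k w)"
      using gr_bracket_class[OF _ _ m(1), of k w] xyw by simp
    also have "\<dots> = ?cl (commutator G (inv (commutator G x y)) w)"
      unfolding e using gr_bracket_class[OF _ _ lower_central_closed(2)[OF m(2)], of k w] xyw by simp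
    also have "\<dots> = ?cl (commutator G w (commutator G x y))"
    proof -
      let ?u = "commutator G x y"
      have "commutator G (inv ?u) w = ?u \<otimes> commutator G w ?u \<otimes> inv ?u"
        using carr by (simp add: commutator_def inv_mult_group m_assoc)
      then show ?thesis
        using lc_class_conj[of ?n "commutator G w ?u" "inv ?u"] carr xyw
          lower_central_commutator[OF _ _ xyw(7) m(2)] by (simp add: add.commute)
    qed
    finally show ?thesis
      using lower_central_commutator[OF _ _ m(1) xyw(7)] lower_central_commutator[OF _ _ xyw(7) m(2)] xyw
      by (simp add: add.commute)
  qed
  have [simp]: "a \<in> carrier G" "b \<in> carrier G" "z \<in> carrier G"
    using assms lower_central_carrier by blast+
  note 1 = comm[of c d e a b z] and 2 = comm[of d e c b z a] and 3 = comm[of e c d z a b]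
  let ?A = "commutator G (commutator G a (inv b)) z" and ?B = "commutator G (commutator G b (inv z)) a"
    and ?C = "commutator G (commutator G z (inv a)) b"
  have n: "?n \<ge> 1" using assms by simp
  have m: "?A \<in> lower_central G ?n" "?B \<in> lower_central G ?n" "?C \<in> lower_central G ?n"
    "commutator G a (commutator G b z) \<in> lower_central G ?n"
    "commutator G b (commutator G z a) \<in> lower_central G ?n"
    "commutator G z (commutator G a b) \<in> lower_central G ?n"
    using 1 2 3 assms by simp_all
  have "?cl (inv b \<otimes> ?A \<otimes> b \<otimes> (inv z \<otimes> ?B \<otimes> z) \<otimes> (inv a \<otimes> ?C \<otimes> a)) = one ?Q"
    by (simp only: Hall_Witt[OF \<open>a \<in> carrier G\<close> \<open>b \<in> carrier G\<close> \<open>z \<in> carrier G\<close>] one_quotient)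
  then have "?cl ?A \<otimes>\<^bsub>?Q\<^esub> ?cl ?B \<otimes>\<^bsub>?Q\<^esub> ?cl ?C = one ?Q"
    using m n by (simp add: lower_central_closed lc_class_conj flip: mult_quotient)
  then have "?cl (commutator G z (commutator G a b)) \<otimes>\<^bsub>?Q\<^esub> ?cl (commutator G a (commutator G b z))
      \<otimes>\<^bsub>?Q\<^esub> ?cl (commutator G b (commutator G z a)) = one ?Q"
    using 1 2 3 assms by simp
  then have "?cl (commutator G a (commutator G b z)) \<otimes>\<^bsub>?Q\<^esub> ?cl (commutator G b (commutator G z a))
      \<otimes>\<^bsub>?Q\<^esub> ?cl (commutator G z (commutator G a b)) = one ?Q"
    using m by (simp add: Q.m_ac carrier_quotient)
  then show ?thesis using m by (simp add: mult_quotient lower_central_closed)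
qed

end

section \<open>The associated graded Lie algebra\<close>

definition gr_single :: "('a, 'm) monoid_scheme \<Rightarrow> nat \<Rightarrow> 'a set \<Rightarrow> nat \<Rightarrow> 'a set" where
  "gr_single G n A = (\<lambda>i\<in>{1..}. if i = n then A else one (lower_central_quotient G i))"

lemma associated_graded_simps:
  "carrier (associated_graded G) = carrier (sum_group {1..} (lower_central_quotient G))"
  "monoid.mult (associated_graded G) = (\<lambda>x y. \<lambda>i\<in>{1..}. x i \<otimes>\<^bsub>lower_central_quotient G i\<^esub> y i)"
  "one (associated_graded G) = (\<lambda>i\<in>{1..}. one (lower_central_quotient G i))"
  "bracket (associated_graded G) = (\<lambda>x y. \<lambda>e\<in>{1..}. finprod (lower_central_quotient G e)
           (\<lambda>c. gr_bracket G c (e - c) (x c) (y (e - c))) {1..<e})"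
  by (simp_all add: associated_graded_def Let_def)

lemmas gr_simps = associated_graded_simps(2-4)

context group
begin

lemma commutator_one [simp]:
  "a \<in> carrier G \<Longrightarrow> commutator G a \<one> = \<one>" "a \<in> carrier G \<Longrightarrow> commutator G \<one> a = \<one>"
  by (simp_all add: commutator_def)

lemma gr_carrier_iff:
  "x \<in> carrier (associated_graded G) \<longleftrightarrow>
    x \<in> (\<Pi>\<^sub>E i\<in>{1..}. carrier (lower_central_quotient G i)) \<and>
    finite {i \<in> {1..}. x i \<noteq> one (lower_central_quotient G i)}"
  by (simp add: associated_graded_simps(1) carrier_sum_group group_quotient)

lemma comm_group_graded: "comm_group (associated_graded G)"
proof -
  have g: "group (associated_graded G)"
    using sum_group[of "{1..}" "lower_central_quotient G", OF group_quotient]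
    by (simp add: associated_graded_def Let_def sum_group_def group_def group_axioms_def
        Group.monoid_def Units_def)
  show ?thesis
  proof (rule group.group_comm_groupI[OF g])
    fix x y assume "x \<in> carrier (associated_graded G)" "y \<in> carrier (associated_graded G)"
    then have "x i \<otimes>\<^bsub>lower_central_quotient G i\<^esub> y i = y i \<otimes>\<^bsub>lower_central_quotient G i\<^esub> x i"
      if "i \<ge> 1" for i
      using that comm_group.axioms(1)[OF comm_group_quotient[OF that]]
      by (intro comm_monoid.m_comm) (auto simp: gr_carrier_iff)
    then show "x \<otimes>\<^bsub>associated_graded G\<^esub> y = y \<otimes>\<^bsub>associated_graded G\<^esub> x"
      by (auto simp: gr_simps intro!: restrict_ext)
  qed
qed

lemma gr_single_closed:
  assumes "a \<in> lower_central G n"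
  shows "gr_single G n (lc_class G n a) \<in> carrier (associated_graded G)"
proof -
  have "{i \<in> {1..}. gr_single G n (lc_class G n a) i \<noteq> one (lower_central_quotient G i)} \<subseteq> {n}"
    by (auto simp: gr_single_def)
  then show ?thesis
    using assms finite_subset[OF _ finite.insertI[OF finite.emptyI]] lower_central_closed(3)
    by (auto simp: gr_carrier_iff gr_single_def carrier_quotient one_quotient)
qed

lemma gr_single_mult:
  assumes "a \<in> lower_central G n" "b \<in> lower_central G n"
  shows "gr_single G n (lc_class G n a) \<otimes>\<^bsub>associated_graded G\<^esub> gr_single G n (lc_class G n b)
    = gr_single G n (lc_class G n (a \<otimes> b))"
  using assms group.is_monoid[OF group_quotient, THEN monoid.l_one, OF monoid.one_closed[OF group.is_monoid[OF group_quotient]]]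
  by (auto simp: gr_simps gr_single_def mult_quotient intro!: restrict_ext)

lemma gr_single_one: "gr_single G n (lc_class G n \<one>) = one (associated_graded G)"
  by (simp add: gr_simps gr_single_def one_quotient fun_eq_iff restrict_def)

lemma gr_single_eq_one_iff:
  assumes "n \<ge> 1" "a \<in> carrier G"
  shows "gr_single G n (lc_class G n a) = one (associated_graded G) \<longleftrightarrow> a \<in> lower_central G (Suc n)"
proof -
  have "gr_single G n (lc_class G n a) = one (associated_graded G) \<longleftrightarrow> lc_class G n a = one (lower_central_quotient G n)"
    using assms by (auto simp: gr_simps gr_single_def fun_eq_iff restrict_def split: if_splits)
  then show ?thesis using assms by (simp add: lc_class_one_iff)
qed

lemma gr_single_inv:
  assumes "a \<in> lower_central G n"
  shows "inv\<^bsub>associated_graded G\<^esub> (gr_single G n (lc_class G n a)) = gr_single G n (lc_class G n (inv a))"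
proof -
  interpret S: comm_group "associated_graded G" by (rule comm_group_graded)
  show ?thesis
    using assms lower_central_carrier
    by (intro S.inv_equality)
      (auto simp: gr_single_mult gr_single_closed lower_central_closed gr_single_one)
qed

text \<open>Elements have finite support, so homogeneous ones generate. Identities that are multiplicative in each argument
  thus need to be checked for homogeneous elements only.\<close>

lemma gr_induct [consumes 1, case_names single mult]:
  assumes "x \<in> carrier (associated_graded G)"
    and single: "\<And>n a. n \<ge> 1 \<Longrightarrow> a \<in> lower_central G n \<Longrightarrow> P (gr_single G n (lc_class G n a))"
    and mult: "\<And>x y. x \<in> carrier (associated_graded G) \<Longrightarrow> y \<in> carrier (associated_graded G)
      \<Longrightarrow> P x \<Longrightarrow> P y \<Longrightarrow> P (x \<otimes>\<^bsub>associated_graded G\<^esub> y)"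
  shows "P x"
proof -
  let ?Q = "lower_central_quotient G"
  have "P x" if "finite T" "x \<in> carrier (associated_graded G)" "{i \<in> {1..}. x i \<noteq> one (?Q i)} \<subseteq> T" for T x
    using that
  proof (induction T arbitrary: x rule: finite_induct)
    case empty
    then have "x = one (associated_graded G)"
      by (auto simp: gr_carrier_iff gr_simps PiE_iff extensional_def fun_eq_iff restrict_def)
    then show ?case using single[of 1 \<one>] gr_single_one[of 1] by simp
  next
    case (insert n T)
    show ?case
    proof (cases "n \<ge> 1")
      case False
      then show ?thesis using insert by (intro insert.IH) auto
    next
      case True
      define y where "y = x(n := one (?Q n))"
      have x: "x \<in> (\<Pi>\<^sub>E i\<in>{1..}. carrier (?Q i))" using insert by (simp add: gr_carrier_iff)
      have one: "one (?Q i) \<in> carrier (?Q i)" for i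
        using group.is_monoid[OF group_quotient] by (rule monoid.one_closed)
      obtain a where a: "a \<in> lower_central G n" "x n = lc_class G n a"
        using x True by (auto simp: PiE_iff carrier_quotient)
      have supp: "{i \<in> {1..}. y i \<noteq> one (?Q i)} \<subseteq> T" using insert by (auto simp: y_def)
      have y: "y \<in> carrier (associated_graded G)"
        using x one True finite_subset[OF supp] insert by (auto simp: gr_carrier_iff y_def PiE_iff extensional_def)
      note insert.IH[OF y supp] y
      moreover have "x = gr_single G n (lc_class G n a) \<otimes>\<^bsub>associated_graded G\<^esub> y"
      proof
        fix i
        have [simp]: "\<one>\<^bsub>?Q i\<^esub> \<otimes>\<^bsub>?Q i\<^esub> x i = x i" if "i \<ge> 1"
          using x that group.is_monoid[OF group_quotient, THEN monoid.l_one] by (auto simp: PiE_iff)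
        have "lc_class G n a \<otimes>\<^bsub>?Q n\<^esub> \<one>\<^bsub>?Q n\<^esub> = lc_class G n a"
          using a group.is_monoid[OF group_quotient, THEN monoid.r_one] by (auto simp: carrier_quotient)
        then show "x i = (gr_single G n (lc_class G n a) \<otimes>\<^bsub>associated_graded G\<^esub> y) i"
          using x True a by (auto simp: gr_simps gr_single_def y_def PiE_iff extensional_def)
      qed
      ultimately show ?thesis
        using mult[OF gr_single_closed[OF a(1)] _ single[OF True a(1)]] by simp
    qed
  qed
  then show ?thesis using assms(1) unfolding gr_carrier_iff by blast
qed

lemma gr_comp_closed: "x \<in> carrier (associated_graded G) \<Longrightarrow> i \<ge> 1 \<Longrightarrow> x i \<in> carrier (lower_central_quotient G i)"
  by (auto simp: gr_carrier_iff)

lemma gr_bracket_simps: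
  assumes "c \<ge> 1" "d \<ge> 1"
  shows "A \<in> carrier (lower_central_quotient G c) \<Longrightarrow> B \<in> carrier (lower_central_quotient G d)
      \<Longrightarrow> gr_bracket G c d A B \<in> carrier (lower_central_quotient G (c + d))"
    and "A \<in> carrier (lower_central_quotient G c) \<Longrightarrow> A' \<in> carrier (lower_central_quotient G c)
      \<Longrightarrow> B \<in> carrier (lower_central_quotient G d)
      \<Longrightarrow> gr_bracket G c d (A \<otimes>\<^bsub>lower_central_quotient G c\<^esub> A') B
        = gr_bracket G c d A B \<otimes>\<^bsub>lower_central_quotient G (c + d)\<^esub> gr_bracket G c d A' B"
    and "A \<in> carrier (lower_central_quotient G c) \<Longrightarrow> B \<in> carrier (lower_central_quotient G d)
      \<Longrightarrow> B' \<in> carrier (lower_central_quotient G d)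
      \<Longrightarrow> gr_bracket G c d A (B \<otimes>\<^bsub>lower_central_quotient G d\<^esub> B')
        = gr_bracket G c d A B \<otimes>\<^bsub>lower_central_quotient G (c + d)\<^esub> gr_bracket G c d A B'"
    and "B \<in> carrier (lower_central_quotient G d)
      \<Longrightarrow> gr_bracket G c d (one (lower_central_quotient G c)) B = one (lower_central_quotient G (c + d))"
    and "A \<in> carrier (lower_central_quotient G c)
      \<Longrightarrow> gr_bracket G c d A (one (lower_central_quotient G d)) = one (lower_central_quotient G (c + d))"
  using assms lower_central_carrier
  by (auto simp: carrier_quotient gr_bracket_class mult_quotient one_quotient lower_central_closed
      commutator_mult_left_class commutator_mult_right_class lower_central_commutator
      simp del: lower_central.simps)

lemma gr_factor_closed:
  assumes "x \<in> carrier (associated_graded G)" "y \<in> carrier (associated_graded G)"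
  shows "(\<lambda>c. gr_bracket G c (e - c) (x c) (y (e - c))) \<in> {1..<e} \<rightarrow> carrier (lower_central_quotient G e)"
proof
  fix c assume c: "c \<in> {1..<e}"
  then have "gr_bracket G c (e - c) (x c) (y (e - c)) \<in> carrier (lower_central_quotient G (c + (e - c)))"
    using assms by (intro gr_bracket_simps(1) gr_comp_closed) auto
  then show "gr_bracket G c (e - c) (x c) (y (e - c)) \<in> carrier (lower_central_quotient G e)"
    using c by simp
qed

lemma gr_br_closed:
  assumes x: "x \<in> carrier (associated_graded G)" and y: "y \<in> carrier (associated_graded G)"
  shows "bracket (associated_graded G) x y \<in> carrier (associated_graded G)"
proof -
  let ?Q = "lower_central_quotient G"
  have "finite ({i \<in> {1..}. x i \<noteq> one (?Q i)} \<union> {i \<in> {1..}. y i \<noteq> one (?Q i)})"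
    using x y by (simp add: gr_carrier_iff)
  then obtain N where "\<forall>n\<in>{i \<in> {1..}. x i \<noteq> one (?Q i)} \<union> {i \<in> {1..}. y i \<noteq> one (?Q i)}. n \<le> N"
    unfolding finite_nat_set_iff_bounded_le by blast
  then have N: "x i = one (?Q i) \<and> y i = one (?Q i)" if "i \<ge> 1" "i > N" for i
    using that by (metis (mono_tags, lifting) UnI1 UnI2 atLeast_iff mem_Collect_eq not_le)
  have "bracket (associated_graded G) x y i = one (?Q i)" if "i \<ge> 1" "i > 2 * N" for i
  proof -
    interpret Q: comm_group "?Q i" using that by (intro comm_group_quotient) simp
    have "finprod (?Q i) (\<lambda>c. gr_bracket G c (i - c) (x c) (y (i - c))) {1..<i} = one (?Q i)"
    proof (rule Q.finprod_one_eqI)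
      fix c assume c: "c \<in> {1..<i}"
      then have "c > N \<or> i - c > N" using that by auto
      then show "gr_bracket G c (i - c) (x c) (y (i - c)) = one (?Q i)"
        using c N[of c] N[of "i - c"] gr_bracket_simps(4,5)[of c "i - c"] gr_comp_closed[OF x, of c]
          gr_comp_closed[OF y, of "i - c"] by auto
    qed
    then show ?thesis using that by (simp add: gr_simps)
  qed
  then have "{i \<in> {1..}. bracket (associated_graded G) x y i \<noteq> one (?Q i)} \<subseteq> {..2 * N}"
    by force
  then have "finite {i \<in> {1..}. bracket (associated_graded G) x y i \<noteq> one (?Q i)}"
    by (rule finite_subset) simp
  moreover have "finprod (?Q i) (\<lambda>c. gr_bracket G c (i - c) (x c) (y (i - c))) {1..<i} \<in> carrier (?Q i)"
    if "i \<ge> 1" for i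
    using comm_group.axioms(1)[OF comm_group_quotient[OF that]] gr_factor_closed[OF x y]
    by (rule comm_monoid.finprod_closed)
  ultimately show ?thesis by (auto simp: gr_carrier_iff gr_simps)
qed

lemma gr_br_mult:
  assumes x: "x \<in> carrier (associated_graded G)" and y: "y \<in> carrier (associated_graded G)"
    and z: "z \<in> carrier (associated_graded G)"
  shows "bracket (associated_graded G) (x \<otimes>\<^bsub>associated_graded G\<^esub> y) z
      = bracket (associated_graded G) x z \<otimes>\<^bsub>associated_graded G\<^esub> bracket (associated_graded G) y z"
    and "bracket (associated_graded G) z (x \<otimes>\<^bsub>associated_graded G\<^esub> y)
      = bracket (associated_graded G) z x \<otimes>\<^bsub>associated_graded G\<^esub> bracket (associated_graded G) z y"
proof -
  let ?Q = "lower_central_quotient G" and ?S = "associated_graded G"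
  have "finprod (?Q i) (\<lambda>c. gr_bracket G c (i - c) (x c \<otimes>\<^bsub>?Q c\<^esub> y c) (z (i - c))) {1..<i}
      = finprod (?Q i) (\<lambda>c. gr_bracket G c (i - c) (x c) (z (i - c))) {1..<i}
        \<otimes>\<^bsub>?Q i\<^esub> finprod (?Q i) (\<lambda>c. gr_bracket G c (i - c) (y c) (z (i - c))) {1..<i}"
    "finprod (?Q i) (\<lambda>c. gr_bracket G c (i - c) (z c) (x (i - c) \<otimes>\<^bsub>?Q (i - c)\<^esub> y (i - c))) {1..<i}
      = finprod (?Q i) (\<lambda>c. gr_bracket G c (i - c) (z c) (x (i - c))) {1..<i}
        \<otimes>\<^bsub>?Q i\<^esub> finprod (?Q i) (\<lambda>c. gr_bracket G c (i - c) (z c) (y (i - c))) {1..<i}"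
    if "i \<ge> 1" for i
  proof -
    interpret Q: comm_group "?Q i" using that by (rule comm_group_quotient)
    note cl = gr_comp_closed[OF x] gr_comp_closed[OF y] gr_comp_closed[OF z]
    have 1: "gr_bracket G c (i - c) (x c \<otimes>\<^bsub>?Q c\<^esub> y c) (z (i - c))
        = gr_bracket G c (i - c) (x c) (z (i - c)) \<otimes>\<^bsub>?Q i\<^esub> gr_bracket G c (i - c) (y c) (z (i - c))"
      "gr_bracket G c (i - c) (z c) (x (i - c) \<otimes>\<^bsub>?Q (i - c)\<^esub> y (i - c))
        = gr_bracket G c (i - c) (z c) (x (i - c)) \<otimes>\<^bsub>?Q i\<^esub> gr_bracket G c (i - c) (z c) (y (i - c))"
      if "c \<in> {1..<i}" for c
      using that cl gr_bracket_simps(2,3)[of c "i - c"] by auto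
    note f = gr_factor_closed[of _ _ i]
    have "finprod (?Q i) (\<lambda>c. gr_bracket G c (i - c) (x c \<otimes>\<^bsub>?Q c\<^esub> y c) (z (i - c))) {1..<i}
      = finprod (?Q i) (\<lambda>c. gr_bracket G c (i - c) (x c) (z (i - c)) \<otimes>\<^bsub>?Q i\<^esub> gr_bracket G c (i - c) (y c) (z (i - c))) {1..<i}"
      by (rule Q.finprod_cong') (use f[OF x z] f[OF y z] 1 in auto)
    then show "finprod (?Q i) (\<lambda>c. gr_bracket G c (i - c) (x c \<otimes>\<^bsub>?Q c\<^esub> y c) (z (i - c))) {1..<i}
      = finprod (?Q i) (\<lambda>c. gr_bracket G c (i - c) (x c) (z (i - c))) {1..<i}
        \<otimes>\<^bsub>?Q i\<^esub> finprod (?Q i) (\<lambda>c. gr_bracket G c (i - c) (y c) (z (i - c))) {1..<i}"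
      using Q.finprod_multf[OF f[OF x z] f[OF y z]] by simp
    have "finprod (?Q i) (\<lambda>c. gr_bracket G c (i - c) (z c) (x (i - c) \<otimes>\<^bsub>?Q (i - c)\<^esub> y (i - c))) {1..<i}
      = finprod (?Q i) (\<lambda>c. gr_bracket G c (i - c) (z c) (x (i - c)) \<otimes>\<^bsub>?Q i\<^esub> gr_bracket G c (i - c) (z c) (y (i - c))) {1..<i}"
      by (rule Q.finprod_cong') (use f[OF z x] f[OF z y] 1 in auto)
    then show "finprod (?Q i) (\<lambda>c. gr_bracket G c (i - c) (z c) (x (i - c) \<otimes>\<^bsub>?Q (i - c)\<^esub> y (i - c))) {1..<i}
      = finprod (?Q i) (\<lambda>c. gr_bracket G c (i - c) (z c) (x (i - c))) {1..<i}
        \<otimes>\<^bsub>?Q i\<^esub> finprod (?Q i) (\<lambda>c. gr_bracket G c (i - c) (z c) (y (i - c))) {1..<i}"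
      using Q.finprod_multf[OF f[OF z x] f[OF z y]] by simp
  qed note * = this
  have cong: "finprod (?Q i) (\<lambda>c. gr_bracket G c (i - c) (f c) (g (i - c))) {1..<i}
      = finprod (?Q i) (\<lambda>c. gr_bracket G c (i - c) (f' c) (g' (i - c))) {1..<i}"
    if "i \<ge> 1" "\<And>c. c \<ge> 1 \<Longrightarrow> f c = f' c \<and> g c = g' c"
      "(\<lambda>c. gr_bracket G c (i - c) (f' c) (g' (i - c))) \<in> {1..<i} \<rightarrow> carrier (?Q i)" for i f f' g g'
    using comm_group.axioms(1)[OF comm_group_quotient[OF that(1)]] refl that(3)
    by (rule comm_monoid.finprod_cong') (use that in auto)
  interpret S: comm_group ?S by (rule comm_group_graded)
  have xy: "x \<otimes>\<^bsub>?S\<^esub> y \<in> carrier ?S" using x y by simp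
  have xyi: "(x \<otimes>\<^bsub>?S\<^esub> y) c = x c \<otimes>\<^bsub>?Q c\<^esub> y c" if "c \<ge> 1" for c
    using that by (simp add: gr_simps)
  have "finprod (?Q i) (\<lambda>c. gr_bracket G c (i - c) ((x \<otimes>\<^bsub>?S\<^esub> y) c) (z (i - c))) {1..<i}
      = finprod (?Q i) (\<lambda>c. gr_bracket G c (i - c) (x c \<otimes>\<^bsub>?Q c\<^esub> y c) (z (i - c))) {1..<i}"
    if "i \<ge> 1" for i
    by (rule cong[OF that, symmetric, where f = "\<lambda>c. x c \<otimes>\<^bsub>?Q c\<^esub> y c"])
      (use xyi gr_factor_closed[OF xy z, of i] in auto)
  then show "bracket ?S (x \<otimes>\<^bsub>?S\<^esub> y) z = bracket ?S x z \<otimes>\<^bsub>?S\<^esub> bracket ?S y z"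
    using * by (auto simp: gr_simps intro!: restrict_ext)
  have "finprod (?Q i) (\<lambda>c. gr_bracket G c (i - c) (z c) ((x \<otimes>\<^bsub>?S\<^esub> y) (i - c))) {1..<i}
      = finprod (?Q i) (\<lambda>c. gr_bracket G c (i - c) (z c) (x (i - c) \<otimes>\<^bsub>?Q (i - c)\<^esub> y (i - c))) {1..<i}"
    if "i \<ge> 1" for i
    by (rule cong[OF that, symmetric, where g = "\<lambda>c. x c \<otimes>\<^bsub>?Q c\<^esub> y c"])
      (use xyi gr_factor_closed[OF z xy, of i] in auto)
  then show "bracket ?S z (x \<otimes>\<^bsub>?S\<^esub> y) = bracket ?S z x \<otimes>\<^bsub>?S\<^esub> bracket ?S z y"
    using * by (auto simp: gr_simps intro!: restrict_ext)
qed

text \<open>In the sum that defines a component of the bracket only the pair of degrees \<open>(c, d)\<close> can contribute.\<close>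

lemma gr_br_single:
  assumes "c \<ge> 1" "d \<ge> 1" "a \<in> lower_central G c" "b \<in> lower_central G d"
  shows "bracket (associated_graded G) (gr_single G c (lc_class G c a)) (gr_single G d (lc_class G d b))
    = gr_single G (c + d) (lc_class G (c + d) (commutator G a b))"
proof -
  let ?Q = "lower_central_quotient G"
  let ?x = "gr_single G c (lc_class G c a)" and ?y = "gr_single G d (lc_class G d b)"
  have "finprod (?Q e) (\<lambda>k. gr_bracket G k (e - k) (?x k) (?y (e - k))) {1..<e}
      = (if e = c + d then lc_class G (c + d) (commutator G a b) else one (?Q e))" if e: "e \<ge> 1" for e
  proof -
    interpret Q: comm_group "?Q e" using e by (rule comm_group_quotient)
    let ?f = "\<lambda>k. gr_bracket G k (e - k) (?x k) (?y (e - k))"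
    note xc = gr_comp_closed[OF gr_single_closed[OF assms(3)]]
      and yc = gr_comp_closed[OF gr_single_closed[OF assms(4)]]
    have one: "?f k = one (?Q e)" if "k \<in> {1..<e}" "k \<noteq> c \<or> e - k \<noteq> d" for k
    proof (cases "k = c")
      case False
      then have "?x k = one (?Q k)" using that by (simp add: gr_single_def)
      then show ?thesis using gr_bracket_simps(4)[of k "e - k"] yc that by auto
    next
      case True
      then have "?y (e - k) = one (?Q (e - k))" using that by (auto simp: gr_single_def)
      then show ?thesis using gr_bracket_simps(5)[of k "e - k"] xc that by auto
    qed
    show ?thesis
    proof (cases "e = c + d")
      case False
      then have "finprod (?Q e) ?f {1..<e} = one (?Q e)"
        by (intro Q.finprod_one_eqI one) auto
      then show ?thesis using False by simp
    next
      case True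
      let ?v = "lc_class G (c + d) (commutator G a b)"
      have "?f c = ?v"
        using assms gr_bracket_class[OF assms] by (simp add: True gr_single_def)
      then have f: "?f k = (if c = k then ?v else one (?Q e))" if "k \<in> {1..<e}" for k
        using one[OF that] by auto
      have v: "?v \<in> carrier (?Q e)" using assms lower_central_commutator by (auto simp: True carrier_quotient)
      have "finprod (?Q e) ?f {1..<e} = finprod (?Q e) (\<lambda>k. if c = k then ?v else one (?Q e)) {1..<e}"
        by (rule Q.finprod_cong') (use f v in auto)
      also have "\<dots> = ?v"
        using Q.finprod_singleton[of c "{1..<e}" "\<lambda>_. ?v"] assms v by (auto simp: True)
      finally show ?thesis using True by simp
    qed
  qed
  then show ?thesis
    by (auto simp: associated_graded_simps(4) gr_single_def[of G "c + d"] intro!: restrict_ext)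
qed

text \<open>Antisymmetry, the alternating law and the Jacobi identity are extended one argument at a time from homogeneous
  elements.\<close>

theorem lie_algebra_graded: "lie_algebra (associated_graded G)"
proof -
  let ?S = "associated_graded G"
  interpret S: comm_group ?S by (rule comm_group_graded)
  note cl = gr_br_closed and dist = gr_br_mult
  have anti: "bracket ?S x y \<otimes>\<^bsub>?S\<^esub> bracket ?S y x = one ?S" if "x \<in> carrier ?S" "y \<in> carrier ?S" for x y
    using that
  proof (induction x arbitrary: y rule: gr_induct)
    case (single n a)
    show ?case using single(3)
    proof (induction y rule: gr_induct)
      case (single m b)
      have "commutator G a b \<otimes> commutator G b a = \<one>"
        using \<open>a \<in> _\<close> \<open>b \<in> _\<close> lower_central_carrier by (metis commutator_closed commutator_inv r_inv)
      then show ?case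
        using single \<open>1 \<le> n\<close> \<open>a \<in> _\<close> lower_central_commutator[of n m a b] lower_central_commutator[of m n b a]
        by (simp add: gr_br_single gr_single_mult gr_single_one add.commute)
    next
      case (mult y z)
      let ?x = "gr_single G n (lc_class G n a)"
      have x: "?x \<in> carrier ?S" using single gr_single_closed by simp
      have "bracket ?S ?x (y \<otimes>\<^bsub>?S\<^esub> z) \<otimes>\<^bsub>?S\<^esub> bracket ?S (y \<otimes>\<^bsub>?S\<^esub> z) ?x
        = (bracket ?S ?x y \<otimes>\<^bsub>?S\<^esub> bracket ?S y ?x) \<otimes>\<^bsub>?S\<^esub> (bracket ?S ?x z \<otimes>\<^bsub>?S\<^esub> bracket ?S z ?x)"
        using mult x by (simp add: dist cl S.m_ac)
      then show ?case using mult by simp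
    qed
  next
    case (mult x z)
    have "bracket ?S (x \<otimes>\<^bsub>?S\<^esub> z) y \<otimes>\<^bsub>?S\<^esub> bracket ?S y (x \<otimes>\<^bsub>?S\<^esub> z)
        = (bracket ?S x y \<otimes>\<^bsub>?S\<^esub> bracket ?S y x) \<otimes>\<^bsub>?S\<^esub> (bracket ?S z y \<otimes>\<^bsub>?S\<^esub> bracket ?S y z)"
      using mult by (simp add: dist cl S.m_ac)
    then show ?case using mult by simp
  qed
  have alt: "bracket ?S x x = one ?S" if "x \<in> carrier ?S" for x
    using that
  proof (induction x rule: gr_induct)
    case (single n a)
    have "commutator G a a = \<one>"
      using single lower_central_carrier[of a n] by (simp add: commutator_def m_assoc)
    then show ?case using single by (simp add: gr_br_single gr_single_one)
  next
    case (mult x y)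
    have "bracket ?S (x \<otimes>\<^bsub>?S\<^esub> y) (x \<otimes>\<^bsub>?S\<^esub> y)
        = bracket ?S x x \<otimes>\<^bsub>?S\<^esub> bracket ?S y y \<otimes>\<^bsub>?S\<^esub> (bracket ?S x y \<otimes>\<^bsub>?S\<^esub> bracket ?S y x)"
      using mult by (simp add: dist cl S.m_ac)
    then show ?case using mult anti by simp
  qed
  define J where "J x y z = bracket ?S x (bracket ?S y z) \<otimes>\<^bsub>?S\<^esub> bracket ?S y (bracket ?S z x)
    \<otimes>\<^bsub>?S\<^esub> bracket ?S z (bracket ?S x y)" for x y z
  have J1: "J (x \<otimes>\<^bsub>?S\<^esub> x') y z = J x y z \<otimes>\<^bsub>?S\<^esub> J x' y z"
    if "x \<in> carrier ?S" "x' \<in> carrier ?S" "y \<in> carrier ?S" "z \<in> carrier ?S" for x x' y z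
    using that by (simp add: J_def dist cl S.m_ac)
  have J2: "J y z x = J x y z" if "x \<in> carrier ?S" "y \<in> carrier ?S" "z \<in> carrier ?S" for x y z
    using that by (simp add: J_def dist cl S.m_ac)
  have J0: "J (gr_single G n (lc_class G n a)) (gr_single G m (lc_class G m b)) (gr_single G k (lc_class G k e)) = one ?S"
    if *: "n \<ge> 1" "a \<in> lower_central G n" "m \<ge> 1" "b \<in> lower_central G m" "k \<ge> 1" "e \<in> lower_central G k"
    for n a m b k e
  proof -
    note lc = lower_central_commutator
    have m: "commutator G a b \<in> lower_central G (n + m)" "commutator G b e \<in> lower_central G (m + k)"
      "commutator G e a \<in> lower_central G (k + n)" using * lc by blast+
    then have m': "commutator G a (commutator G b e) \<in> lower_central G (n + m + k)"
      "commutator G b (commutator G e a) \<in> lower_central G (n + m + k)"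
      "commutator G e (commutator G a b) \<in> lower_central G (n + m + k)"
      using * lc[of n "m + k" a "commutator G b e"] lc[of m "k + n" b "commutator G e a"]
        lc[of k "n + m" e "commutator G a b"] by (simp_all add: ac_simps)
    have "J (gr_single G n (lc_class G n a)) (gr_single G m (lc_class G m b)) (gr_single G k (lc_class G k e))
      = gr_single G (n + m + k) (lc_class G (n + m + k) (commutator G a (commutator G b e)))
       \<otimes>\<^bsub>?S\<^esub> gr_single G (n + m + k) (lc_class G (n + m + k) (commutator G b (commutator G e a)))
       \<otimes>\<^bsub>?S\<^esub> gr_single G (n + m + k) (lc_class G (n + m + k) (commutator G e (commutator G a b)))"
      using * m by (simp add: J_def gr_br_single ac_simps)
    also have "\<dots> = gr_single G (n + m + k) (one (lower_central_quotient G (n + m + k)))"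
      using m' Jacobi_class[OF *(1,3,5,2,4,6)] by (simp add: gr_single_mult lower_central_closed)
    also have "\<dots> = one ?S" by (simp add: one_quotient gr_single_one)
    finally show ?thesis .
  qed
  have jac: "J x y z = one ?S" if "x \<in> carrier ?S" "y \<in> carrier ?S" "z \<in> carrier ?S" for x y z
    using that
  proof (induction x arbitrary: y z rule: gr_induct)
    case (mult x x')
    then show ?case by (simp add: J1)
  next
    case x: (single n a)
    let ?x = "gr_single G n (lc_class G n a)"
    have xc: "?x \<in> carrier ?S" using x gr_single_closed by simp
    have "J y z ?x = one ?S" using x(3,4)
    proof (induction y arbitrary: z rule: gr_induct)
      case (mult y y')
      then show ?case using xc by (simp add: J1)
    next
      case y: (single m b)
      let ?y = "gr_single G m (lc_class G m b)"
      have yc: "?y \<in> carrier ?S" using y gr_single_closed by simp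
      have "J z ?x ?y = one ?S" using y(3)
      proof (induction z rule: gr_induct)
        case (mult z z')
        then show ?case using xc yc by (simp add: J1)
      next
        case (single k e)
        then show ?case using J0 x y by simp
      qed
      then show ?case using J2[OF _ xc yc, of z] J2[OF xc yc, of z] y(3) xc yc by simp
    qed
    then show ?case using J2[OF xc] x(3,4) by simp
  qed
  show ?thesis
    by (intro lie_algebra.intro lie_algebra_axioms.intro comm_group_graded)
      (use cl dist alt jac J_def in auto)
qed

end

section \<open>Homomorphisms and the lower central series\<close>

lemma (in group_hom) subgroup_preimage:
  assumes "subgroup N H"
  shows "subgroup {x \<in> carrier G. h x \<in> N} G"
proof -
  interpret N: subgroup N H by fact
  show ?thesis by (rule G.subgroupI) (auto intro!: exI[of _ "\<one>\<^bsub>G\<^esub>"])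
qed

lemma (in group_hom) hom_commutator:
  "a \<in> carrier G \<Longrightarrow> b \<in> carrier G \<Longrightarrow> h (commutator G a b) = commutator H (h a) (h b)"
  by (simp add: commutator_def)

lemma (in group_hom) hom_lower_central:
  assumes "n \<ge> 1" "x \<in> lower_central G n"
  shows "h x \<in> lower_central H n"
  using assms
proof (induction n arbitrary: x rule: nat_induct_at_least)
  case base
  then show ?case by simp
next
  case (Suc n)
  have "lower_central G (Suc n) \<subseteq> {x \<in> carrier G. h x \<in> lower_central H (Suc n)}"
  proof (rule G.lower_central_Suc_minimal[OF Suc.hyps])
    show "subgroup {x \<in> carrier G. h x \<in> lower_central H (Suc n)} G"
      by (rule subgroup_preimage[OF H.lower_central_subgroup])
    fix a b assume ab: "a \<in> lower_central G n" "b \<in> carrier G"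
    then show "commutator G a b \<in> {x \<in> carrier G. h x \<in> lower_central H (Suc n)}"
      using Suc G.lower_central_carrier H.lower_central_commutator_carrier
      by (simp add: hom_commutator del: lower_central.simps)
  qed
  then show ?case using Suc.prems by blast
qed

text \<open>A commutator of \<open>a\<close> and \<open>b\<close> is changed by \<open>\<phi>\<close> only modulo the next term, since its class depends on the
  classes of \<open>a\<close> and \<open>b\<close> alone and \<open>\<phi>\<close> fixes these.\<close>

lemma (in group) IA_displacement:
  assumes h: "\<phi> \<in> hom G G"
    and gen: "carrier G = generate G S" "S \<subseteq> carrier G"
    and S: "\<And>x. x \<in> S \<Longrightarrow> \<phi> x \<otimes> inv x \<in> lower_central G 2"
    and "n \<ge> 1" "x \<in> lower_central G n"
  shows "\<phi> x \<otimes> inv x \<in> lower_central G (Suc n)"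
proof -
  interpret h: group_hom G G \<phi> by unfold_locales (rule h)
  note cl = lower_central_closed and carr = lower_central_carrier
  have sub: "subgroup {x \<in> carrier G. \<phi> x \<otimes> inv x \<in> lower_central G k} G" for k
  proof (rule subgroupI)
    have "\<one> \<in> {x \<in> carrier G. \<phi> x \<otimes> inv x \<in> lower_central G k}" using cl(3) by simp
    then show "{x \<in> carrier G. \<phi> x \<otimes> inv x \<in> lower_central G k} \<noteq> {}" by blast
    fix a b assume a: "a \<in> {x \<in> carrier G. \<phi> x \<otimes> inv x \<in> lower_central G k}"
    then have "inv a \<otimes> inv (\<phi> a \<otimes> inv a) \<otimes> a \<in> lower_central G k" using cl by blast
    moreover have "inv a \<otimes> inv (\<phi> a \<otimes> inv a) \<otimes> a = \<phi> (inv a) \<otimes> inv (inv a)"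
      using a by (simp add: inv_mult_group m_assoc)
    ultimately show "inv a \<in> {x \<in> carrier G. \<phi> x \<otimes> inv x \<in> lower_central G k}" using a by simp
    assume b: "b \<in> {x \<in> carrier G. \<phi> x \<otimes> inv x \<in> lower_central G k}"
    have "(\<phi> a \<otimes> inv a) \<otimes> (a \<otimes> (\<phi> b \<otimes> inv b) \<otimes> inv a) \<in> lower_central G k"
      by (rule cl(1)[OF _ cl(5)]) (use a b in auto)
    moreover have "(\<phi> a \<otimes> inv a) \<otimes> (a \<otimes> (\<phi> b \<otimes> inv b) \<otimes> inv a) = \<phi> (a \<otimes> b) \<otimes> inv (a \<otimes> b)"
      using a b by (simp add: inv_mult_group m_assoc)
    ultimately show "a \<otimes> b \<in> {x \<in> carrier G. \<phi> x \<otimes> inv x \<in> lower_central G k}" using a b by simp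
  qed auto
  have base: "\<phi> x \<otimes> inv x \<in> lower_central G 2" if "x \<in> carrier G" for x
    using generate_subgroup_incl[OF _ sub[of 2], of S] that gen S by auto
  show ?thesis using assms(5,6)
  proof (induction n arbitrary: x rule: nat_induct_at_least)
    case base
    then show ?case using \<open>\<And>x. x \<in> carrier G \<Longrightarrow> _\<close> by (simp add: numeral_2_eq_2)
  next
    case (Suc n)
    have "lower_central G (Suc n) \<subseteq> {x \<in> carrier G. \<phi> x \<otimes> inv x \<in> lower_central G (Suc (Suc n))}"
    proof (rule lower_central_Suc_minimal[OF Suc.hyps sub])
      fix a b assume ab: "a \<in> lower_central G n" "b \<in> carrier G"
      let ?u = "\<phi> a \<otimes> inv a" and ?v = "\<phi> b \<otimes> inv b"
      have ac: "a \<in> carrier G" using ab carr by blast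
      have u: "?u \<in> lower_central G (Suc n)" using Suc.IH ab by blast
      have v: "?v \<in> lower_central G (Suc 1)" using base[OF ab(2)] by (simp add: numeral_2_eq_2 del: lower_central.simps)
      have \<phi>a: "\<phi> a \<in> lower_central G n" using h.hom_lower_central[OF Suc.hyps ab(1)] .
      have eq: "?u \<otimes> a = \<phi> a" "?v \<otimes> b = \<phi> b" using ac ab by (simp_all add: m_assoc)
      have "lc_class G (n + 1) (commutator G (?u \<otimes> a) (?v \<otimes> b)) = lc_class G (n + 1) (commutator G (?u \<otimes> a) b)"
        by (rule commutator_class_right_cong[OF Suc.hyps]) (use \<phi>a eq ab v in auto)
      also have "\<dots> = lc_class G (n + 1) (commutator G a b)"
        by (rule commutator_class_left_cong[OF Suc.hyps]) (use ab u in auto)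
      finally have "lc_class G (n + 1) (\<phi> (commutator G a b)) = lc_class G (n + 1) (commutator G a b)"
        using ac ab by (simp add: eq h.hom_commutator)
      then show "commutator G a b \<in> {x \<in> carrier G. \<phi> x \<otimes> inv x \<in> lower_central G (Suc (Suc n))}"
        using ac ab by (simp add: lc_class_eq_iff del: lower_central.simps)
    qed
    then show ?case using Suc.prems by blast
  qed
qed

section \<open>The free group of rank three\<close>

datatype idx = I1 | I2 | I3

instance idx :: finite
proof
  have "x \<in> {I1, I2, I3}" for x by (cases x) auto
  then have "(UNIV :: idx set) \<subseteq> {I1, I2, I3}" by blast
  then show "finite (UNIV :: idx set)" by (rule finite_subset) simp
qed

primrec nxt :: "idx \<Rightarrow> idx" where "nxt I1 = I2" | "nxt I2 = I3" | "nxt I3 = I1"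

primrec num :: "idx \<Rightarrow> nat" where "num I1 = 1" | "num I2 = 2" | "num I3 = 3"

lemma nxt_simps [simp]: "nxt i \<noteq> i" "i \<noteq> nxt i" "nxt (nxt i) \<noteq> i" "i \<noteq> nxt (nxt i)" "nxt (nxt (nxt i)) = i"
  by (cases i; simp)+

lemma idx_cases3: obtains "j = i" | "j = nxt i" | "j = nxt (nxt i)"
  by (cases i; cases j) auto

lemma num_eq_iff [simp]: "num i = num j \<longleftrightarrow> i = j"
  by (cases i; cases j) auto

lemma num_range: "range num = {1..3}"
proof -
  have U: "(UNIV :: idx set) = {I1, I2, I3}" by (auto intro: idx.exhaust)
  have "{1..3} = {1, 2, 3 :: nat}" by auto
  then show ?thesis by (simp add: U)
qed

definition F3 :: "nat fgroup monoid" where "F3 = free_group {1..3}"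

interpretation F: group F3 unfolding F3_def by (rule group_free_group)

definition gen3 :: "idx \<Rightarrow> nat fgroup" where "gen3 i = fg_gen (num i)"

lemma gen3_closed [simp]: "gen3 i \<in> carrier F3"
  unfolding gen3_def F3_def using num_range by (intro fg_gen_closed) blast

lemma carrier_F3: "carrier F3 = generate F3 (range gen3)"
proof -
  have "range gen3 = fg_gen ` {1..3}"
    by (simp only: num_range[symmetric] image_image gen3_def[abs_def])
  then show ?thesis using generate_fg_gen[of "{1..3 :: nat}"] by (simp only: F3_def)
qed

lemma F3_subgroup_eq:
  assumes "subgroup N F3" "\<And>i. gen3 i \<in> N"
  shows "N = carrier F3"
  using F.generate_subgroup_incl[of "range gen3" N] assms subgroup.subset[OF assms(1)]
  by (auto simp: carrier_F3)

lemma F3_hom_exists: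
  assumes "group H" "\<And>i. f i \<in> carrier H"
  shows "\<exists>\<phi>. \<phi> \<in> hom F3 H \<and> (\<forall>i. \<phi> (gen3 i) = f i)"
proof -
  have "f (inv_into UNIV num x) \<in> carrier H" for x using assms by blast
  from ex1_implies_ex[OF free_group_universal[OF assms(1), of "{1..3}" "\<lambda>x. f (inv_into UNIV num x)", OF this]]
  obtain \<phi> where \<phi>: "\<phi> \<in> hom F3 H" "\<forall>x\<in>{1..3}. \<phi> (fg_gen x) = f (inv_into UNIV num x)"
    unfolding F3_def by blast
  have "num i \<in> {1..3}" for i unfolding num_range[symmetric] by (rule rangeI)
  moreover have "inv_into UNIV num (num i) = i" for i by (rule inv_f_f) (simp add: inj_def)
  ultimately have "\<phi> (gen3 i) = f i" for i using \<phi>(2) unfolding gen3_def by metis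
  then show ?thesis using \<phi>(1) by blast
qed

lemma F3_hom_eqI:
  assumes "group H" "\<phi> \<in> hom F3 H" "\<psi> \<in> hom F3 H" "\<And>i. \<phi> (gen3 i) = \<psi> (gen3 i)" "x \<in> carrier F3"
  shows "\<phi> x = \<psi> x"
proof (rule hom_free_group_eqI[OF assms(1-3)[unfolded F3_def]])
  fix k :: nat assume "k \<in> {1..3}"
  then obtain i where "k = num i" unfolding num_range[symmetric] by blast
  then show "\<phi> (fg_gen k) = \<psi> (fg_gen k)" using assms(4)[of i] by (simp add: gen3_def)
qed (rule assms(5)[unfolded F3_def])

section \<open>Normal forms\<close>

text \<open>A list \<open>[(i\<^sub>1, k\<^sub>1), \<dots>]\<close> of syllables stands for \<open>g\<^bsub>i\<^sub>1\<^esub>\<^bsup>k\<^sub>1\<^esup> \<cdots>\<close>.\<close>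

primrec syl_eval :: "(idx \<times> int) list \<Rightarrow> nat fgroup" where
  "syl_eval [] = \<one>\<^bsub>F3\<^esub>"
| "syl_eval (p # s) = gen3 (fst p) [^]\<^bsub>F3\<^esub> snd p \<otimes>\<^bsub>F3\<^esub> syl_eval s"

definition syl_normal :: "(idx \<times> int) list \<Rightarrow> bool" where
  "syl_normal s \<longleftrightarrow> (\<forall>p\<in>set s. snd p \<noteq> 0) \<and> distinct_adj (map fst s)"

lemma syl_normal_Cons:
  "syl_normal (p # s) \<longleftrightarrow> snd p \<noteq> 0 \<and> syl_normal s \<and> (s = [] \<or> fst (hd s) \<noteq> fst p)"
  by (cases s) (auto simp: syl_normal_def)

lemma syl_eval_closed [simp]: "syl_eval s \<in> carrier F3"
  by (induction s) simp_all

lemma syl_mult: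
  assumes "syl_normal s"
  shows "\<exists>s'. syl_normal s' \<and> gen3 i [^]\<^bsub>F3\<^esub> (k::int) \<otimes>\<^bsub>F3\<^esub> syl_eval s = syl_eval s'"
proof (cases "k = 0")
  case True
  then show ?thesis using assms by (intro exI[of _ s]) simp
next
  case False
  show ?thesis
  proof (cases "s = [] \<or> fst (hd s) \<noteq> i")
    case True
    then show ?thesis using assms False by (intro exI[of _ "(i, k) # s"]) (simp add: syl_normal_Cons)
  next
    case hd: False
    then obtain l t where s: "s = (i, l) # t" by (cases s) auto
    have e: "gen3 i [^]\<^bsub>F3\<^esub> k \<otimes>\<^bsub>F3\<^esub> syl_eval s = gen3 i [^]\<^bsub>F3\<^esub> (k + l) \<otimes>\<^bsub>F3\<^esub> syl_eval t"
      by (simp add: s F.int_pow_mult F.m_assoc)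
    show ?thesis
    proof (cases "k + l = 0")
      case True
      then show ?thesis using e assms s by (intro exI[of _ t]) (simp add: syl_normal_Cons)
    next
      case False
      then show ?thesis using e assms s
        by (intro exI[of _ "(i, k + l) # t"]) (simp add: syl_normal_Cons)
    qed
  qed
qed

lemma syl_exists:
  assumes "x \<in> carrier F3"
  shows "\<exists>s. syl_normal s \<and> x = syl_eval s"
proof -
  define P where "P x \<longleftrightarrow> (\<forall>s. syl_normal s \<longrightarrow> (\<exists>s'. syl_normal s' \<and> x \<otimes>\<^bsub>F3\<^esub> syl_eval s = syl_eval s'))" for x
  have "P x \<and> x \<in> carrier F3" if "x \<in> generate F3 (range gen3)"
    using that
  proof induction
    case one
    then show ?case by (auto simp: P_def)
  next
    case (incl h)
    then obtain i where "h = gen3 i" by blast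
    then show ?case using syl_mult[of _ i 1] by (auto simp: P_def)
  next
    case (inv h)
    then obtain i where "h = gen3 i" by blast
    then show ?case using syl_mult[of _ i "-1"] by (auto simp: P_def F.int_pow_neg)
  next
    case (eng h1 h2)
    then show ?case by (simp add: P_def F.m_assoc) metis
  qed
  then have "P x" using assms by (simp add: carrier_F3)
  moreover have "syl_normal []" by (simp add: syl_normal_def)
  ultimately obtain s' where "syl_normal s'" "x \<otimes>\<^bsub>F3\<^esub> syl_eval [] = syl_eval s'"
    unfolding P_def by blast
  then show ?thesis using assms by auto
qed

section \<open>The Magnus embedding\<close>

definition nc_geom :: "'x \<Rightarrow> 'x ncps" where
  "nc_geom x = Abs_ncps (\<lambda>w. if set w \<subseteq> {x} then (- 1) ^ length w else 0)"

lemma nc_geom_inverse: "(1 + nc_var x) * nc_geom x = 1" "nc_geom x * (1 + nc_var x) = 1"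
proof -
  show "(1 + nc_var x) * nc_geom x = 1"
  proof (rule ncps_eqI)
    fix w show "nc_coeff ((1 + nc_var x) * nc_geom x) w = nc_coeff 1 w"
      by (cases w) (auto simp: distrib_right nc_var_mult_coeff nc_coeff_one nc_geom_def nc_coeff_var)
  qed
  show "nc_geom x * (1 + nc_var x) = 1"
  proof (rule ncps_eqI)
    fix w show "nc_coeff (nc_geom x * (1 + nc_var x)) w = nc_coeff 1 w"
      by (cases w rule: rev_cases)
        (auto simp: distrib_left mult_nc_var_coeff nc_coeff_one nc_geom_def nc_coeff_var)
  qed
qed

lemma nc_var_unit: "1 + nc_var x \<in> carrier nc_units"
  using nc_geom_inverse[of x]
  by (auto simp: nc_units_def nc_coeff_one nc_coeff_var nc_geom_def intro!: exI[of _ "nc_geom x"])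

definition magnus :: "nat fgroup \<Rightarrow> idx ncps" where
  "magnus = (SOME \<phi>. \<phi> \<in> hom F3 nc_units \<and> (\<forall>i. \<phi> (gen3 i) = 1 + nc_var i))"

lemma magnus: "magnus \<in> hom F3 nc_units" "magnus (gen3 i) = 1 + nc_var i"
  using someI_ex[OF F3_hom_exists[OF group_nc_units, of "\<lambda>i. 1 + nc_var i", OF nc_var_unit]] unfolding magnus_def by blast+

interpretation mag: group_hom F3 nc_units magnus
  by (intro group_hom.intro group_hom_axioms.intro F.is_group group_nc_units magnus)

lemma magnus_mult: "x \<in> carrier F3 \<Longrightarrow> y \<in> carrier F3 \<Longrightarrow> magnus (x \<otimes>\<^bsub>F3\<^esub> y) = magnus x * magnus y"
  using mag.hom_mult by simp

lemma magnus_commutator: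
  "x \<in> carrier F3 \<Longrightarrow> y \<in> carrier F3 \<Longrightarrow> magnus (commutator F3 x y) = commutator nc_units (magnus x) (magnus y)"
  by (rule mag.hom_commutator)

lemma magnus_inv_gen: "magnus (inv\<^bsub>F3\<^esub> gen3 i) = nc_geom i"
proof -
  have "magnus (inv\<^bsub>F3\<^esub> gen3 i) * (1 + nc_var i) = 1"
    using magnus_mult[of "inv\<^bsub>F3\<^esub> gen3 i" "gen3 i"] mag.hom_one by (simp add: magnus)
  then have "magnus (inv\<^bsub>F3\<^esub> gen3 i) * ((1 + nc_var i) * nc_geom i) = nc_geom i"
    by (simp only: mult.assoc[symmetric]) simp
  then show ?thesis by (simp add: nc_geom_inverse)
qed

text \<open>What matters about \<open>(1 + x\<^sub>i)\<^sup>k\<close>: it involves no variable but \<open>x\<^sub>i\<close>, and its linear coefficient is \<open>k\<close>.\<close>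

definition power_like :: "'x \<Rightarrow> int \<Rightarrow> 'x ncps \<Rightarrow> bool" where
  "power_like i k f \<longleftrightarrow> nc_coeff f [] = 1 \<and> nc_coeff f [i] = k \<and> (\<forall>w. \<not> set w \<subseteq> {i} \<longrightarrow> nc_coeff f w = 0)"

lemma power_like_mult: "power_like i k f \<Longrightarrow> power_like i l g \<Longrightarrow> power_like i (k + l) (f * g)"
proof -
  have "conv_at w f g = 0"
    if "\<And>w. \<not> set w \<subseteq> {i} \<Longrightarrow> f w = 0" "\<And>w. \<not> set w \<subseteq> {i} \<Longrightarrow> g w = 0" "\<not> set w \<subseteq> {i}" for f g w
    using that(1,3)
  proof (induction w arbitrary: f)
    case (Cons x w)
    show ?case
    proof (cases "x = i")
      case True
      then show ?thesis using Cons that(2)[of "x # w"] by auto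
    next
      case False
      then have "(\<lambda>v. f (x # v)) = (\<lambda>_. 0)" using Cons.prems by auto
      then show ?thesis using that(2)[of "x # w"] False by (simp add: conv_at_zero_left)
    qed
  qed simp
  then show "power_like i k f \<Longrightarrow> power_like i l g \<Longrightarrow> power_like i (k + l) (f * g)"
    by (simp add: power_like_def nc_coeff_mult)
qed

lemma magnus_power: "power_like i k (magnus (gen3 i [^]\<^bsub>F3\<^esub> k))"
proof (induction k rule: int_induct[where k = 0])
  case base
  then show ?case using mag.hom_one by (auto simp: power_like_def nc_coeff_one)
next
  case (step1 k)
  have "power_like i 1 (1 + nc_var i)"
    by (auto simp: power_like_def nc_coeff_one nc_coeff_var)
  then show ?case
    using power_like_mult[OF step1(2)] by (simp add: F.int_pow_mult magnus_mult magnus)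
next
  case (step2 k)
  have "power_like i (- 1) (nc_geom i)"
    by (auto simp: power_like_def nc_geom_def)
  from power_like_mult[OF step2(2) this] show ?case
    by (simp add: F.int_pow_diff magnus_mult magnus_inv_gen)
qed

lemma power_like_mult_coeff:
  assumes "power_like i k f" "distinct_adj (y # v)"
  shows "nc_coeff (f * g) (y # v) = nc_coeff g (y # v) + (if y = i then k * nc_coeff g v else 0)"
proof -
  have f: "nc_coeff f [] = 1" "nc_coeff f [i] = k" "\<And>w. \<not> set w \<subseteq> {i} \<Longrightarrow> nc_coeff f w = 0"
    using assms(1) by (auto simp: power_like_def)
  have "conv_at v (\<lambda>u. nc_coeff f (y # u)) (nc_coeff g) = (if y = i then k * nc_coeff g v else 0)"
  proof (cases "y = i")
    case False
    then have "(\<lambda>u. nc_coeff f (y # u)) = (\<lambda>_. 0)" using f(3) by auto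
    then show ?thesis using False by (simp add: conv_at_zero_left)
  next
    case True
    show ?thesis
    proof (cases v)
      case (Cons z u)
      then have "(\<lambda>u. nc_coeff f (y # z # u)) = (\<lambda>_. 0)" using f(3) assms(2) True by auto
      then show ?thesis using True f by (simp add: Cons conv_at_zero_left)
    qed (use True f in simp)
  qed
  then show ?thesis by (simp add: nc_coeff_mult f)
qed

text \<open>In a word without repeated neighbours each syllable can contribute at most one letter, so such a word of length
  at least the number of syllables occurs only if every syllable contributes its linear term.\<close>

lemma magnus_syl_coeff:
  assumes "distinct_adj v" "length v \<ge> length s"
  shows "nc_coeff (magnus (syl_eval s)) v = (if v = map fst s then prod_list (map snd s) else 0)"
  using assms
proof (induction s arbitrary: v)
  case Nil
  then show ?case using mag.hom_one by (simp add: nc_coeff_one)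
next
  case (Cons p s)
  then obtain y u where v: "v = y # u" by (cases v) auto
  have u: "distinct_adj u" using Cons.prems v by (cases u) auto
  have "length (y # u) > length s" using Cons.prems v by simp
  then have ne: "y # u \<noteq> map fst s" by (metis length_map less_irrefl)
  have "nc_coeff (magnus (syl_eval (p # s))) v
      = nc_coeff (magnus (syl_eval s)) v + (if y = fst p then snd p * nc_coeff (magnus (syl_eval s)) u else 0)"
    using power_like_mult_coeff[OF magnus_power, of y u "fst p" "snd p" "magnus (syl_eval s)"] Cons.prems
    by (simp add: v magnus_mult)
  also have "\<dots> = (if y = fst p then snd p * nc_coeff (magnus (syl_eval s)) u else 0)"
    using Cons.IH[of v] Cons.prems ne by (simp add: v)
  also have "\<dots> = (if v = map fst (p # s) then prod_list (map snd (p # s)) else 0)"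
    using Cons.IH[of u] Cons.prems u by (auto simp: v)
  finally show ?case .
qed

text \<open>The linear terms of the syllables of a normal form multiply to a nonzero coefficient.\<close>

theorem magnus_inj:
  assumes "x \<in> carrier F3" "magnus x = 1"
  shows "x = \<one>\<^bsub>F3\<^esub>"
proof -
  obtain s where s: "syl_normal s" "x = syl_eval s" using syl_exists[OF assms(1)] by blast
  have "prod_list (map snd s) \<noteq> 0"
    using s(1) by (auto simp: syl_normal_def prod_list_zero_iff)
  moreover have "nc_coeff (magnus (syl_eval s)) (map fst s) = prod_list (map snd s)"
    using magnus_syl_coeff[of "map fst s" s] s(1) by (simp add: syl_normal_def)
  ultimately have "map fst s = []"
    using assms(2) s(2) by (auto simp: nc_coeff_one split: if_splits)
  then show ?thesis using s(2) by simp
qed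

lemma nc_low_one: "a \<in> carrier nc_units \<Longrightarrow> a \<in> nc_low 1"
  by (simp add: nc_low_def nc_units_low_1)

theorem magnus_lower_central:
  assumes "n \<ge> 1" "x \<in> lower_central F3 n"
  shows "magnus x \<in> nc_low n"
  using assms
proof (induction n arbitrary: x rule: nat_induct_at_least)
  case base
  then show ?case by (intro nc_low_one mag.hom_closed) simp
next
  case (Suc n)
  have "lower_central F3 (Suc n) \<subseteq> {x \<in> carrier F3. magnus x \<in> nc_low (Suc n)}"
  proof (rule F.lower_central_Suc_minimal[OF Suc.hyps mag.subgroup_preimage[OF subgroup_nc_low]])
    fix a b assume ab: "a \<in> lower_central F3 n" "b \<in> carrier F3"
    then have "commutator nc_units (magnus a) (magnus b) \<in> nc_low (n + 1)"
      using Suc.IH by (intro nc_low_commutator nc_low_one) auto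
    then show "commutator F3 a b \<in> {x \<in> carrier F3. magnus x \<in> nc_low (Suc n)}"
      using ab F.lower_central_carrier by (simp add: magnus_commutator)
  qed
  then show ?case using Suc.prems by blast
qed

theorem F3_residually_nilpotent:
  assumes "x \<in> carrier F3" "\<And>n. n \<ge> 1 \<Longrightarrow> x \<in> lower_central F3 n"
  shows "x = \<one>\<^bsub>F3\<^esub>"
proof (rule magnus_inj[OF assms(1)])
  have "magnus x - 1 = 0"
  proof (rule ncps_eqI)
    fix w :: "idx list"
    have "magnus x \<in> nc_low (Suc (length w))" by (rule magnus_lower_central) (use assms(2) in auto)
    then show "nc_coeff (magnus x - 1) w = nc_coeff 0 w" by (auto simp: nc_low_def low_def)
  qed
  then show "magnus x = 1" by simp
qed

lemma leads_magnus_gen: "leads 1 (magnus (gen3 i)) (fl_gen i)"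
  by (simp only: magnus) (rule leads_gen[OF nc_var_unit])

section \<open>Automorphisms of the free group\<close>

definition A3 :: "(nat fgroup \<Rightarrow> nat fgroup) monoid" where "A3 = AutoGroup F3"

interpretation A: group A3 unfolding A3_def by (rule F.AutoGroup)

lemma A3_carrier: "carrier A3 = auto F3"
  by (simp add: A3_def AutoGroup_def)

lemma A3_hom: "\<phi> \<in> carrier A3 \<Longrightarrow> \<phi> \<in> hom F3 F3"
  by (simp add: A3_carrier auto_def)

lemma A3_group_hom: "\<phi> \<in> carrier A3 \<Longrightarrow> group_hom F3 F3 \<phi>"
  by (simp add: group_hom_def group_hom_axioms_def A3_hom F.is_group)

lemma A3_simps [simp]:
  assumes "\<phi> \<in> carrier A3"
  shows "x \<in> carrier F3 \<Longrightarrow> \<phi> x \<in> carrier F3"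
    and "x \<in> carrier F3 \<Longrightarrow> y \<in> carrier F3 \<Longrightarrow> \<phi> (x \<otimes>\<^bsub>F3\<^esub> y) = \<phi> x \<otimes>\<^bsub>F3\<^esub> \<phi> y"
    and "x \<in> carrier F3 \<Longrightarrow> \<phi> (inv\<^bsub>F3\<^esub> x) = inv\<^bsub>F3\<^esub> (\<phi> x)"
    and "\<phi> \<one>\<^bsub>F3\<^esub> = \<one>\<^bsub>F3\<^esub>"
    and "x \<in> carrier F3 \<Longrightarrow> \<phi> (x [^]\<^bsub>F3\<^esub> (k :: int)) = \<phi> x [^]\<^bsub>F3\<^esub> k"
proof -
  interpret group_hom F3 F3 \<phi> by (rule A3_group_hom[OF assms])
  show "x \<in> carrier F3 \<Longrightarrow> \<phi> x \<in> carrier F3"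
    "x \<in> carrier F3 \<Longrightarrow> y \<in> carrier F3 \<Longrightarrow> \<phi> (x \<otimes>\<^bsub>F3\<^esub> y) = \<phi> x \<otimes>\<^bsub>F3\<^esub> \<phi> y"
    "x \<in> carrier F3 \<Longrightarrow> \<phi> (inv\<^bsub>F3\<^esub> x) = inv\<^bsub>F3\<^esub> (\<phi> x)"
    "\<phi> \<one>\<^bsub>F3\<^esub> = \<one>\<^bsub>F3\<^esub>"
    "x \<in> carrier F3 \<Longrightarrow> \<phi> (x [^]\<^bsub>F3\<^esub> (k :: int)) = \<phi> x [^]\<^bsub>F3\<^esub> k"
    by (simp_all add: hom_int_pow)
qed

lemma A3_apply [simp]:
  assumes "\<phi> \<in> carrier A3" "\<psi> \<in> carrier A3" "x \<in> carrier F3"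
  shows "(\<phi> \<otimes>\<^bsub>A3\<^esub> \<psi>) x = \<phi> (\<psi> x)"
  using assms by (simp add: A3_carrier) (simp add: A3_def AutoGroup_def BijGroup_def auto_def compose_def)

lemma A3_one_apply [simp]: "x \<in> carrier F3 \<Longrightarrow> \<one>\<^bsub>A3\<^esub> x = x"
  by (simp add: A3_def AutoGroup_def BijGroup_def)

lemma A3_inv_apply [simp]:
  assumes "\<phi> \<in> carrier A3" "x \<in> carrier F3"
  shows "(inv\<^bsub>A3\<^esub> \<phi>) (\<phi> x) = x" "\<phi> ((inv\<^bsub>A3\<^esub> \<phi>) x) = x"
  using assms A3_apply[of "inv\<^bsub>A3\<^esub> \<phi>" \<phi> x] A3_apply[of \<phi> "inv\<^bsub>A3\<^esub> \<phi>" x] by simp_all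

lemma A3_eqI:
  assumes "\<phi> \<in> carrier A3" "\<psi> \<in> carrier A3" "\<And>i. \<phi> (gen3 i) = \<psi> (gen3 i)"
  shows "\<phi> = \<psi>"
proof (rule extensionalityI[of _ "carrier F3"])
  show "\<phi> \<in> extensional (carrier F3)" "\<psi> \<in> extensional (carrier F3)"
    using assms by (auto simp: A3_carrier auto_def Bij_def)
  show "\<phi> x = \<psi> x" if "x \<in> carrier F3" for x
    using F3_hom_eqI[OF F.is_group A3_hom A3_hom] assms that by blast
qed

text \<open>With \<open>g\<close> on the left, \<open>inner\<close> is a homomorphism and not an antihomomorphism.\<close>

definition inner :: "nat fgroup \<Rightarrow> nat fgroup \<Rightarrow> nat fgroup" where
  "inner g = (\<lambda>x\<in>carrier F3. g \<otimes>\<^bsub>F3\<^esub> x \<otimes>\<^bsub>F3\<^esub> inv\<^bsub>F3\<^esub> g)"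

lemma inner_apply [simp]: "x \<in> carrier F3 \<Longrightarrow> inner g x = g \<otimes>\<^bsub>F3\<^esub> x \<otimes>\<^bsub>F3\<^esub> inv\<^bsub>F3\<^esub> g"
  by (simp add: inner_def)

lemma inner_closed [simp]:
  assumes g: "g \<in> carrier F3"
  shows "inner g \<in> carrier A3"
proof -
  have "inner g \<in> hom F3 F3"
    using g by (auto simp: hom_def F.m_assoc)
  moreover have "bij_betw (inner g) (carrier F3) (carrier F3)"
    by (rule bij_betw_byWitness[where f' = "inner (inv\<^bsub>F3\<^esub> g)"]) (use g in \<open>auto simp: F.m_assoc\<close>)
  moreover have "inner g \<in> extensional (carrier F3)" by (simp add: inner_def)
  ultimately show ?thesis by (simp add: A3_carrier auto_def Bij_def)
qed

lemma inner_mult: "g \<in> carrier F3 \<Longrightarrow> h \<in> carrier F3 \<Longrightarrow> inner (g \<otimes>\<^bsub>F3\<^esub> h) = inner g \<otimes>\<^bsub>A3\<^esub> inner h"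
  by (rule A3_eqI) (simp_all add: F.m_assoc F.inv_mult_group)

lemma inner_hom: "group_hom F3 A3 inner"
  by (simp add: group_hom_def group_hom_axioms_def F.is_group A.is_group hom_def inner_mult)

interpretation inner: group_hom F3 A3 inner by (rule inner_hom)

lemma aut_inner:
  "\<phi> \<in> carrier A3 \<Longrightarrow> g \<in> carrier F3 \<Longrightarrow> \<phi> \<otimes>\<^bsub>A3\<^esub> inner g = inner (\<phi> g) \<otimes>\<^bsub>A3\<^esub> \<phi>"
  by (rule A3_eqI) simp_all

section \<open>Generators of the McCool group\<close>

definition chi :: "idx \<Rightarrow> idx \<Rightarrow> nat fgroup \<Rightarrow> nat fgroup" where
  "chi i j = basis_conj 3 (num i) (num j)"

lemma chi_props:
  assumes "i \<noteq> j"
  shows "chi i j \<in> carrier A3" "chi i j (gen3 i) = inv\<^bsub>F3\<^esub> gen3 j \<otimes>\<^bsub>F3\<^esub> gen3 i \<otimes>\<^bsub>F3\<^esub> gen3 j"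
    "k \<noteq> i \<Longrightarrow> chi i j (gen3 k) = gen3 k"
proof -
  have mem: "num k \<in> {1..3}" for k unfolding num_range[symmetric] by (rule rangeI)
  have "num i \<noteq> num j" using assms by simp
  from theI'[OF basis_conj_ex1[OF mem mem this refl]]
  have *: "chi i j \<in> auto F3 \<and> chi i j (gen3 i) = gen3 i \<otimes>\<^bsub>F3\<^esub> commutator F3 (gen3 i) (gen3 j)
      \<and> (\<forall>k\<in>{1..3} - {num i}. chi i j (fg_gen k) = fg_gen k)"
    unfolding chi_def basis_conj_def Let_def F3_def gen3_def .
  then show "chi i j \<in> carrier A3" by (simp add: A3_carrier)
  show "chi i j (gen3 i) = inv\<^bsub>F3\<^esub> gen3 j \<otimes>\<^bsub>F3\<^esub> gen3 i \<otimes>\<^bsub>F3\<^esub> gen3 j"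
    using * by (simp add: commutator_def F.m_assoc)
  show "chi i j (gen3 k) = gen3 k" if "k \<noteq> i"
    using * mem[of k] that by (simp add: gen3_def)
qed

text \<open>The inverse is taken so that \<open>(beta j, inner g) = (inner g\<^sub>j, inner g)\<close> holds for \<open>g = g\<^bsub>j+1\<^esub>\<close> without signs.\<close>

definition beta :: "idx \<Rightarrow> nat fgroup \<Rightarrow> nat fgroup" where
  "beta j = inv\<^bsub>A3\<^esub> (chi (nxt j) j)"

lemma beta_closed [simp]: "beta j \<in> carrier A3"
  by (simp add: beta_def chi_props)

lemma beta_gen:
  "beta j (gen3 (nxt j)) = gen3 j \<otimes>\<^bsub>F3\<^esub> gen3 (nxt j) \<otimes>\<^bsub>F3\<^esub> inv\<^bsub>F3\<^esub> gen3 j"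
  "k \<noteq> nxt j \<Longrightarrow> beta j (gen3 k) = gen3 k"
proof -
  let ?c = "chi (nxt j) j"
  have c: "?c \<in> carrier A3" by (simp add: chi_props)
  show "beta j (gen3 k) = gen3 k" if "k \<noteq> nxt j" for k
    using A3_inv_apply(1)[OF c gen3_closed[of k]] that by (simp add: chi_props beta_def)
  have "?c (gen3 j \<otimes>\<^bsub>F3\<^esub> gen3 (nxt j) \<otimes>\<^bsub>F3\<^esub> inv\<^bsub>F3\<^esub> gen3 j) = gen3 (nxt j)"
    using c by (simp add: chi_props F.m_assoc)
  then show "beta j (gen3 (nxt j)) = gen3 j \<otimes>\<^bsub>F3\<^esub> gen3 (nxt j) \<otimes>\<^bsub>F3\<^esub> inv\<^bsub>F3\<^esub> gen3 j"
    using A3_inv_apply(1)[OF c, of "gen3 j \<otimes>\<^bsub>F3\<^esub> gen3 (nxt j) \<otimes>\<^bsub>F3\<^esub> inv\<^bsub>F3\<^esub> gen3 j"] by (simp add: beta_def)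
qed

text \<open>The identity expresses the remaining generators \<open>\<chi>\<^bsub>j+2,j\<^esub>\<close> by \<open>inner g\<^sub>j\<close> and \<open>beta j\<close>.\<close>

lemma inner_gen_eq: "inner (gen3 j) \<otimes>\<^bsub>A3\<^esub> chi (nxt (nxt j)) j = beta j"
proof (rule A3_eqI)
  show "(inner (gen3 j) \<otimes>\<^bsub>A3\<^esub> chi (nxt (nxt j)) j) (gen3 i) = beta j (gen3 i)" for i
    by (rule idx_cases3[of i j]) (simp_all add: chi_props beta_gen F.m_assoc)
qed (simp_all add: chi_props)

definition M3 :: "(nat fgroup \<Rightarrow> nat fgroup) monoid" where "M3 = mccool_group 3"

interpretation M: group M3 unfolding M3_def by (rule group_mccool_group)

lemma M3_alt: "M3 = A3\<lparr>carrier := generate A3 {chi i j | i j. i \<noteq> j}\<rparr>"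
proof -
  have "{basis_conj 3 i j | i j. i \<in> {1..3} \<and> j \<in> {1..3} \<and> i \<noteq> j} = {chi i j | i j. i \<noteq> j}"
    unfolding num_range[symmetric] chi_def by fastforce
  moreover have "carrier A3 \<inter> {chi i j | i j. i \<noteq> j} = {chi i j | i j. i \<noteq> j}"
    using chi_props(1) by auto
  ultimately show ?thesis
    unfolding M3_def mccool_group_def subgroup_generated_def A3_def F3_def by simp
qed

lemma M3_simps [simp]: "monoid.mult M3 = monoid.mult A3" "one M3 = one A3"
  by (simp_all add: M3_alt)

lemma M3_subgroup: "subgroup (carrier M3) A3"
  by (simp add: M3_alt) (rule A.generate_is_subgroup, use chi_props(1) in auto)

lemma M3_carrier [simp]: "m \<in> carrier M3 \<Longrightarrow> m \<in> carrier A3"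
  using subgroup.subset[OF M3_subgroup] by blast

lemma M3_inv [simp]: "m \<in> carrier M3 \<Longrightarrow> inv\<^bsub>M3\<^esub> m = inv\<^bsub>A3\<^esub> m"
  using A.m_inv_consistent[OF M3_subgroup, of m] by (simp add: M3_alt)

lemma M3_closed:
  "m \<in> carrier M3 \<Longrightarrow> m' \<in> carrier M3 \<Longrightarrow> m \<otimes>\<^bsub>A3\<^esub> m' \<in> carrier M3"
  "m \<in> carrier M3 \<Longrightarrow> inv\<^bsub>A3\<^esub> m \<in> carrier M3"
  using M3_subgroup by (auto simp: subgroup_def)

lemma chi_M3: "i \<noteq> j \<Longrightarrow> chi i j \<in> carrier M3"
  by (auto simp: M3_alt intro: generate.incl)

lemma beta_M3: "beta j \<in> carrier M3"
  unfolding beta_def by (intro M3_closed chi_M3) simp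

lemma inner_M3:
  assumes "g \<in> carrier F3"
  shows "inner g \<in> carrier M3"
proof -
  have "{g \<in> carrier F3. inner g \<in> carrier M3} = carrier F3"
  proof (rule F3_subgroup_eq)
    show "subgroup {g \<in> carrier F3. inner g \<in> carrier M3} F3"
      by (rule inner.subgroup_preimage[OF M3_subgroup])
    fix j
    have "inner (gen3 j) = beta j \<otimes>\<^bsub>A3\<^esub> inv\<^bsub>A3\<^esub> (chi (nxt (nxt j)) j)"
      by (simp add: chi_props A.m_assoc flip: inner_gen_eq)
    then show "gen3 j \<in> {g \<in> carrier F3. inner g \<in> carrier M3}"
      by (simp add: M3_closed beta_M3 chi_M3)
  qed
  then show ?thesis using assms by blast
qed

definition psi :: "nat fgroup \<Rightarrow> nat fgroup \<Rightarrow> nat fgroup" where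
  "psi = (SOME \<phi>. \<phi> \<in> hom F3 M3 \<and> (\<forall>i. \<phi> (gen3 i) = beta i))"

lemma psi: "psi \<in> hom F3 M3" "psi (gen3 i) = beta i"
  using someI_ex[OF F3_hom_exists[OF M.is_group, of beta, OF beta_M3]] unfolding psi_def by blast+

interpretation psi: group_hom F3 M3 psi
  by (intro group_hom.intro group_hom_axioms.intro F.is_group M.is_group psi)

lemma psi_simps [simp]:
  "b \<in> carrier F3 \<Longrightarrow> psi b \<in> carrier M3" "b \<in> carrier F3 \<Longrightarrow> psi b \<in> carrier A3"
  "b \<in> carrier F3 \<Longrightarrow> c \<in> carrier F3 \<Longrightarrow> psi (b \<otimes>\<^bsub>F3\<^esub> c) = psi b \<otimes>\<^bsub>A3\<^esub> psi c"
  "b \<in> carrier F3 \<Longrightarrow> psi (inv\<^bsub>F3\<^esub> b) = inv\<^bsub>A3\<^esub> (psi b)"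
  "psi \<one>\<^bsub>F3\<^esub> = \<one>\<^bsub>A3\<^esub>"
  using psi.hom_closed psi.hom_mult psi.hom_inv psi.hom_one by auto

lemma psi_hom_A3: "group_hom F3 A3 psi"
  by (simp add: group_hom_def group_hom_axioms_def F.is_group A.is_group hom_def)

lemma inner_psi_mult:
  assumes [simp]: "g \<in> carrier F3" "b \<in> carrier F3" "h \<in> carrier F3" "c \<in> carrier F3"
  shows "(inner g \<otimes>\<^bsub>A3\<^esub> psi b) \<otimes>\<^bsub>A3\<^esub> (inner h \<otimes>\<^bsub>A3\<^esub> psi c)
    = inner (g \<otimes>\<^bsub>F3\<^esub> psi b h) \<otimes>\<^bsub>A3\<^esub> psi (b \<otimes>\<^bsub>F3\<^esub> c)"
proof -
  have "(inner g \<otimes>\<^bsub>A3\<^esub> psi b) \<otimes>\<^bsub>A3\<^esub> (inner h \<otimes>\<^bsub>A3\<^esub> psi c)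
      = inner g \<otimes>\<^bsub>A3\<^esub> (psi b \<otimes>\<^bsub>A3\<^esub> inner h) \<otimes>\<^bsub>A3\<^esub> psi c"
    by (simp add: A.m_assoc)
  then show ?thesis by (simp add: aut_inner[of "psi b" h] inner_mult A.m_assoc)
qed

text \<open>Automorphisms normalize the inner ones by \<open>aut_inner\<close>, so the products \<open>inner g \<cdot> psi b\<close> form a subgroup.\<close>

lemma M3_decompose:
  assumes "m \<in> carrier M3"
  shows "\<exists>g\<in>carrier F3. \<exists>b\<in>carrier F3. m = inner g \<otimes>\<^bsub>A3\<^esub> psi b"
proof -
  define T where "T = {inner g \<otimes>\<^bsub>A3\<^esub> psi b | g b. g \<in> carrier F3 \<and> b \<in> carrier F3}"
  have TI: "inner g \<otimes>\<^bsub>A3\<^esub> psi b \<in> T" if "g \<in> carrier F3" "b \<in> carrier F3" for g b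
    using that by (auto simp: T_def)
  have "subgroup T A3"
  proof (rule A.subgroupI)
    show "T \<subseteq> carrier A3" by (auto simp: T_def)
    show "T \<noteq> {}" by (auto simp: T_def)
    fix x y assume "x \<in> T" "y \<in> T"
    then obtain g b h c where xy: "x = inner g \<otimes>\<^bsub>A3\<^esub> psi b" "y = inner h \<otimes>\<^bsub>A3\<^esub> psi c"
      and gbhc [simp]: "g \<in> carrier F3" "b \<in> carrier F3" "h \<in> carrier F3" "c \<in> carrier F3"
      by (auto simp: T_def)
    show "x \<otimes>\<^bsub>A3\<^esub> y \<in> T"
      unfolding xy inner_psi_mult[OF gbhc] by (rule TI) simp_all
    have "inv\<^bsub>A3\<^esub> x = psi (inv\<^bsub>F3\<^esub> b) \<otimes>\<^bsub>A3\<^esub> inner (inv\<^bsub>F3\<^esub> g)"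
      unfolding xy by (simp add: A.inv_mult_group)
    also have "\<dots> = inner (psi (inv\<^bsub>F3\<^esub> b) (inv\<^bsub>F3\<^esub> g)) \<otimes>\<^bsub>A3\<^esub> psi (inv\<^bsub>F3\<^esub> b)"
      by (rule aut_inner) (simp_all del: psi_simps(4))
    also have "\<dots> \<in> T" by (rule TI) (simp_all del: psi_simps(4))
    finally show "inv\<^bsub>A3\<^esub> x \<in> T" .
  qed
  moreover have "{chi i j | i j. i \<noteq> j} \<subseteq> T"
  proof clarify
    fix i j :: idx assume ij: "i \<noteq> j"
    show "chi i j \<in> T"
    proof (rule idx_cases3[of i j])
      assume "i = nxt j"
      then have "chi i j = inner \<one>\<^bsub>F3\<^esub> \<otimes>\<^bsub>A3\<^esub> psi (inv\<^bsub>F3\<^esub> gen3 j)"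
        by (simp add: psi beta_def chi_props inner.hom_one M3_closed chi_M3)
      then show ?thesis using TI[of "\<one>\<^bsub>F3\<^esub>" "inv\<^bsub>F3\<^esub> gen3 j"] by simp
    next
      assume "i = nxt (nxt j)"
      then have "chi i j = inner (inv\<^bsub>F3\<^esub> gen3 j) \<otimes>\<^bsub>A3\<^esub> psi (gen3 j)"
        using ij by (simp add: psi chi_props A.m_assoc[symmetric] flip: inner_gen_eq)
      then show ?thesis using TI[of "inv\<^bsub>F3\<^esub> gen3 j" "gen3 j"] by simp
    qed (use ij in simp)
  qed
  ultimately have "carrier M3 \<subseteq> T"
    using A.generate_subgroup_incl by (simp add: M3_alt)
  then show ?thesis using assms unfolding T_def by blast
qed

section \<open>Ping-pong on triples of transvections\<close>

text \<open>To see that \<open>psi b\<close> is inner only for \<open>b = 1\<close>, represent \<open>F\<^sub>3\<close> by transvections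
  \<open>u \<mapsto> u + om v u \<cdot> v\<close> of \<open>\<int>\<^sup>2\<close>, with one vector \<open>v\<^sub>i\<close> for each generator. An automorphism that conjugates generators
  changes the vectors, and the three numbers \<open>wedge v j = om v\<^bsub>j+1\<^esub> v\<^bsub>j+2\<^esub>\<close> depend up to sign only on its class modulo
  inner automorphisms. The \<open>k\<close>-th power of \<open>beta j\<close> replaces the \<open>j\<close>-th number \<open>t\<^sub>j\<close> by
  \<open>t\<^sub>j - k t\<^bsub>j+1\<^esub> t\<^bsub>j+2\<^esub>\<close> and fixes the other two. Starting from three numbers of absolute value \<open>3\<close>, these steps make the
  number changed last strictly the largest, as long as consecutive steps have different indices.\<close>

definition om :: "int \<times> int \<Rightarrow> int \<times> int \<Rightarrow> int" where
  "om v w = fst v * snd w - snd v * fst w"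

definition sc :: "int \<Rightarrow> int \<times> int \<Rightarrow> int \<times> int" where
  "sc c v = (c * fst v, c * snd v)"

lemma om_simps [simp]:
  "om (u + v) w = om u w + om v w" "om w (u + v) = om w u + om w v"
  "om (sc c v) w = c * om v w" "om w (sc c v) = c * om w v" "om v v = 0"
  by (simp_all add: om_def sc_def algebra_simps)

lemma om_anti: "om v w = - om w v"
  by (simp add: om_def)

definition Sp :: "(int \<times> int \<Rightarrow> int \<times> int) monoid" where
  "Sp = \<lparr>carrier = {f. bij f \<and> (\<forall>u w. om (f u) (f w) = om u w \<and> f (u + w) = f u + f w) \<and> (\<forall>c u. f (sc c u) = sc c (f u))},
    monoid.mult = (\<circ>), one = id\<rparr>"

lemma Sp_simps [simp]: "monoid.mult Sp = (\<circ>)" "one Sp = id"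
  by (simp_all add: Sp_def)

lemma Sp_carrier:
  "f \<in> carrier Sp \<longleftrightarrow> bij f \<and> (\<forall>u w. om (f u) (f w) = om u w \<and> f (u + w) = f u + f w) \<and> (\<forall>c u. f (sc c u) = sc c (f u))"
  by (simp add: Sp_def)

lemma group_Sp: "group Sp"
proof (rule groupI)
  fix f assume f: "f \<in> carrier Sp"
  then have b: "bij f" by (simp add: Sp_carrier)
  have r: "f (inv_into UNIV f u) = u" for u using b by (simp add: bij_is_surj surj_f_inv_f)
  have l: "inv_into UNIV f (f u) = u" for u using b by (simp add: bij_is_inj)
  have "inv_into UNIV f \<in> carrier Sp"
    unfolding Sp_carrier
  proof (intro conjI allI)
    show "bij (inv_into UNIV f)" using b by (rule bij_imp_bij_inv)
    fix u w c
    show "om (inv_into UNIV f u) (inv_into UNIV f w) = om u w" using f r by (metis Sp_carrier)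
    show "inv_into UNIV f (u + w) = inv_into UNIV f u + inv_into UNIV f w" using f r l by (metis Sp_carrier)
    show "inv_into UNIV f (sc c u) = sc c (inv_into UNIV f u)" using f r l by (metis Sp_carrier)
  qed
  then show "\<exists>y\<in>carrier Sp. y \<otimes>\<^bsub>Sp\<^esub> f = \<one>\<^bsub>Sp\<^esub>"
    using l by (intro bexI[of _ "inv_into UNIV f"]) (auto simp: fun_eq_iff)
next
  show "\<one>\<^bsub>Sp\<^esub> \<in> carrier Sp" by (simp add: Sp_carrier)
qed (simp_all add: Sp_carrier bij_comp comp_assoc del: split_paired_All)

interpretation Sp: group Sp by (rule group_Sp)

definition transv :: "int \<Rightarrow> int \<times> int \<Rightarrow> int \<times> int \<Rightarrow> int \<times> int" where
  "transv k v u = u + sc (k * om v u) v"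

lemma transv_mult: "transv j v \<circ> transv k v = transv (j + k) v"
  by (auto simp: transv_def fun_eq_iff sc_def om_def algebra_simps)

lemma transv_zero: "transv 0 v = id"
  by (auto simp: transv_def fun_eq_iff sc_def zero_prod_def)

lemma transv_closed [simp]: "transv k v \<in> carrier Sp"
proof -
  have "transv k v (transv (- k) v u) = u" "transv (- k) v (transv k v u) = u" for k u
    using fun_cong[OF transv_mult[of k v "- k"], of u] fun_cong[OF transv_mult[of "- k" v k], of u]
    by (simp_all add: transv_zero)
  then have "bij (transv k v)" by (intro bij_betw_byWitness[where f' = "transv (- k) v"]) auto
  then show ?thesis
    by (auto simp: Sp_carrier transv_def sc_def om_def algebra_simps)
qed

lemma transv_pow: "transv 1 v [^]\<^bsub>Sp\<^esub> (k :: int) = transv k v"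
proof (induction k rule: int_induct[where k = 0])
  case (step1 k)
  then show ?case using Sp.int_pow_mult[of "transv 1 v" k 1] by (simp add: transv_mult)
next
  case (step2 k)
  have "inv\<^bsub>Sp\<^esub> (transv 1 v) = transv (- 1) v"
    by (rule Sp.inv_equality) (simp_all add: transv_mult transv_zero)
  then show ?case using step2 Sp.int_pow_diff[of "transv 1 v" k 1] by (simp add: transv_mult)
qed (simp add: transv_zero)

lemma transv_conj:
  assumes "f \<in> carrier Sp"
  shows "f \<circ> transv k v \<circ> inv\<^bsub>Sp\<^esub> f = transv k (f v)"
proof -
  have "f \<circ> transv k v = transv k (f v) \<circ> f"
    using assms unfolding Sp_carrier by (intro ext) (simp add: transv_def del: split_paired_All)
  moreover have "f \<circ> inv\<^bsub>Sp\<^esub> f = id" using Sp.r_inv[OF assms] by simp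
  ultimately show ?thesis by (metis comp_assoc comp_id)
qed

text \<open>A transvection determines its vector up to sign.\<close>

lemma transv_eq_om: "transv 1 v = transv 1 v' \<Longrightarrow> (om v a)\<^sup>2 = (om v' a)\<^sup>2"
proof -
  assume "transv 1 v = transv 1 v'"
  then have "transv 1 v a = transv 1 v' a" by simp
  then have "om (transv 1 v a) a = om (transv 1 v' a) a" by simp
  then show ?thesis by (simp add: transv_def power2_eq_square)
qed

text \<open>Vectors whose pairwise values under \<open>om\<close> are \<open>3\<close> or \<open>-3\<close>.\<close>

definition base_vec :: "idx \<Rightarrow> int \<times> int" where
  "base_vec i = (case i of I1 \<Rightarrow> (1, 0) | I2 \<Rightarrow> (0, 3) | I3 \<Rightarrow> (1, 3))"

lemma base_vec_om: "\<bar>om (base_vec (nxt j)) (base_vec (nxt (nxt j)))\<bar> = 3"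
  by (cases j) (simp_all add: base_vec_def om_def)

definition rho :: "nat fgroup \<Rightarrow> int \<times> int \<Rightarrow> int \<times> int" where
  "rho = (SOME \<phi>. \<phi> \<in> hom F3 Sp \<and> (\<forall>i. \<phi> (gen3 i) = transv 1 (base_vec i)))"

lemma rho: "rho \<in> hom F3 Sp" "rho (gen3 i) = transv 1 (base_vec i)"
  using someI_ex[OF F3_hom_exists[OF group_Sp, of "\<lambda>i. transv 1 (base_vec i)", OF transv_closed]]
  unfolding rho_def by blast+

interpretation rho: group_hom F3 Sp rho
  by (intro group_hom.intro group_hom_axioms.intro F.is_group group_Sp rho)

definition frame :: "(nat fgroup \<Rightarrow> nat fgroup) \<Rightarrow> (idx \<Rightarrow> int \<times> int) \<Rightarrow> bool" where
  "frame \<phi> v \<longleftrightarrow> (\<forall>i. rho (\<phi> (gen3 i)) = transv 1 (v i))"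

definition wedge :: "(idx \<Rightarrow> int \<times> int) \<Rightarrow> idx \<Rightarrow> int" where
  "wedge v j = om (v (nxt j)) (v (nxt (nxt j)))"

lemma beta_pow:
  "(beta j [^]\<^bsub>A3\<^esub> (k :: int)) (gen3 (nxt j))
    = gen3 j [^]\<^bsub>F3\<^esub> k \<otimes>\<^bsub>F3\<^esub> gen3 (nxt j) \<otimes>\<^bsub>F3\<^esub> inv\<^bsub>F3\<^esub> (gen3 j [^]\<^bsub>F3\<^esub> k)
  \<and> (\<forall>i. i \<noteq> nxt j \<longrightarrow> (beta j [^]\<^bsub>A3\<^esub> k) (gen3 i) = gen3 i)"
proof (induction k rule: int_induct[where k = 0])
  case base
  then show ?case by simp
next
  case (step1 k)
  let ?B = "beta j [^]\<^bsub>A3\<^esub> k"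
  have B: "?B \<in> carrier A3" by simp
  have "(beta j [^]\<^bsub>A3\<^esub> (k + 1)) = ?B \<otimes>\<^bsub>A3\<^esub> beta j" by (simp add: A.int_pow_mult)
  moreover have "gen3 j [^]\<^bsub>F3\<^esub> (k + 1) = gen3 j \<otimes>\<^bsub>F3\<^esub> gen3 j [^]\<^bsub>F3\<^esub> k"
    using F.int_pow_mult[of "gen3 j" 1 k] by (simp add: add.commute)
  ultimately show ?case
    using step1(2) B by (simp add: beta_gen F.inv_mult_group F.m_assoc)
next
  case (step2 k)
  let ?B = "beta j [^]\<^bsub>A3\<^esub> k"
  have B: "?B \<in> carrier A3" by simp
  have "(beta j [^]\<^bsub>A3\<^esub> (k - 1)) = ?B \<otimes>\<^bsub>A3\<^esub> chi (nxt j) j"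
    by (simp add: A.int_pow_diff beta_def chi_props)
  moreover have "gen3 j [^]\<^bsub>F3\<^esub> (k - 1) = inv\<^bsub>F3\<^esub> gen3 j \<otimes>\<^bsub>F3\<^esub> gen3 j [^]\<^bsub>F3\<^esub> k"
    using F.int_pow_mult[of "gen3 j" "-1" k] by (simp add: F.int_pow_neg)
  ultimately show ?case
    using step2(2) B by (simp add: chi_props F.inv_mult_group F.m_assoc)
qed

lemma frame_step:
  fixes k :: int and i :: idx
  assumes \<phi>: "\<phi> \<in> carrier A3" and fr: "frame \<phi> v"
  defines "v' \<equiv> v(nxt i := transv k (v i) (v (nxt i)))"
  shows "frame (\<phi> \<otimes>\<^bsub>A3\<^esub> beta i [^]\<^bsub>A3\<^esub> (k :: int)) v'"
    and "wedge v' i = wedge v i - k * wedge v (nxt i) * wedge v (nxt (nxt i))"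
    and "j \<noteq> i \<Longrightarrow> wedge v' j = wedge v j"
proof -
  have B: "beta i [^]\<^bsub>A3\<^esub> k \<in> carrier A3" by simp
  have \<rho>: "rho (\<phi> (gen3 j)) = transv 1 (v j)" for j using fr by (simp add: frame_def)
  have "rho (\<phi> (gen3 i [^]\<^bsub>F3\<^esub> k)) = transv k (v i)"
    using \<phi> \<rho> rho.hom_int_pow[of "\<phi> (gen3 i)" k] by (simp add: transv_pow)
  then have "rho (\<phi> (gen3 i [^]\<^bsub>F3\<^esub> k \<otimes>\<^bsub>F3\<^esub> gen3 (nxt i) \<otimes>\<^bsub>F3\<^esub> inv\<^bsub>F3\<^esub> (gen3 i [^]\<^bsub>F3\<^esub> k)))
      = transv k (v i) \<circ> transv 1 (v (nxt i)) \<circ> inv\<^bsub>Sp\<^esub> (transv k (v i))"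
    using \<phi> \<rho> by (simp del: A3_simps(5))
  then show "frame (\<phi> \<otimes>\<^bsub>A3\<^esub> beta i [^]\<^bsub>A3\<^esub> k) v'"
    using \<phi> B beta_pow[of i k] \<rho> by (auto simp: frame_def v'_def transv_conj)
  show "wedge v' i = wedge v i - k * wedge v (nxt i) * wedge v (nxt (nxt i))"
    using om_anti[of "v i" "v (nxt (nxt i))"] by (simp add: wedge_def v'_def transv_def)
  show "wedge v' j = wedge v j" if "j \<noteq> i"
    by (rule idx_cases3[of j i]) (use that in \<open>auto simp: wedge_def v'_def transv_def\<close>)
qed

lemma ping_pong_growth:
  fixes x a b k :: int
  assumes "\<bar>a\<bar> \<ge> 3" "\<bar>b\<bar> \<ge> 3" "k \<noteq> 0" "\<bar>x\<bar> \<le> \<bar>a\<bar> \<or> \<bar>x\<bar> \<le> \<bar>b\<bar>"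
  shows "\<bar>x - k * a * b\<bar> > \<bar>a\<bar>" "\<bar>x - k * a * b\<bar> > \<bar>b\<bar>"
proof -
  have "1 * (\<bar>a\<bar> * \<bar>b\<bar>) \<le> \<bar>k\<bar> * (\<bar>a\<bar> * \<bar>b\<bar>)" using assms(3) by (intro mult_right_mono) auto
  then have 1: "\<bar>x - k * a * b\<bar> \<ge> \<bar>a\<bar> * \<bar>b\<bar> - \<bar>x\<bar>" by (simp add: abs_mult mult.assoc)
  have 2: "3 * \<bar>b\<bar> \<le> \<bar>a\<bar> * \<bar>b\<bar>" "\<bar>a\<bar> * 3 \<le> \<bar>a\<bar> * \<bar>b\<bar>"
    using assms by (intro mult_right_mono mult_left_mono; simp)+
  have 3: "0 \<le> (\<bar>a\<bar> - 3) * (\<bar>b\<bar> - 3)" using assms by (intro mult_nonneg_nonneg) auto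
  have 4: "(\<bar>a\<bar> - 3) * (\<bar>b\<bar> - 3) = \<bar>a\<bar> * \<bar>b\<bar> - 3 * \<bar>a\<bar> - 3 * \<bar>b\<bar> + 9" by (simp add: algebra_simps)
  from assms(4) have "\<bar>a\<bar> < \<bar>x - k * a * b\<bar> \<and> \<bar>b\<bar> < \<bar>x - k * a * b\<bar>"
    using 1 2 3 assms(1,2) unfolding 4 by linarith
  then show "\<bar>x - k * a * b\<bar> > \<bar>a\<bar>" "\<bar>x - k * a * b\<bar> > \<bar>b\<bar>" by auto
qed

text \<open>Taking the inverse turns the first syllable into the last step, so that the induction peels off the head of the
  list.\<close>

lemma ping_pong:
  assumes "syl_normal s"
  shows "\<exists>v. frame (inv\<^bsub>A3\<^esub> (psi (syl_eval s))) v \<and> (\<forall>j. \<bar>wedge v j\<bar> \<ge> 3)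
    \<and> (if s = [] then \<forall>j. \<bar>wedge v j\<bar> = 3 else \<forall>j. j \<noteq> fst (hd s) \<longrightarrow> \<bar>wedge v j\<bar> < \<bar>wedge v (fst (hd s))\<bar>)"
  using assms
proof (induction s)
  case Nil
  show ?case
    by (rule exI[of _ base_vec]) (simp add: frame_def rho wedge_def base_vec_om)
next
  case (Cons p s)
  obtain i k where p: "p = (i, k)" by (cases p)
  have n: "syl_normal s" "k \<noteq> 0" "s \<noteq> [] \<Longrightarrow> fst (hd s) \<noteq> i" using Cons.prems by (auto simp: syl_normal_Cons p)
  let ?\<phi> = "inv\<^bsub>A3\<^esub> (psi (syl_eval s))"
  obtain v where v: "frame ?\<phi> v" "\<And>j. \<bar>wedge v j\<bar> \<ge> 3"
    "if s = [] then \<forall>j. \<bar>wedge v j\<bar> = 3 else \<forall>j. j \<noteq> fst (hd s) \<longrightarrow> \<bar>wedge v j\<bar> < \<bar>wedge v (fst (hd s))\<bar>"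
    using Cons.IH[OF n(1)] by blast
  define v' where "v' = v(nxt i := transv (- k) (v i) (v (nxt i)))"
  have \<phi>: "?\<phi> \<in> carrier A3" by simp
  note st = frame_step[OF \<phi> v(1), where i = i and k = "- k", folded v'_def]
  have "psi (syl_eval (p # s)) = beta i [^]\<^bsub>A3\<^esub> k \<otimes>\<^bsub>A3\<^esub> psi (syl_eval s)"
    using group_hom.hom_int_pow[OF psi_hom_A3, of "gen3 i" k] by (simp add: p psi)
  then have eq: "inv\<^bsub>A3\<^esub> (psi (syl_eval (p # s))) = ?\<phi> \<otimes>\<^bsub>A3\<^esub> beta i [^]\<^bsub>A3\<^esub> (- k)"
    by (simp add: A.inv_mult_group A.int_pow_neg)
  \<comment> \<open>The index \<open>i\<close> differs from that of the previous step, whose number is the largest.\<close>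
  have "\<exists>j. j \<noteq> i \<and> \<bar>wedge v i\<bar> \<le> \<bar>wedge v j\<bar>"
  proof (cases "s = []")
    case True
    then show ?thesis using v(3) by (intro exI[of _ "nxt i"]) simp
  next
    case False
    then show ?thesis using v(3) n(3) by (intro exI[of _ "fst (hd s)"]) (auto intro: less_imp_le)
  qed
  then have "\<bar>wedge v i\<bar> \<le> \<bar>wedge v (nxt i)\<bar> \<or> \<bar>wedge v i\<bar> \<le> \<bar>wedge v (nxt (nxt i))\<bar>"
    by (metis idx_cases3)
  from ping_pong_growth[OF v(2) v(2) _ this, of "- k"] n(2)
  have big: "\<bar>wedge v' i\<bar> > \<bar>wedge v (nxt i)\<bar>" "\<bar>wedge v' i\<bar> > \<bar>wedge v (nxt (nxt i))\<bar>"
    unfolding st(2) by simp_all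
  have lt: "\<bar>wedge v' j\<bar> < \<bar>wedge v' i\<bar>" if "j \<noteq> i" for j
    by (rule idx_cases3[of j i]) (use that st(3) big in auto)
  moreover have "\<bar>wedge v' j\<bar> \<ge> 3" for j
    using st(3)[of j] v(2)[of j] big(1) v(2)[of "nxt i"] by (cases "j = i") auto
  ultimately show ?case
    using st(1) unfolding eq by (intro exI[of _ v']) (simp add: p)
qed

text \<open>An inner automorphism moves the three vectors by one and the same symplectic map, up to signs, hence leaves the
  absolute values at \<open>3\<close>. After a nonempty normal form they are not all equal.\<close>

lemma psi_inner_trivial:
  assumes "b \<in> carrier F3" "g \<in> carrier F3" "psi b = inner g"
  shows "b = \<one>\<^bsub>F3\<^esub>"
proof -
  obtain s where s: "syl_normal s" "b = syl_eval s" using syl_exists[OF assms(1)] by blast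
  obtain v where v: "frame (inv\<^bsub>A3\<^esub> (psi b)) v" "\<And>j. \<bar>wedge v j\<bar> \<ge> 3"
    "s \<noteq> [] \<Longrightarrow> \<forall>j. j \<noteq> fst (hd s) \<longrightarrow> \<bar>wedge v j\<bar> < \<bar>wedge v (fst (hd s))\<bar>"
    using ping_pong[OF s(1)] s(2) by (auto split: if_splits)
  let ?h = "inv\<^bsub>F3\<^esub> g"
  define f where "f = rho ?h"
  have f: "f \<in> carrier Sp" using assms by (simp add: f_def)
  have "inv\<^bsub>A3\<^esub> (psi b) = inner ?h" using assms by simp
  then have "transv 1 (v i) = rho (?h \<otimes>\<^bsub>F3\<^esub> gen3 i \<otimes>\<^bsub>F3\<^esub> inv\<^bsub>F3\<^esub> ?h)" for i
    using v(1) by (simp add: frame_def del: F.inv_inv)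
  note fr = this
  have t: "transv 1 (v i) = transv 1 (f (base_vec i))" for i
  proof -
    have "rho (?h \<otimes>\<^bsub>F3\<^esub> gen3 i \<otimes>\<^bsub>F3\<^esub> inv\<^bsub>F3\<^esub> ?h) = f \<circ> transv 1 (base_vec i) \<circ> inv\<^bsub>Sp\<^esub> f"
      using assms(2) unfolding f_def
      by (simp only: rho.hom_mult rho.hom_inv rho Sp_simps F.m_closed F.inv_closed gen3_closed)
    then show ?thesis using fr[of i] transv_conj[OF f] by simp
  qed
  have sq: "(wedge v j)\<^sup>2 = 9" for j
  proof -
    have "(wedge v j)\<^sup>2 = (om (f (base_vec (nxt j))) (v (nxt (nxt j))))\<^sup>2"
      unfolding wedge_def by (rule transv_eq_om[OF t])
    also have "\<dots> = (om (v (nxt (nxt j))) (f (base_vec (nxt j))))\<^sup>2"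
      using om_anti by (metis power2_minus)
    also have "\<dots> = (om (f (base_vec (nxt (nxt j)))) (f (base_vec (nxt j))))\<^sup>2"
      by (rule transv_eq_om[OF t])
    also have "\<dots> = (om (base_vec (nxt j)) (base_vec (nxt (nxt j))))\<^sup>2"
      using f om_anti by (metis Sp_carrier power2_minus)
    also have "\<dots> = \<bar>om (base_vec (nxt j)) (base_vec (nxt (nxt j)))\<bar>\<^sup>2" by simp
    also have "\<dots> = 9" unfolding base_vec_om by simp
    finally show ?thesis .
  qed
  have "s = []"
  proof (rule ccontr)
    assume "s \<noteq> []"
    then have "\<bar>wedge v (nxt (fst (hd s)))\<bar> < \<bar>wedge v (fst (hd s))\<bar>" using v(3) by simp
    moreover have "(wedge v (nxt (fst (hd s))))\<^sup>2 = (wedge v (fst (hd s)))\<^sup>2" by (simp only: sq)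
    ultimately show False by (simp add: power2_eq_iff) (auto simp: abs_if split: if_splits)
  qed
  then show ?thesis using s by simp
qed

lemma M3_decompose_unique:
  assumes [simp]: "g \<in> carrier F3" "b \<in> carrier F3" "h \<in> carrier F3" "c \<in> carrier F3"
    and eq: "inner g \<otimes>\<^bsub>A3\<^esub> psi b = inner h \<otimes>\<^bsub>A3\<^esub> psi c"
  shows "b = c"
proof -
  have "inv\<^bsub>A3\<^esub> (inner g) \<otimes>\<^bsub>A3\<^esub> (inner g \<otimes>\<^bsub>A3\<^esub> psi b) \<otimes>\<^bsub>A3\<^esub> inv\<^bsub>A3\<^esub> (psi c)
      = inv\<^bsub>A3\<^esub> (inner g) \<otimes>\<^bsub>A3\<^esub> (inner h \<otimes>\<^bsub>A3\<^esub> psi c) \<otimes>\<^bsub>A3\<^esub> inv\<^bsub>A3\<^esub> (psi c)"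
    by (simp only: eq)
  then have "psi (b \<otimes>\<^bsub>F3\<^esub> inv\<^bsub>F3\<^esub> c) = inner (inv\<^bsub>F3\<^esub> g \<otimes>\<^bsub>F3\<^esub> h)"
    by (simp add: inner_mult A.m_assoc)
  then have "b \<otimes>\<^bsub>F3\<^esub> inv\<^bsub>F3\<^esub> c = \<one>\<^bsub>F3\<^esub>"
    by (intro psi_inner_trivial[of _ "inv\<^bsub>F3\<^esub> g \<otimes>\<^bsub>F3\<^esub> h"]) simp_all
  then show ?thesis by (metis F.inv_closed F.inv_equality F.inv_inv assms(2,4))
qed

text \<open>The projection of the semidirect product onto the free group generated by the \<open>beta j\<close>, which is well defined by
  \<open>M3_decompose_unique\<close>.\<close>

definition outer_part :: "(nat fgroup \<Rightarrow> nat fgroup) \<Rightarrow> nat fgroup" where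
  "outer_part m = (THE b. b \<in> carrier F3 \<and> (\<exists>g\<in>carrier F3. m = inner g \<otimes>\<^bsub>A3\<^esub> psi b))"

lemma outer_part_eq [simp]:
  "g \<in> carrier F3 \<Longrightarrow> b \<in> carrier F3 \<Longrightarrow> outer_part (inner g \<otimes>\<^bsub>A3\<^esub> psi b) = b"
  unfolding outer_part_def by (rule the_equality) (use M3_decompose_unique in blast)+

lemma outer_part_hom: "outer_part \<in> hom M3 F3"
proof (rule homI)
  fix m assume "m \<in> carrier M3"
  then show "outer_part m \<in> carrier F3" using M3_decompose by force
next
  fix m n assume "m \<in> carrier M3" "n \<in> carrier M3"
  then obtain g b h c where gbhc: "g \<in> carrier F3" "b \<in> carrier F3" "h \<in> carrier F3" "c \<in> carrier F3"
    and mn: "m = inner g \<otimes>\<^bsub>A3\<^esub> psi b" "n = inner h \<otimes>\<^bsub>A3\<^esub> psi c" by (meson M3_decompose)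
  have "outer_part (m \<otimes>\<^bsub>A3\<^esub> n) = b \<otimes>\<^bsub>F3\<^esub> c"
    unfolding mn inner_psi_mult[OF gbhc] by (rule outer_part_eq) (simp_all add: gbhc)
  moreover have "outer_part m = b" "outer_part n = c" unfolding mn by (simp_all add: gbhc)
  ultimately show "outer_part (m \<otimes>\<^bsub>M3\<^esub> n) = outer_part m \<otimes>\<^bsub>F3\<^esub> outer_part n"
    by (simp only: M3_simps)
qed

lemma outer_part_inner: "g \<in> carrier F3 \<Longrightarrow> outer_part (inner g) = \<one>\<^bsub>F3\<^esub>"
  using outer_part_eq[of g "\<one>\<^bsub>F3\<^esub>"] by simp

lemma outer_part_psi: "b \<in> carrier F3 \<Longrightarrow> outer_part (psi b) = b"
  using outer_part_eq[of "\<one>\<^bsub>F3\<^esub>" b] by (simp add: inner.hom_one)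

interpretation inM: group_hom F3 M3 inner
  by (simp add: group_hom_def group_hom_axioms_def F.is_group M.is_group hom_def inner_M3 inner_mult)

lemma M3_generate:
  assumes "subgroup N M3" "\<And>j. inner (gen3 j) \<in> N" "\<And>j. beta j \<in> N"
  shows "N = carrier M3"
proof -
  interpret N: subgroup N M3 by fact
  have "{g \<in> carrier F3. inner g \<in> N} = carrier F3"
    by (rule F3_subgroup_eq[OF inM.subgroup_preimage[OF assms(1)]]) (simp add: assms)
  moreover have "{g \<in> carrier F3. psi g \<in> N} = carrier F3"
    by (rule F3_subgroup_eq[OF psi.subgroup_preimage[OF assms(1)]]) (simp add: assms psi)
  ultimately have in_N: "inner g \<in> N" "psi g \<in> N" if "g \<in> carrier F3" for g
    using that by blast+
  show ?thesis
  proof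
    show "carrier M3 \<subseteq> N"
    proof
      fix m assume "m \<in> carrier M3"
      then obtain g b where "g \<in> carrier F3" "b \<in> carrier F3" "m = inner g \<otimes>\<^bsub>A3\<^esub> psi b"
        using M3_decompose by blast
      then show "m \<in> N" using N.m_closed[OF in_N(1) in_N(2)] by simp
    qed
  qed (rule N.subset)
qed

section \<open>The Johnson filtration\<close>

text \<open>The automorphisms that act trivially on each \<open>\<gamma>\<^sub>k / \<gamma>\<^bsub>k+n\<^esub>\<close> of \<open>F\<^sub>3\<close>.\<close>

definition johnson :: "nat \<Rightarrow> (nat fgroup \<Rightarrow> nat fgroup) set" where
  "johnson n = {m \<in> carrier M3. \<forall>k\<ge>1. \<forall>x\<in>lower_central F3 k. m x \<otimes>\<^bsub>F3\<^esub> inv\<^bsub>F3\<^esub> x \<in> lower_central F3 (k + n)}"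

lemma aut_lower_central:
  assumes "\<phi> \<in> carrier A3" "k \<ge> 1" "x \<in> lower_central F3 k"
  shows "\<phi> x \<in> lower_central F3 k"
  using group_hom.hom_lower_central[OF A3_group_hom] assms by blast

lemma johnson_subgroup: "subgroup (johnson n) M3"
proof (rule M.subgroupI)
  show "johnson n \<subseteq> carrier M3" by (auto simp: johnson_def)
  have "\<one>\<^bsub>M3\<^esub> \<in> johnson n"
    using M.one_closed F.lower_central_carrier F.lower_central_closed(3) by (auto simp: johnson_def)
  then show "johnson n \<noteq> {}" by blast
next
  fix m assume m: "m \<in> johnson n"
  then have mc: "m \<in> carrier M3" "m \<in> carrier A3" by (auto simp: johnson_def)
  have "(inv\<^bsub>A3\<^esub> m) x \<otimes>\<^bsub>F3\<^esub> inv\<^bsub>F3\<^esub> x \<in> lower_central F3 (k + n)"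
    if x: "k \<ge> 1" "x \<in> lower_central F3 k" for k x
  proof -
    let ?y = "(inv\<^bsub>A3\<^esub> m) x"
    have xc: "x \<in> carrier F3" using x F.lower_central_carrier by blast
    have y: "?y \<in> lower_central F3 k" using aut_lower_central x mc by simp
    have yc: "?y \<in> carrier F3" using y F.lower_central_carrier by blast
    have "m ?y \<otimes>\<^bsub>F3\<^esub> inv\<^bsub>F3\<^esub> ?y \<in> lower_central F3 (k + n)" using m x y by (simp add: johnson_def)
    then have "inv\<^bsub>F3\<^esub> (m ?y \<otimes>\<^bsub>F3\<^esub> inv\<^bsub>F3\<^esub> ?y) \<in> lower_central F3 (k + n)" by (rule F.lower_central_closed)
    then show ?thesis using mc xc yc by (simp add: F.inv_mult_group del: A3_simps)
  qed
  then show "inv\<^bsub>M3\<^esub> m \<in> johnson n" using mc M3_closed by (simp add: johnson_def)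
next
  fix m m' assume m: "m \<in> johnson n" "m' \<in> johnson n"
  then have mc: "m \<in> carrier M3" "m' \<in> carrier M3" by (auto simp: johnson_def)
  have "(m \<otimes>\<^bsub>A3\<^esub> m') x \<otimes>\<^bsub>F3\<^esub> inv\<^bsub>F3\<^esub> x \<in> lower_central F3 (k + n)"
    if x: "k \<ge> 1" "x \<in> lower_central F3 k" for k x
  proof -
    have xc: "x \<in> carrier F3" using x F.lower_central_carrier by blast
    have m'x: "m' x \<in> lower_central F3 k" using aut_lower_central x mc by simp
    have "(m (m' x) \<otimes>\<^bsub>F3\<^esub> inv\<^bsub>F3\<^esub> (m' x)) \<otimes>\<^bsub>F3\<^esub> (m' x \<otimes>\<^bsub>F3\<^esub> inv\<^bsub>F3\<^esub> x) \<in> lower_central F3 (k + n)"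
      by (rule F.lower_central_closed(1)) (use m x m'x in \<open>auto simp: johnson_def\<close>)
    then show ?thesis using mc xc by (simp add: F.m_assoc)
  qed
  then show "m \<otimes>\<^bsub>M3\<^esub> m' \<in> johnson n" using mc M3_closed by (simp add: johnson_def)
qed

lemma johnson_one: "carrier M3 = johnson 1"
proof (rule M3_generate[OF johnson_subgroup, symmetric])
  have IA: "m \<in> johnson 1"
    if m: "m \<in> carrier M3" "\<And>i. m (gen3 i) \<otimes>\<^bsub>F3\<^esub> inv\<^bsub>F3\<^esub> gen3 i \<in> lower_central F3 2" for m
  proof -
    have "m x \<otimes>\<^bsub>F3\<^esub> inv\<^bsub>F3\<^esub> x \<in> lower_central F3 (Suc k)" if "k \<ge> 1" "x \<in> lower_central F3 k" for k x
      using A3_hom[OF M3_carrier[OF m(1)]] carrier_F3 _ _ that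
      by (rule F.IA_displacement) (use m in auto)
    then show ?thesis using m by (simp add: johnson_def)
  qed
  have comm: "x \<otimes>\<^bsub>F3\<^esub> y \<otimes>\<^bsub>F3\<^esub> inv\<^bsub>F3\<^esub> x \<otimes>\<^bsub>F3\<^esub> inv\<^bsub>F3\<^esub> y \<in> lower_central F3 2"
    if "x \<in> carrier F3" "y \<in> carrier F3" for x y
    using F.lower_central_commutator_carrier[of 1 "inv\<^bsub>F3\<^esub> x" "inv\<^bsub>F3\<^esub> y", unfolded F.lower_central_one] that
    by (simp add: commutator_def numeral_2_eq_2 del: lower_central.simps)
  fix j
  show "inner (gen3 j) \<in> johnson 1"
    by (rule IA) (simp_all add: inner_M3 comm)
  show "beta j \<in> johnson 1"
  proof (rule IA[OF beta_M3])
    fix i show "beta j (gen3 i) \<otimes>\<^bsub>F3\<^esub> inv\<^bsub>F3\<^esub> gen3 i \<in> lower_central F3 2"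
      by (cases "i = nxt j") (simp_all add: beta_gen comm F.lower_central_closed(3))
  qed
qed

text \<open>With \<open>\<phi> x = a x\<close> and \<open>\<psi> x = b x\<close>, the elements \<open>\<phi> (\<psi> x)\<close> and \<open>\<psi> (\<phi> x)\<close> agree with \<open>b a x\<close> and \<open>a b x\<close>
  modulo \<open>\<gamma>\<^bsub>k+n+1\<^esub>\<close>, and the commutator of \<open>a\<close> and \<open>b\<close> lies even deeper.\<close>

lemma johnson_commutator:
  assumes \<phi>: "\<phi> \<in> johnson n" and \<psi>: "\<psi> \<in> carrier M3"
  shows "commutator M3 \<phi> \<psi> \<in> johnson (Suc n)"
proof -
  note cl = F.lower_central_closed
  have c: "\<phi> \<in> carrier M3" "\<psi> \<in> carrier M3" using assms by (auto simp: johnson_def)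
  then have [simp]: "\<phi> \<in> carrier A3" "\<psi> \<in> carrier A3" by auto
  have \<psi>1: "\<psi> \<in> johnson 1" using \<psi> by (simp add: johnson_one)
  have "commutator M3 \<phi> \<psi> x \<otimes>\<^bsub>F3\<^esub> inv\<^bsub>F3\<^esub> x \<in> lower_central F3 (k + Suc n)"
    if x: "k \<ge> 1" "x \<in> lower_central F3 k" for k x
  proof -
    have [simp]: "x \<in> carrier F3" using x F.lower_central_carrier by blast
    define a b where "a = \<phi> x \<otimes>\<^bsub>F3\<^esub> inv\<^bsub>F3\<^esub> x" and "b = \<psi> x \<otimes>\<^bsub>F3\<^esub> inv\<^bsub>F3\<^esub> x"
    have a: "a \<in> lower_central F3 (k + n)" using \<phi> x by (simp add: johnson_def a_def)
    have b: "b \<in> lower_central F3 (k + 1)" using \<psi>1 x unfolding johnson_def b_def by blast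
    have [simp]: "a \<in> carrier F3" "b \<in> carrier F3" using a b F.lower_central_carrier by blast+
    have \<phi>x: "\<phi> x = a \<otimes>\<^bsub>F3\<^esub> x" and \<psi>x: "\<psi> x = b \<otimes>\<^bsub>F3\<^esub> x" by (simp_all add: a_def b_def F.m_assoc)
    have b': "\<phi> b \<otimes>\<^bsub>F3\<^esub> inv\<^bsub>F3\<^esub> b \<in> lower_central F3 (k + Suc n)"
      using \<phi> b x unfolding johnson_def by (auto dest: spec[of _ "k + 1"] simp del: lower_central.simps)
    have a': "\<psi> a \<otimes>\<^bsub>F3\<^esub> inv\<^bsub>F3\<^esub> a \<in> lower_central F3 (k + Suc n)"
      using \<psi>1 a x unfolding johnson_def by (auto dest: spec[of _ "k + n"] simp del: lower_central.simps)
    have ab: "commutator F3 (inv\<^bsub>F3\<^esub> b) (inv\<^bsub>F3\<^esub> a) \<in> lower_central F3 (k + Suc n)"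
    proof -
      have "commutator F3 (inv\<^bsub>F3\<^esub> b) (inv\<^bsub>F3\<^esub> a) \<in> lower_central F3 ((k + 1) + (k + n))"
        using x by (intro F.lower_central_commutator cl a b) auto
      then show ?thesis using F.lower_central_antimono[of "k + Suc n" "(k + 1) + (k + n)"] by auto
    qed
    \<comment> \<open>The quotient of \<open>\<phi> (\<psi> x)\<close> by \<open>\<psi> (\<phi> x)\<close>.\<close>
    let ?z = "(\<phi> b \<otimes>\<^bsub>F3\<^esub> inv\<^bsub>F3\<^esub> b) \<otimes>\<^bsub>F3\<^esub> commutator F3 (inv\<^bsub>F3\<^esub> b) (inv\<^bsub>F3\<^esub> a) \<otimes>\<^bsub>F3\<^esub> inv\<^bsub>F3\<^esub> (\<psi> a \<otimes>\<^bsub>F3\<^esub> inv\<^bsub>F3\<^esub> a)"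
    have z: "?z \<in> lower_central F3 (k + Suc n)" by (rule cl(1)[OF cl(1)[OF b' ab] cl(2)[OF a']])
    have zc: "?z \<in> carrier F3" by simp
    have "\<phi> (\<psi> x) = ?z \<otimes>\<^bsub>F3\<^esub> \<psi> (\<phi> x)"
      by (simp add: \<phi>x \<psi>x commutator_def F.inv_mult_group F.m_assoc)
    moreover have "commutator M3 \<phi> \<psi> = inv\<^bsub>A3\<^esub> (\<psi> \<otimes>\<^bsub>A3\<^esub> \<phi>) \<otimes>\<^bsub>A3\<^esub> (\<phi> \<otimes>\<^bsub>A3\<^esub> \<psi>)"
      using c by (simp add: commutator_def A.inv_mult_group A.m_assoc)
    ultimately have "commutator M3 \<phi> \<psi> x = (inv\<^bsub>A3\<^esub> (\<psi> \<otimes>\<^bsub>A3\<^esub> \<phi>)) (?z \<otimes>\<^bsub>F3\<^esub> (\<psi> \<otimes>\<^bsub>A3\<^esub> \<phi>) x)"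
      by simp
    also have "\<dots> = (inv\<^bsub>A3\<^esub> (\<psi> \<otimes>\<^bsub>A3\<^esub> \<phi>)) ?z \<otimes>\<^bsub>F3\<^esub> x"
      using zc A3_simps(2)[of "inv\<^bsub>A3\<^esub> (\<psi> \<otimes>\<^bsub>A3\<^esub> \<phi>)" ?z "(\<psi> \<otimes>\<^bsub>A3\<^esub> \<phi>) x"] A3_inv_apply(1)[of "\<psi> \<otimes>\<^bsub>A3\<^esub> \<phi>" x]
      by (simp del: A3_apply A3_inv_apply A3_simps(2))
    finally have "commutator M3 \<phi> \<psi> x \<otimes>\<^bsub>F3\<^esub> inv\<^bsub>F3\<^esub> x = (inv\<^bsub>A3\<^esub> (\<psi> \<otimes>\<^bsub>A3\<^esub> \<phi>)) ?z"
      using zc A3_simps(1)[of "inv\<^bsub>A3\<^esub> (\<psi> \<otimes>\<^bsub>A3\<^esub> \<phi>)" ?z] by (simp add: F.m_assoc del: A3_apply A3_simps)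
    then show ?thesis using aut_lower_central[OF _ _ z] by simp
  qed
  then show ?thesis using M.commutator_closed[OF c] by (simp add: johnson_def)
qed

theorem lower_central_johnson: "n \<ge> 1 \<Longrightarrow> lower_central M3 n \<subseteq> johnson n"
proof (induction n rule: nat_induct_at_least)
  case base
  then show ?case using johnson_one by simp
next
  case (Suc n)
  then show ?case
    by (intro M.lower_central_Suc_minimal johnson_subgroup johnson_commutator) auto
qed

theorem M3_residually_nilpotent: "residually_nilpotent M3"
proof -
  have "m = \<one>\<^bsub>M3\<^esub>" if m: "\<And>n. n \<ge> 1 \<Longrightarrow> m \<in> lower_central M3 n" for m
  proof -
    have j: "m \<in> johnson n" if "n \<ge> 1" for n using lower_central_johnson[OF that] m[OF that] by blast
    have mc: "m \<in> carrier M3" using j[of 1] by (simp add: johnson_def)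
    have "m (gen3 i) \<otimes>\<^bsub>F3\<^esub> inv\<^bsub>F3\<^esub> gen3 i = \<one>\<^bsub>F3\<^esub>" for i
    proof (rule F3_residually_nilpotent)
      show "m (gen3 i) \<otimes>\<^bsub>F3\<^esub> inv\<^bsub>F3\<^esub> gen3 i \<in> carrier F3" using mc by simp
      fix n :: nat assume "n \<ge> 1"
      have "gen3 i \<in> lower_central F3 1" by simp
      then have "m (gen3 i) \<otimes>\<^bsub>F3\<^esub> inv\<^bsub>F3\<^esub> gen3 i \<in> lower_central F3 (1 + n)"
        using j[OF \<open>n \<ge> 1\<close>] unfolding johnson_def by blast
      then show "m (gen3 i) \<otimes>\<^bsub>F3\<^esub> inv\<^bsub>F3\<^esub> gen3 i \<in> lower_central F3 n"
        using F.lower_central_antimono[of n "1 + n"] by auto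
    qed
    then have "m (gen3 i) = gen3 i" for i
      using mc by (metis A3_simps(1) F.inv_closed F.inv_equality F.inv_inv M3_carrier gen3_closed)
    then show ?thesis using mc by (intro A3_eqI[of m "\<one>\<^bsub>M3\<^esub>"]) auto
  qed
  moreover have "\<one>\<^bsub>M3\<^esub> \<in> lower_central M3 n" for n by (rule M.lower_central_closed)
  ultimately show ?thesis unfolding residually_nilpotent_def by (auto simp del: M3_simps)
qed

section \<open>The graded Lie algebra of the McCool group\<close>

interpretation out: group_hom M3 F3 outer_part
  by (simp add: group_hom_def group_hom_axioms_def F.is_group M.is_group outer_part_hom)

definition gr3 :: "(nat \<Rightarrow> (nat fgroup \<Rightarrow> nat fgroup) set) lie_ring" where
  "gr3 = associated_graded M3"

interpretation Gr: lie_algebra gr3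
  unfolding gr3_def by (rule M.lie_algebra_graded)

definition single :: "nat \<Rightarrow> (nat fgroup \<Rightarrow> nat fgroup) \<Rightarrow> nat \<Rightarrow> (nat fgroup \<Rightarrow> nat fgroup) set" where
  "single n m = gr_single M3 n (lc_class M3 n m)"

lemma single_closed: "m \<in> lower_central M3 n \<Longrightarrow> single n m \<in> carrier gr3"
  by (simp add: single_def gr3_def M.gr_single_closed)

lemma single_mult: "m \<in> lower_central M3 n \<Longrightarrow> m' \<in> lower_central M3 n
    \<Longrightarrow> single n (m \<otimes>\<^bsub>M3\<^esub> m') = single n m \<otimes>\<^bsub>gr3\<^esub> single n m'"
  by (simp add: single_def gr3_def M.gr_single_mult del: M3_simps)

lemma single_inv: "m \<in> lower_central M3 n \<Longrightarrow> single n (inv\<^bsub>M3\<^esub> m) = inv\<^bsub>gr3\<^esub> (single n m)"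
  by (simp add: single_def gr3_def M.gr_single_inv del: M3_inv)

lemma single_one: "single n (one M3) = one gr3"
  by (simp add: single_def gr3_def M.gr_single_one del: M3_simps)

lemma single_bracket: "1 \<le> c \<Longrightarrow> 1 \<le> d \<Longrightarrow> m \<in> lower_central M3 c \<Longrightarrow> m' \<in> lower_central M3 d
    \<Longrightarrow> bracket gr3 (single c m) (single d m') = single (c + d) (commutator M3 m m')"
  unfolding single_def gr3_def by (rule M.gr_br_single)

lemma single_eq_one: "1 \<le> n \<Longrightarrow> m \<in> carrier M3 \<Longrightarrow> single n m = one gr3 \<longleftrightarrow> m \<in> lower_central M3 (Suc n)"
  unfolding single_def gr3_def by (rule M.gr_single_eq_one_iff)

definition gr_gen :: "idx + idx \<Rightarrow> nat \<Rightarrow> (nat fgroup \<Rightarrow> nat fgroup) set" where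
  "gr_gen = case_sum (\<lambda>a. single 1 (inner (gen3 a))) (\<lambda>b. single 1 (beta b))"

lemma gr_gen_closed [simp]: "gr_gen p \<in> carrier gr3"
  by (cases p) (auto simp: gr_gen_def inner_M3 beta_M3 intro!: single_closed)

definition lam :: "(idx + idx) flie \<Rightarrow> nat \<Rightarrow> (nat fgroup \<Rightarrow> nat fgroup) set" where
  "lam = fl_ev gr3 gr_gen"

lemma lam_simps [simp]:
  "lam u \<in> carrier gr3" "lam (fl_gen p) = gr_gen p" "lam 0 = one gr3" "lam (u + v) = lam u \<otimes>\<^bsub>gr3\<^esub> lam v"
  "lam (- u) = inv\<^bsub>gr3\<^esub> (lam u)" "lam (u \<diamondop> v) = bracket gr3 (lam u) (lam v)"
  unfolding lam_def by (simp_all add: Gr.fl_ev_simps[OF gr_gen_closed])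

lemma lam_diff: "lam (u - v) = lam u \<otimes>\<^bsub>gr3\<^esub> inv\<^bsub>gr3\<^esub> (lam v)"
  using lam_simps(4)[of u "- v"] by simp

text \<open>The derivations by which the \<open>b\<^sub>j\<close> act: \<open>[b\<^sub>j, a\<^bsub>j+1\<^esub>] = [a\<^sub>j, a\<^bsub>j+1\<^esub>]\<close> and \<open>[b\<^sub>j, a\<^sub>i] = 0\<close> otherwise.\<close>

definition mc_action :: "idx \<Rightarrow> idx \<Rightarrow> idx flie" where
  "mc_action b a = (if a = nxt b then fl_gen b \<diamondop> fl_gen a else 0)"

text \<open>The nine relations already hold in the group: \<open>(beta b, inner g) = inner (\<chi>(g\<inverse>) g)\<close> for the inverse
  \<open>\<chi>\<close> of \<open>beta b\<close>.\<close>

lemma beta_inner_commutator: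
  "commutator M3 (beta b) (inner (gen3 a))
    = (if a = nxt b then commutator M3 (inner (gen3 b)) (inner (gen3 a)) else one M3)"
proof -
  let ?g = "gen3 a"
  have chi: "chi (nxt b) b \<in> carrier A3" "chi (nxt b) b = inv\<^bsub>A3\<^esub> (beta b)" by (simp_all add: chi_props beta_def)
  have "commutator M3 (beta b) (inner ?g) = inv\<^bsub>A3\<^esub> (beta b) \<otimes>\<^bsub>A3\<^esub> inner (inv\<^bsub>F3\<^esub> ?g) \<otimes>\<^bsub>A3\<^esub> beta b \<otimes>\<^bsub>A3\<^esub> inner ?g"
    by (simp add: commutator_def beta_M3 inner_M3)
  also have "\<dots> = inner (chi (nxt b) b (inv\<^bsub>F3\<^esub> ?g)) \<otimes>\<^bsub>A3\<^esub> inner ?g"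
    using aut_inner[of "inv\<^bsub>A3\<^esub> (beta b)" "inv\<^bsub>F3\<^esub> ?g"] chi
    by (simp add: A.m_assoc del: inner.hom_inv)
  also have "\<dots> = inner (chi (nxt b) b (inv\<^bsub>F3\<^esub> ?g) \<otimes>\<^bsub>F3\<^esub> ?g)"
    using chi by (simp add: inner_mult)
  also have "chi (nxt b) b (inv\<^bsub>F3\<^esub> ?g) \<otimes>\<^bsub>F3\<^esub> ?g = (if a = nxt b then commutator F3 (gen3 b) ?g else \<one>\<^bsub>F3\<^esub>)"
    using chi(1) by (simp add: chi_props commutator_def F.inv_mult_group F.m_assoc)
  also have "inner (if a = nxt b then commutator F3 (gen3 b) ?g else \<one>\<^bsub>F3\<^esub>)
      = (if a = nxt b then commutator M3 (inner (gen3 b)) (inner ?g) else one M3)"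
    using inM.hom_commutator[of "gen3 b" ?g] inM.hom_one by (cases "a = nxt b") (simp_all del: M3_simps)
  finally show ?thesis .
qed

lemma lam_mc_action: "lam (fl_map Inl (mc_action b a)) = bracket gr3 (gr_gen (Inr b)) (gr_gen (Inl a))"
proof -
  have m: "inner (gen3 i) \<in> lower_central M3 1" "beta b \<in> lower_central M3 1" for i by (simp_all add: inner_M3 beta_M3)
  have "bracket gr3 (gr_gen (Inr b)) (gr_gen (Inl a)) = single 2 (commutator M3 (beta b) (inner (gen3 a)))"
    using single_bracket[OF _ _ m(2) m(1)[of a]] by (simp add: gr_gen_def numeral_2_eq_2)
  also have "\<dots> = lam (fl_map Inl (mc_action b a))"
    using single_bracket[OF _ _ m(1)[of b] m(1)[of a]]
    by (cases "a = nxt b")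
      (simp_all add: beta_inner_commutator mc_action_def single_one gr_gen_def numeral_2_eq_2 del: M3_simps)
  finally show ?thesis by simp
qed

lemma lam_derivation:
  "lam (fl_map Inl (der (mc_action b) u)) = lam (fl_gen (Inr b) \<diamondop> fl_map Inl u)"
proof (induction u rule: flie_induct)
  case (Gen a)
  then show ?case by (simp add: lam_mc_action)
next
  case (Plus u v)
  then show ?case by (simp add: Gr.bracket_right)
next
  case (Neg u)
  have "lam (fl_gen (Inr b) \<diamondop> fl_map Inl (- u)) = inv\<^bsub>gr3\<^esub> (lam (fl_gen (Inr b) \<diamondop> fl_map Inl u))"
    using lam_simps(5)[of "fl_gen (Inr b) \<diamondop> fl_map Inl u"] by (simp del: lam_simps(2,5,6))
  then show ?case using Neg by (simp del: lam_simps(2,6))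
next
  case (Br u v)
  let ?b = "fl_gen (Inr b) :: (idx + idx) flie" and ?u = "fl_map Inl u :: (idx + idx) flie"
    and ?v = "fl_map Inl v :: (idx + idx) flie"
  have "lam (?b \<diamondop> (?u \<diamondop> ?v)) = lam ((?b \<diamondop> ?u) \<diamondop> ?v + ?u \<diamondop> (?b \<diamondop> ?v))"
    by (simp only: br_derivation[of ?b])
  then show ?case using Br by simp
next
  case Zero
  have "lam (fl_gen (Inr b) \<diamondop> 0) = one gr3" by (simp only: br_zero_right lam_simps)
  then show ?case by (simp del: lam_simps(6))
qed

lemma lam_action:
  "lam (fl_map Inl (act mc_action v u)) = lam (fl_map Inr v \<diamondop> fl_map Inl u)"
proof (induction v arbitrary: u rule: flie_induct)
  case (Gen b)
  then show ?case using lam_derivation[of b u] by simp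
next
  case Zero
  have "lam (0 \<diamondop> fl_map Inl u) = one gr3" by (simp only: br_zero_left lam_simps)
  then show ?case by (simp del: lam_simps(6))
next
  case (Plus v w)
  then show ?case by (simp add: Gr.bracket_left)
next
  case (Neg v)
  have "lam (fl_map Inr (- v) \<diamondop> fl_map Inl u) = inv\<^bsub>gr3\<^esub> (lam (fl_map Inr v \<diamondop> fl_map Inl u))"
    using lam_simps(5)[of "fl_map Inr v \<diamondop> fl_map Inl u"] by (simp del: lam_simps(5,6))
  then show ?case using Neg by (simp del: lam_simps(6))
next
  case (Br v w)
  let ?u = "fl_map Inl u :: (idx + idx) flie" and ?v = "fl_map Inr v :: (idx + idx) flie"
    and ?w = "fl_map Inr w :: (idx + idx) flie"
  have "lam ((?v \<diamondop> ?w) \<diamondop> ?u) = lam (?v \<diamondop> (?w \<diamondop> ?u) - ?w \<diamondop> (?v \<diamondop> ?u))"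
    using br_derivation[of ?v ?w ?u] by simp
  then show ?case using Br by (simp add: lam_diff)
qed

text \<open>Both sides depend on \<open>z\<close> as Lie homomorphisms, because \<open>lam\<close> turns the action in the semidirect product into
  brackets. Hence \<open>lam\<close> factors through \<open>semi_proj\<close>.\<close>

theorem lam_section:
  "lam z = lam (fl_map Inl (fst (semi_proj mc_action z)) + fl_map Inr (snd (semi_proj mc_action z)))"
proof (induction z rule: flie_induct)
  case (Gen p)
  then show ?case by (cases p) simp_all
next
  case (Plus u v)
  then show ?case by (simp add: Gr.m_ac)
next
  case (Neg u)
  then show ?case by (simp add: lam_diff Gr.inv_mult_group Gr.m_comm)
next
  case (Br z z')
  define a b c e where "a = fst (semi_proj mc_action z)" "b = snd (semi_proj mc_action z)"
    "c = fst (semi_proj mc_action z')" "e = snd (semi_proj mc_action z')"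
  note abce = this
  define A B C E :: "(idx + idx) flie" where "A = fl_map Inl a" "B = fl_map Inr b" "C = fl_map Inl c" "E = fl_map Inr e"
  note ABCE = this
  have "lam (z \<diamondop> z') = lam ((A + B) \<diamondop> (C + E))"
    using Br by (simp add: abce ABCE)
  also have "(A + B) \<diamondop> (C + E) = A \<diamondop> C + B \<diamondop> C - E \<diamondop> A + B \<diamondop> E"
    using br_anti[of A E] by (simp add: br_add_left br_add_right algebra_simps)
  also have "lam \<dots> = lam (A \<diamondop> C) \<otimes>\<^bsub>gr3\<^esub> lam (B \<diamondop> C) \<otimes>\<^bsub>gr3\<^esub> inv\<^bsub>gr3\<^esub> (lam (E \<diamondop> A)) \<otimes>\<^bsub>gr3\<^esub> lam (B \<diamondop> E)"
    by (simp only: lam_simps(4) lam_diff)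
  also have "\<dots> = lam (fl_map Inl (a \<diamondop> c)) \<otimes>\<^bsub>gr3\<^esub> lam (fl_map Inl (act mc_action b c))
      \<otimes>\<^bsub>gr3\<^esub> inv\<^bsub>gr3\<^esub> (lam (fl_map Inl (act mc_action e a))) \<otimes>\<^bsub>gr3\<^esub> lam (fl_map Inr (b \<diamondop> e))"
    by (simp only: lam_action ABCE fl_map_simps)
  also have "\<dots> = lam (fl_map Inl (a \<diamondop> c + act mc_action b c - act mc_action e a) + fl_map Inr (b \<diamondop> e))"
    by (simp only: lam_simps(4) lam_diff fl_map_simps(3,6))
  finally show ?case by (simp only: semi_proj_simps semi_br_def fst_conv snd_conv abce)
qed simp

section \<open>Surjectivity\<close>

lemma single_range_subgroup: "subgroup {m \<in> lower_central M3 n. \<exists>z. single n m = lam z} M3"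
proof -
  define T where "T = {m \<in> lower_central M3 n. \<exists>z. single n m = lam z}"
  have "subgroup T M3"
  proof (rule M.subgroupI)
    show "T \<subseteq> carrier M3" using M.lower_central_carrier by (auto simp: T_def)
    have "single n (one M3) = lam 0" by (simp only: single_one lam_simps)
    then have "one M3 \<in> T" using M.lower_central_closed(3)[of n] unfolding T_def by blast
    then show "T \<noteq> {}" by blast
    fix a b assume "a \<in> T"
    then obtain z where z: "a \<in> lower_central M3 n" "single n a = lam z" by (auto simp: T_def)
    have "single n (inv\<^bsub>M3\<^esub> a) = lam (- z)" using single_inv[OF z(1)] z(2) by simp
    then show "inv\<^bsub>M3\<^esub> a \<in> T" using M.lower_central_closed(2)[OF z(1)] unfolding T_def by blast
    assume "b \<in> T"
    then obtain y where y: "b \<in> lower_central M3 n" "single n b = lam y" by (auto simp: T_def)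
    have "single n (a \<otimes>\<^bsub>M3\<^esub> b) = lam (z + y)" using single_mult[OF z(1) y(1)] z(2) y(2) by simp
    then show "a \<otimes>\<^bsub>M3\<^esub> b \<in> T" using M.lower_central_closed(1)[OF z(1) y(1)] unfolding T_def by blast
  qed
  then show ?thesis by (simp only: T_def)
qed

lemma single_in_range_1:
  assumes "m \<in> carrier M3"
  shows "\<exists>z. single 1 m = lam z"
proof -
  have "{m \<in> lower_central M3 1. \<exists>z. single 1 m = lam z} = carrier M3"
  proof (rule M3_generate[OF single_range_subgroup])
    fix j
    have "\<exists>z. single 1 (inner (gen3 j)) = lam z" "\<exists>z. single 1 (beta j) = lam z"
      by (rule exI[of _ "fl_gen (Inl j)"], simp add: gr_gen_def,
          rule exI[of _ "fl_gen (Inr j)"], simp add: gr_gen_def)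
    then show "inner (gen3 j) \<in> {m \<in> lower_central M3 1. \<exists>z. single 1 m = lam z}"
      "beta j \<in> {m \<in> lower_central M3 1. \<exists>z. single 1 m = lam z}"
      using inner_M3[of "gen3 j"] beta_M3[of j] by (simp_all del: One_nat_def)
  qed
  then show ?thesis using assms by blast
qed

text \<open>The image of \<open>lam\<close> contains the degree one part, and every further lower central quotient is generated by brackets
  with it.\<close>

lemma single_in_range:
  assumes "n \<ge> 1" "m \<in> lower_central M3 n"
  shows "\<exists>z. single n m = lam z"
  using assms
proof (induction n arbitrary: m rule: nat_induct_at_least)
  case base
  then show ?case using single_in_range_1 by simp
next
  case (Suc n)
  have "lower_central M3 (Suc n) \<subseteq> {m \<in> lower_central M3 (Suc n). \<exists>z. single (Suc n) m = lam z}"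
  proof (rule M.lower_central_Suc_minimal[OF Suc.hyps single_range_subgroup])
    fix a b assume ab: "a \<in> lower_central M3 n" "b \<in> carrier M3"
    obtain z y where "single n a = lam z" "single 1 b = lam y"
      using Suc.IH[OF ab(1)] single_in_range_1[OF ab(2)] by blast
    then have "single (Suc n) (commutator M3 a b) = lam (z \<diamondop> y)"
      using single_bracket[OF Suc.hyps _ ab(1), of 1 b] ab(2) by simp
    then show "commutator M3 a b \<in> {m \<in> lower_central M3 (Suc n). \<exists>z. single (Suc n) m = lam z}"
      using M.lower_central_commutator_carrier[OF Suc.hyps ab] by blast
  qed
  then show ?case using Suc.prems by blast
qed

theorem lam_surj:
  assumes "x \<in> carrier gr3"
  shows "\<exists>z. x = lam z"
  using assms unfolding gr3_def
proof (induction x rule: M.gr_induct)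
  case (single n a)
  then show ?case using single_in_range unfolding single_def by blast
next
  case (mult x y)
  then obtain z w where "x = lam z" "y = lam w" by blast
  then have "x \<otimes>\<^bsub>associated_graded M3\<^esub> y = lam (z + w)" by (simp add: gr3_def)
  then show ?case by blast
qed

section \<open>Injectivity\<close>

lemma homog_kill_left: "homog n z \<Longrightarrow> homog n (kill_left z)"
proof (induction rule: homog.induct)
  case (homog_gen x)
  then show ?case by (cases x) (auto intro: homog.intros simp del: One_nat_def)
qed (auto intro: homog.intros)

lemma homog_map: "homog n z \<Longrightarrow> homog n (fl_map f z)"
  by (induction rule: homog.induct) (auto intro: homog.intros simp del: One_nat_def)

lemma leads_deeper:
  assumes "leads n a u" "homog n u" "a \<in> nc_low (Suc n)"
  shows "nc_lie u = 0"
proof (rule ncps_eqI)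
  fix w
  show "nc_coeff (nc_lie u) w = nc_coeff 0 w"
    using assms homog_pure[OF assms(2)]
    by (cases "length w = n") (auto simp: leads_def nc_low_def low_def pure_def)
qed

text \<open>A group \<open>H\<close> over \<open>M\<^sub>3\<close> with a map to power series, and a Lie ring over \<open>L\<close> with a map to the free Lie ring of rank \<open>3\<close>,
  that match on generators. They then match on homogeneous elements: each \<open>u\<close> of degree \<open>n\<close> is represented by some
  \<open>h\<close> in \<open>\<gamma>\<^sub>n(H)\<close> whose series has the leading term \<open>q u\<close>. This is used for \<open>H = M\<^sub>3\<close>, to read off the component in
  the \<open>b\<^sub>j\<close>, and for \<open>H = F\<^sub>3\<close> mapping to inner automorphisms, to read off the component in the \<open>a\<^sub>j\<close>.\<close>

locale graded_representation = E: group_hom H nc_units e + I: group_hom H M3 \<iota>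
  for H :: "('h, 'm) monoid_scheme" and e and \<iota> +
  fixes p :: "'x flie \<Rightarrow> (idx + idx) flie" and q :: "'x flie \<Rightarrow> idx flie"
  assumes p: "p 0 = 0" "p (u + v) = p u + p v" "p (- u) = - p u" "p (u \<diamondop> v) = p u \<diamondop> p v"
    and q: "q 0 = 0" "q (u + v) = q u + q v" "q (- u) = - q u" "q (u \<diamondop> v) = q u \<diamondop> q v"
    and q_homog: "homog n u \<Longrightarrow> homog n (q u)"
    and gen: "\<exists>h\<in>carrier H. lam (p (fl_gen x)) = single 1 (\<iota> h) \<and> leads 1 (e h) (q (fl_gen x))"
begin

lemma homog_represented:
  assumes "homog n u" "n \<ge> 1"
  shows "\<exists>h\<in>lower_central H n. lam (p u) = single n (\<iota> h) \<and> leads n (e h) (q u)"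
  using assms
proof (induction rule: homog.induct)
  case (homog_gen x)
  then show ?case using gen[of x] by simp
next
  case (homog_zero n)
  have "single n (\<iota> \<one>\<^bsub>H\<^esub>) = one gr3" using single_one[of n] by (simp only: I.hom_one)
  then show ?case
    using leads_one[of n] E.hom_one E.G.lower_central_closed(3)[of n]
    by (intro bexI[of _ "\<one>\<^bsub>H\<^esub>"]) (simp_all add: p q del: M3_simps)
next
  case (homog_add n u v)
  then obtain g h where g: "g \<in> lower_central H n" "lam (p u) = single n (\<iota> g)" "leads n (e g) (q u)"
    and h: "h \<in> lower_central H n" "lam (p v) = single n (\<iota> h)" "leads n (e h) (q v)"
    by blast
  have c: "g \<in> carrier H" "h \<in> carrier H" using g h E.G.lower_central_carrier by blast+
  have M: "\<iota> g \<in> lower_central M3 n" "\<iota> h \<in> lower_central M3 n"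
    using I.hom_lower_central homog_add.prems g h by blast+
  show ?case
  proof (rule bexI[of _ "g \<otimes>\<^bsub>H\<^esub> h"], intro conjI)
    show "lam (p (u + v)) = single n (\<iota> (g \<otimes>\<^bsub>H\<^esub> h))"
      using g h c single_mult[OF M] by (simp add: p del: M3_simps)
    show "leads n (e (g \<otimes>\<^bsub>H\<^esub> h)) (q (u + v))"
      using leads_mult[OF g(3) h(3)] homog_add q_homog c by (simp add: q)
  qed (use g h E.G.lower_central_closed in blast)
next
  case (homog_neg n u)
  then obtain g where g: "g \<in> lower_central H n" "lam (p u) = single n (\<iota> g)" "leads n (e g) (q u)"
    by blast
  have c: "g \<in> carrier H" using g E.G.lower_central_carrier by blast
  have M: "\<iota> g \<in> lower_central M3 n"
    using I.hom_lower_central homog_neg.prems g by blast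
  show ?case
  proof (rule bexI[of _ "inv\<^bsub>H\<^esub> g"], intro conjI)
    show "lam (p (- u)) = single n (\<iota> (inv\<^bsub>H\<^esub> g))"
      using g c single_inv[OF M] by (simp add: p del: M3_inv)
    show "leads n (e (inv\<^bsub>H\<^esub> g)) (q (- u))"
      using leads_inv[OF g(3)] homog_neg q_homog c by (simp add: q)
  qed (use g E.G.lower_central_closed in blast)
next
  case (homog_br k u n v)
  show ?case
  proof (cases "k = 0 \<or> n = 0")
    case True
    then have "u \<diamondop> v = 0" using homog_0[OF homog_br.hyps(1)] homog_0[OF homog_br.hyps(2)] by auto
    moreover have "single (k + n) (\<iota> \<one>\<^bsub>H\<^esub>) = one gr3" using single_one[of "k + n"] by (simp only: I.hom_one)
    ultimately show ?thesis
      using leads_one[of "k + n"] E.hom_one E.G.lower_central_closed(3)[of "k + n"]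
      by (intro bexI[of _ "\<one>\<^bsub>H\<^esub>"]) (simp_all add: p(1) q(1) del: M3_simps)
  next
    case False
    then obtain g h where g: "g \<in> lower_central H k" "lam (p u) = single k (\<iota> g)" "leads k (e g) (q u)"
      and h: "h \<in> lower_central H n" "lam (p v) = single n (\<iota> h)" "leads n (e h) (q v)"
      using homog_br.IH by auto
    have c: "g \<in> carrier H" "h \<in> carrier H" using g h E.G.lower_central_carrier by blast+
    have M: "\<iota> g \<in> lower_central M3 k" "\<iota> h \<in> lower_central M3 n"
      using I.hom_lower_central False g h by auto
    show ?thesis
    proof (rule bexI[of _ "commutator H g h"], intro conjI)
      show "lam (p (u \<diamondop> v)) = single (k + n) (\<iota> (commutator H g h))"
        using g h c False single_bracket[OF _ _ M] by (simp add: p I.hom_commutator)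
      show "leads (k + n) (e (commutator H g h)) (q (u \<diamondop> v))"
        using leads_commutator[OF g(3) h(3)] homog_br.hyps q_homog c by (simp add: q E.hom_commutator)
      show "commutator H g h \<in> lower_central H (k + n)"
        using g h False by (intro E.G.lower_central_commutator) auto
    qed
  qed
qed

end

lemma outer_representation:
  "graded_representation M3 (\<lambda>m. magnus (outer_part m)) (\<lambda>m. m) (\<lambda>z. z) kill_left"
proof unfold_locales
  show "(\<lambda>m. magnus (outer_part m)) \<in> hom M3 nc_units"
    using hom_compose[OF outer_part_hom magnus(1)] by (simp add: comp_def)
  show "(\<lambda>m. m) \<in> hom M3 M3" by (simp add: hom_def)
  fix r :: "idx + idx"
  show "\<exists>m\<in>carrier M3. lam (fl_gen r) = single 1 m \<and> leads 1 (magnus (outer_part m)) (kill_left (fl_gen r))"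
  proof (cases r)
    case (Inl a)
    then show ?thesis
      using leads_one[of 1] by (intro bexI[of _ "inner (gen3 a)"])
        (simp_all add: gr_gen_def outer_part_inner mag.hom_one inner_M3 del: One_nat_def)
  next
    case (Inr b)
    have "outer_part (beta b) = gen3 b" using outer_part_psi[of "gen3 b"] by (simp add: psi)
    then show ?thesis
      using leads_magnus_gen[of b] Inr by (intro bexI[of _ "beta b"])
        (simp_all add: gr_gen_def beta_M3 del: One_nat_def)
  qed
qed (simp_all add: homog_kill_left)

lemma inner_representation: "graded_representation F3 magnus inner (fl_map Inl) (\<lambda>u. u)"
proof unfold_locales
  fix a
  show "\<exists>g\<in>carrier F3. lam (fl_map Inl (fl_gen a)) = single 1 (inner g) \<and> leads 1 (magnus g) (fl_gen a)"
    using leads_magnus_gen[of a]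
    by (intro bexI[of _ "gen3 a"]) (simp_all add: gr_gen_def del: One_nat_def)
qed simp_all

lemma lam_component:
  assumes "homog n z" "i \<ge> 1" "i \<noteq> n"
  shows "lam z i = one (lower_central_quotient M3 i)"
proof (cases "n = 0")
  case True
  then have "lam z = one gr3" using homog_0[OF assms(1)] by simp
  then show ?thesis using assms(2) by (simp add: gr3_def gr_simps)
next
  case False
  then obtain m where "lam z = single n m" using graded_representation.homog_represented[OF outer_representation, OF assms(1)] by auto
  then show ?thesis using assms by (simp add: single_def gr_single_def)
qed

text \<open>The homogeneous components of an element of \<open>L\<close> land in different summands of \<open>gr(M\<^sub>3)\<close>.\<close>

lemma lam_homog_components:
  assumes "\<And>n. homog n (f n)" "lam (\<Sum>n\<le>N. f n) = one gr3" "n \<le> N"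
  shows "lam (f n) = one gr3"
proof -
  let ?Q = "lower_central_quotient M3"
  have comp: "lam u i \<in> carrier (?Q i)" if "i \<ge> 1" for u i
    using M.gr_comp_closed[of "lam u" i] that lam_simps(1)[of u] by (simp add: gr3_def del: lam_simps)
  have Q: "Group.monoid (?Q i)" for i using M.group_quotient group.is_monoid by blast
  have mult: "lam (u + v) i = lam u i \<otimes>\<^bsub>?Q i\<^esub> lam v i" if "i \<ge> 1" for u v i
    using that by (simp add: gr3_def gr_simps(1))
  have sum: "lam (\<Sum>n\<le>N. f n) i = (if i \<le> N then lam (f i) i else one (?Q i))" if i: "i \<ge> 1" for N i
  proof (induction N)
    case 0
    then show ?case using lam_component[OF assms(1)] i by simp
  next
    case (Suc N)
    have "lam (\<Sum>n\<le>Suc N. f n) i = lam (\<Sum>n\<le>N. f n) i \<otimes>\<^bsub>?Q i\<^esub> lam (f (Suc N)) i"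
      using mult[OF i] by simp
    then show ?case
      using Suc lam_component[OF assms(1) i, of "Suc N"] comp[OF i] Q
      by (cases "i = Suc N") (auto simp: monoid.l_one monoid.r_one monoid.one_closed)
  qed
  have "lam (f n) i = one gr3 i" for i
  proof (cases "i \<ge> 1")
    case True
    then show ?thesis
      using sum[OF True, of N] assms lam_component[OF assms(1) True, of n]
      by (cases "i = n") (auto simp: gr3_def gr_simps)
  next
    case False
    have "lam (f n) \<in> carrier (associated_graded M3)" using lam_simps(1)[of "f n"] by (simp add: gr3_def)
    then show ?thesis using False by (auto simp: M.gr_carrier_iff gr3_def gr_simps PiE_iff extensional_def)
  qed
  then show ?thesis by blast
qed

text \<open>If \<open>m\<close> represents \<open>z\<close> and lies in \<open>\<gamma>\<^bsub>n+1\<^esub>(M\<^sub>3)\<close>, so does its image in the free group, whose Magnus series then has no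
  term of degree \<open>n\<close>.\<close>

lemma lam_homog_outer:
  assumes "homog n z" "lam z = one gr3"
  shows "kill_left z = 0"
proof (cases "n = 0")
  case True
  then show ?thesis using homog_0[OF assms(1)] by simp
next
  case False
  then obtain m where m: "m \<in> lower_central M3 n" "lam z = single n m" "leads n (magnus (outer_part m)) (kill_left z)"
    using graded_representation.homog_represented[OF outer_representation, OF assms(1)] by auto
  then have "m \<in> lower_central M3 (Suc n)"
    using assms(2) single_eq_one[of n m] False M.lower_central_carrier by auto
  then have "outer_part m \<in> lower_central F3 (Suc n)"
    by (intro out.hom_lower_central) auto
  then have "magnus (outer_part m) \<in> nc_low (Suc n)"
    by (intro magnus_lower_central) auto
  then show ?thesis
    using leads_deeper[OF m(3)] homog_kill_left[OF assms(1)] nc_lie_inj_homog by blast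
qed

text \<open>If \<open>inner g\<close> represents \<open>u\<close> and lies in \<open>\<gamma>\<^bsub>n+1\<^esub>(M\<^sub>3)\<close>, the Johnson filtration puts \<open>g x g\<inverse> x\<inverse>\<close> into
  \<open>\<gamma>\<^bsub>n+2\<^esub>(F\<^sub>3)\<close> for every generator \<open>x\<close>. So \<open>u\<close>, the leading term of \<open>g\<close>, commutes with all variables.\<close>

lemma lam_homog_inner:
  assumes "homog n u" "lam (fl_map Inl u) = one gr3"
  shows "u = 0"
proof (cases "n = 0")
  case True
  then show ?thesis using homog_0[OF assms(1)] by simp
next
  case False
  then obtain g where g: "g \<in> lower_central F3 n" "lam (fl_map Inl u) = single n (inner g)" "leads n (magnus g) u"
    using graded_representation.homog_represented[OF inner_representation, OF assms(1)] by auto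
  have c: "g \<in> carrier F3" using g F.lower_central_carrier by blast
  have "inner g \<in> lower_central M3 (Suc n)"
    using assms(2) g single_eq_one[of n "inner g"] False inner_M3[OF c] by auto
  then have J: "inner g \<in> johnson (Suc n)" using lower_central_johnson[of "Suc n"] by auto
  have "nc_lie ((- u) \<diamondop> (- fl_gen i)) = 0" for i
  proof (rule leads_deeper)
    let ?x = "gen3 i"
    have "?x \<in> lower_central F3 1" by simp
    then have "inner g ?x \<otimes>\<^bsub>F3\<^esub> inv\<^bsub>F3\<^esub> ?x \<in> lower_central F3 (1 + Suc n)"
      using J unfolding johnson_def by blast
    then have "commutator F3 (inv\<^bsub>F3\<^esub> g) (inv\<^bsub>F3\<^esub> ?x) \<in> lower_central F3 (Suc (n + 1))"
      using c by (simp add: commutator_def del: lower_central.simps)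
    then show "magnus (commutator F3 (inv\<^bsub>F3\<^esub> g) (inv\<^bsub>F3\<^esub> ?x)) \<in> nc_low (Suc (n + 1))"
      by (intro magnus_lower_central) auto
    have "leads n (magnus (inv\<^bsub>F3\<^esub> g)) (- u)" "leads 1 (magnus (inv\<^bsub>F3\<^esub> ?x)) (- fl_gen i)"
      using leads_inv[OF g(3) assms(1)] leads_inv[OF leads_magnus_gen homog_gen, of i] c by simp_all
    then show "leads (n + 1) (magnus (commutator F3 (inv\<^bsub>F3\<^esub> g) (inv\<^bsub>F3\<^esub> ?x))) ((- u) \<diamondop> (- fl_gen i))"
      using leads_commutator[of n _ "- u" 1 _ "- fl_gen i"] homog_neg[OF assms(1)] homog_neg[OF homog_gen, of i] c
      by (simp add: magnus_commutator del: br_minus_left br_minus_right)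
    show "homog (n + 1) ((- u) \<diamondop> (- fl_gen i))"
      by (intro homog_br homog_neg assms homog_gen)
  qed
  then have "nc_var i * nc_lie u = nc_lie u * nc_var i" for i by simp
  moreover have "\<exists>y. y \<noteq> x" for x :: idx using nxt_simps(1)[of x] by blast
  ultimately have "nc_lie u = 0" using nc_lie_centre[OF assms(1)] False by blast
  then show ?thesis using nc_lie_inj_homog[OF assms(1)] by blast
qed

text \<open>First all components are seen to have no part in the \<open>b\<^sub>j\<close>; what is left comes from the \<open>a\<^sub>j\<close> alone.\<close>

theorem lam_section_inj:
  assumes "lam (fl_map Inl u + fl_map Inr v) = one gr3"
  shows "u = 0 \<and> v = 0"
proof -
  have kl: "kill_left (fl_map Inl w) = 0" "kill_left (fl_map Inr w) = w" for w :: "idx flie"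
    by (induction w rule: flie_induct) simp_all
  have ks: "kill_left (sum h A) = (\<Sum>a\<in>A. kill_left (h a))" for h :: "nat \<Rightarrow> (idx + idx) flie" and A
    by (induction A rule: infinite_finite_induct) simp_all
  obtain N f where f: "\<And>n. homog n (f n)" "fl_map Inl u + fl_map Inr v = (\<Sum>n\<le>N. f n)"
    using homog_decomposition by metis
  have "kill_left (f n) = 0" if "n \<le> N" for n
    using lam_homog_outer[OF f(1)] lam_homog_components[OF f(1) _ that] assms f(2) by simp
  then have "kill_left (\<Sum>n\<le>N. f n) = 0" by (simp add: ks)
  then have v: "v = 0" by (simp add: kl flip: f(2))
  obtain N g where g: "\<And>n. homog n (g n)" "u = (\<Sum>n\<le>N. g n)"
    using homog_decomposition by metis
  have "lam (\<Sum>n\<le>N. fl_map Inl (g n)) = one gr3"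
    using assms v by (simp add: g(2) fl_map_sum del: lam_simps(4))
  then have "g n = 0" if "n \<le> N" for n
    using lam_homog_inner[OF g(1)] lam_homog_components[of "\<lambda>n. fl_map Inl (g n)", OF homog_map[OF g(1)] _ that] by blast
  then have "u = 0" by (simp add: g(2))
  then show ?thesis using v by simp
qed

theorem lam_kernel: "lam z = one gr3 \<longleftrightarrow> semi_proj mc_action z = 0"
proof
  assume "lam z = one gr3"
  then show "semi_proj mc_action z = 0"
    using lam_section[of z] lam_section_inj by (simp add: prod_eq_iff del: lam_simps)
next
  assume "semi_proj mc_action z = 0"
  then show "lam z = one gr3" using lam_section[of z] by simp
qed

lemma lam_eq_iff: "lam u = lam v \<longleftrightarrow> lam (u - v) = one gr3"
proof
  assume "lam (u - v) = one gr3"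
  then have "lam u \<otimes>\<^bsub>gr3\<^esub> inv\<^bsub>gr3\<^esub> (lam v) = one gr3" by (simp add: lam_diff)
  then show "lam u = lam v"
    using Gr.inv_equality[of "lam u" "inv\<^bsub>gr3\<^esub> (lam v)"] by simp
qed (simp add: lam_diff)

section \<open>Torsion-freeness\<close>

text \<open>By the previous results \<open>gr(M\<^sub>3)\<close> is additively a sum of two free Lie rings.\<close>

theorem torsion_free_gr3: "torsion_free gr3"
  unfolding torsion_free_def
proof (intro ballI allI impI)
  fix x and n :: nat assume x: "x \<in> carrier gr3" and n: "n > 0" and pow: "x [^]\<^bsub>gr3\<^esub> n = one gr3"
  obtain z where z: "x = lam z" using lam_surj[OF x] by blast
  have "lam (\<Sum>i<k. z) = x [^]\<^bsub>gr3\<^esub> k" for k :: nat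
    by (induction k) (simp_all add: z)
  then have "semi_proj mc_action (\<Sum>i<n. z) = 0" using pow by (simp flip: lam_kernel)
  moreover have "semi_proj mc_action (\<Sum>i<k. z) = (\<Sum>i<k. semi_proj mc_action z)" for k :: nat
    by (induction k) simp_all
  ultimately have t: "(\<Sum>i<n. fst (semi_proj mc_action z)) = 0" "(\<Sum>i<n. snd (semi_proj mc_action z)) = 0"
    by (simp_all add: prod_eq_iff fst_sum snd_sum)
  have "semi_proj mc_action z = 0"
    using flie_torsion_free[OF t(1) n] flie_torsion_free[OF t(2) n] by (simp add: prod_eq_iff)
  then show "x = one gr3" by (simp add: z lam_kernel)
qed

theorem torsion_free_quotient_M3:
  assumes c: "c \<ge> 1"
  shows "torsion_free (lower_central_quotient M3 c)"
  unfolding torsion_free_def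
proof (intro ballI allI impI)
  let ?Q = "lower_central_quotient M3 c"
  fix x and n :: nat assume x: "x \<in> carrier ?Q" and n: "n > 0" and pow: "x [^]\<^bsub>?Q\<^esub> n = one ?Q"
  obtain m where m: "x = lc_class M3 c m" "m \<in> lower_central M3 c"
    using x by (auto simp: M.carrier_quotient)
  have mc: "m \<in> carrier M3" using m M.lower_central_carrier by blast
  have mem: "m [^]\<^bsub>M3\<^esub> k \<in> lower_central M3 c" for k :: nat
    by (induction k) (simp_all add: m M.lower_central_closed del: M3_simps)
  have "x [^]\<^bsub>?Q\<^esub> k = lc_class M3 c (m [^]\<^bsub>M3\<^esub> k)" for k :: nat
    by (induction k) (simp_all add: m mem M.mult_quotient M.one_quotient del: M3_simps)
  then have "m [^]\<^bsub>M3\<^esub> n \<in> lower_central M3 (Suc c)"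
    using pow M.lc_class_one_iff[of "m [^]\<^bsub>M3\<^esub> n" c] mc by simp
  then have "single c (m [^]\<^bsub>M3\<^esub> n) = one gr3" using single_eq_one[OF c] mc by simp
  moreover have "single c (m [^]\<^bsub>M3\<^esub> k) = single c m [^]\<^bsub>gr3\<^esub> k" for k :: nat
    by (induction k) (simp_all add: single_mult single_one m mem del: M3_simps)
  ultimately have "single c m [^]\<^bsub>gr3\<^esub> n = one gr3" by simp
  then have "single c m = one gr3"
    using torsion_free_gr3 n single_closed[OF m(2)] unfolding torsion_free_def by blast
  then show "x = one ?Q"
    using single_eq_one[OF c mc] M.lc_class_one_iff[OF mc] m by simp
qed

section \<open>The presentation by a free ideal\<close>

text \<open>The generators \<open>1, \<dots>, 6\<close> of the free Lie ring in the theorem are \<open>a\<^sub>1, a\<^sub>2, a\<^sub>3, b\<^sub>1, b\<^sub>2, b\<^sub>3\<close>, in this order.\<close>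

definition enc :: "idx + idx \<Rightarrow> nat" where
  "enc = case_sum num (\<lambda>i. num i + 3)"

definition dec :: "nat \<Rightarrow> idx + idx" where
  "dec k = (if k = 1 then Inl I1 else if k = 2 then Inl I2 else if k = 3 then Inl I3
    else if k = 4 then Inr I1 else if k = 5 then Inr I2 else Inr I3)"

lemma dec_enc: "dec (enc p) = p"
  by (cases p; cases "projl p"; cases "projr p") (auto simp: dec_def enc_def)

lemma enc_mem: "enc p \<in> {1..6}"
proof (cases p)
  case (Inl i) then show ?thesis by (cases i) (auto simp: enc_def)
next
  case (Inr i) then show ?thesis by (cases i) (auto simp: enc_def)
qed

lemma enc_dec: "k \<in> {1..6} \<Longrightarrow> enc (dec k) = k"
proof -
  assume "k \<in> {1..6}"
  then have "k = 1 \<or> k = 2 \<or> k = 3 \<or> k = 4 \<or> k = 5 \<or> k = 6" by auto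
  then show ?thesis by (auto simp: dec_def enc_def)
qed

definition L6 :: "nat flie lie_ring" where "L6 = free_lie {1..6}"

interpretation L6: lie_algebra L6 unfolding L6_def by (rule lie_algebra_free_lie)

lemma free_lie_ops [simp]:
  "monoid.mult (free_lie S) = (+)" "one (free_lie S) = 0" "bracket (free_lie S) = (\<diamondop>)"
  by (simp_all add: free_lie_simps plus_flie_def zero_flie_def)

lemma free_lie_closed:
  "x \<in> S \<Longrightarrow> fl_gen x \<in> carrier (free_lie S)" "0 \<in> carrier (free_lie S)"
  "u \<in> carrier (free_lie S) \<Longrightarrow> v \<in> carrier (free_lie S) \<Longrightarrow> u + v \<in> carrier (free_lie S)"
  "u \<in> carrier (free_lie S) \<Longrightarrow> - u \<in> carrier (free_lie S)"
  "u \<in> carrier (free_lie S) \<Longrightarrow> v \<in> carrier (free_lie S) \<Longrightarrow> u \<diamondop> v \<in> carrier (free_lie S)"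
  using fl_gen_closed fl_zero_closed fl_plus_closed fl_neg_closed fl_br_closed
  by (auto simp: plus_flie_def zero_flie_def uminus_flie_def)

lemma inv_free_lie: "u \<in> carrier (free_lie S) \<Longrightarrow> inv\<^bsub>free_lie S\<^esub> u = - u"
proof -
  assume u: "u \<in> carrier (free_lie S)"
  interpret S: lie_algebra "free_lie S" by (rule lie_algebra_free_lie)
  show ?thesis by (rule S.inv_equality) (simp_all add: u free_lie_closed)
qed

lemma carrier_free_lie_image: "carrier (free_lie (range g)) = range (fl_map g)"
proof
  show "range (fl_map g) \<subseteq> carrier (free_lie (range g))"
  proof clarify
    fix u show "fl_map g u \<in> carrier (free_lie (range g))"
      by (induction u rule: flie_induct) (auto intro: free_lie_closed)
  qed
  have "abs_flie t \<in> range (fl_map g)" if "set_lie_term t \<subseteq> range g" for t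
    using that
  proof (induction t)
    case (Gen x)
    then obtain i where "x = g i" by auto
    then have "abs_flie (Gen x) = fl_map g (fl_gen i)" by (simp add: abs_flie_simps)
    then show ?case by blast
  next
    case Zero
    have "abs_flie Zero = fl_map g 0" by (simp add: abs_flie_simps)
    then show ?case by blast
  next
    case (Plus s t)
    then obtain u v where "abs_flie s = fl_map g u" "abs_flie t = fl_map g v" by auto
    then have "abs_flie (Plus s t) = fl_map g (u + v)" by (simp add: abs_flie_simps)
    then show ?case by blast
  next
    case (Neg s)
    then obtain u where "abs_flie s = fl_map g u" by auto
    then have "abs_flie (Neg s) = fl_map g (- u)" by (simp add: abs_flie_simps)
    then show ?case by blast
  next
    case (Br s t)
    then obtain u v where "abs_flie s = fl_map g u" "abs_flie t = fl_map g v" by auto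
    then have "abs_flie (Br s t) = fl_map g (u \<diamondop> v)" by (simp add: abs_flie_simps)
    then show ?case by blast
  qed
  then show "carrier (free_lie (range g)) \<subseteq> range (fl_map g)" by (auto simp: carrier_free_lie)
qed

lemma L6_simps [simp]: "monoid.mult L6 = (+)" "one L6 = 0" "bracket L6 = (\<diamondop>)"
  by (simp_all add: L6_def)

lemmas L6_closed = free_lie_closed[where S = "{1..6 :: nat}", folded L6_def]

lemma inv_L6: "u \<in> carrier L6 \<Longrightarrow> inv\<^bsub>L6\<^esub> u = - u"
  unfolding L6_def by (rule inv_free_lie)

lemma carrier_L6: "carrier L6 = range (fl_map enc)"
proof -
  have "range enc = {1..6}" using enc_mem enc_dec by (metis image_subset_iff subsetI rangeI subset_antisym)
  then show ?thesis using carrier_free_lie_image[of enc] by (simp only: L6_def)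
qed

definition lam6 :: "nat flie \<Rightarrow> nat \<Rightarrow> (nat fgroup \<Rightarrow> nat fgroup) set" where
  "lam6 u = lam (fl_map dec u)"

definition J6 :: "nat flie set" where
  "J6 = {u \<in> carrier L6. lam6 u = one gr3}"

lemma lam6_simps [simp]:
  "lam6 u \<in> carrier gr3" "lam6 0 = one gr3" "lam6 (u + v) = lam6 u \<otimes>\<^bsub>gr3\<^esub> lam6 v"
  "lam6 (- u) = inv\<^bsub>gr3\<^esub> (lam6 u)" "lam6 (u \<diamondop> v) = bracket gr3 (lam6 u) (lam6 v)"
  by (simp_all add: lam6_def)

lemma gr_bracket_one:
  assumes "x \<in> carrier gr3"
  shows "bracket gr3 x (one gr3) = one gr3"
  using Gr.bracket_right[OF assms Gr.one_closed Gr.one_closed] assms by simp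

lemma J6_ideal: "lie_ideal J6 L6"
  unfolding lie_ideal_def
proof
  show "subgroup J6 L6"
    by (rule L6.subgroupI) (auto simp: J6_def inv_L6 L6_closed intro!: exI[of _ 0])
  show "\<forall>x\<in>carrier L6. \<forall>y\<in>J6. bracket L6 x y \<in> J6"
    by (auto simp: J6_def L6_closed gr_bracket_one)
qed

text \<open>The free generators provided by \<open>ker_semi_proj_free\<close> are indexed by an auxiliary type; their images in \<open>J6\<close> serve as
  basis inside the carrier.\<close>

lemma J6_free: "is_free_lie (L6\<lparr>carrier := J6\<rparr>)"
proof -
  obtain f :: "idx list \<times> (idx \<times> idx list \<times> idx) \<Rightarrow> (idx + idx) flie" where
    f: "inj (fl_lift f)" "range (fl_lift f) = {z. semi_proj mc_action z = 0}"
    using ker_semi_proj_free by blast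
  define g where "g i = fl_map enc (f i)" for i
  have g: "fl_lift g u = fl_map enc (fl_lift f u)" for u
    by (induction u rule: flie_induct) (simp_all add: g_def)
  have de: "fl_map dec (fl_map enc z) = z" for z by (rule fl_map_inverse) (rule dec_enc)
  define \<Phi> :: "nat flie flie \<Rightarrow> nat flie" where "\<Phi> = fl_lift (\<lambda>b. b)"
  have \<Phi>: "\<Phi> (fl_map g u) = fl_map enc (fl_lift f u)" for u
    by (simp add: \<Phi>_def g)
  have "bij_betw \<Phi> (carrier (free_lie (range g))) J6"
    unfolding carrier_free_lie_image
  proof (rule bij_betw_imageI)
    show "inj_on \<Phi> (range (fl_map g))"
      using \<Phi> de f(1) by (auto simp: inj_on_def) (metis injD)
    have "\<Phi> ` range (fl_map g) = fl_map enc ` range (fl_lift f)"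
      by (auto simp: \<Phi> image_image)
    also have "\<dots> = J6"
      unfolding f(2) J6_def lam6_def carrier_L6 by (auto simp: de lam_kernel)
    finally show "\<Phi> ` range (fl_map g) = J6" .
  qed
  then have "\<Phi> \<in> lie_hom (free_lie (range g)) (L6\<lparr>carrier := J6\<rparr>)"
    by (auto simp: lie_hom_def hom_def \<Phi>_def bij_betw_def)
  then show ?thesis
    unfolding is_free_lie_def lie_isomorphic_def
    using \<open>bij_betw \<Phi> (carrier (free_lie (range g))) J6\<close> by auto
qed

text \<open>An element of \<open>gr(M\<^sub>3)\<close> is sent to its fibre under \<open>lam6\<close>, which is a coset of \<open>J6\<close>.\<close>

lemma gr3_presentation: "lie_isomorphic gr3 (lie_quotient L6 J6)"
proof -
  define \<Phi> where "\<Phi> x = {u \<in> carrier L6. lam6 u = x}" for x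
  have J: "J6 \<lhd> L6"
    using J6_ideal L6.normal_iff_subgroup unfolding lie_ideal_def by blast
  interpret J: normal J6 L6 by (rule J)
  have coset: "J6 #>\<^bsub>L6\<^esub> u = \<Phi> (lam6 u)" if u: "u \<in> carrier L6" for u
  proof -
    have "v \<in> J6 #>\<^bsub>L6\<^esub> u \<longleftrightarrow> v \<in> \<Phi> (lam6 u)" if v: "v \<in> carrier L6" for v
    proof -
      have "v \<in> J6 #>\<^bsub>L6\<^esub> u \<longleftrightarrow> v - u \<in> J6"
        using J.rcos_module[OF L6.is_group u v] u by (simp add: inv_L6)
      also have "\<dots> \<longleftrightarrow> lam (fl_map dec v - fl_map dec u) = one gr3"
      proof -
        have "v - u \<in> carrier L6"
          using L6_closed(3)[OF v L6_closed(4)[OF u]] by (simp only: add_uminus_conv_diff)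
        then show ?thesis by (simp only: J6_def lam6_def mem_Collect_eq fl_map_simps(6) simp_thms)
      qed
      also have "\<dots> \<longleftrightarrow> lam6 v = lam6 u"
        unfolding lam6_def by (rule lam_eq_iff[symmetric])
      finally show ?thesis using v by (simp add: \<Phi>_def)
    qed
    moreover have "J6 #>\<^bsub>L6\<^esub> u \<subseteq> carrier L6"
      using u J.subset by (intro L6.r_coset_subset_G) auto
    ultimately show ?thesis by (auto simp: \<Phi>_def)
  qed
  have rep: "\<exists>u\<in>carrier L6. lam6 u = x" if x: "x \<in> carrier gr3" for x
  proof -
    obtain z where "x = lam z" using lam_surj[OF x] by blast
    moreover have "fl_map dec (fl_map enc z) = z" by (rule fl_map_inverse) (rule dec_enc)
    ultimately show ?thesis
      unfolding carrier_L6 lam6_def by (intro bexI[of _ "fl_map enc z"]) auto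
  qed
  have "\<Phi> \<in> lie_hom gr3 (lie_quotient L6 J6)"
    unfolding lie_hom_def
  proof (intro CollectI conjI ballI homI)
    fix x assume "x \<in> carrier gr3"
    then obtain u where "u \<in> carrier L6" "lam6 u = x" using rep by blast
    then show "\<Phi> x \<in> carrier (lie_quotient L6 J6)"
      by (auto simp: lie_quotient_def carrier_FactGroup coset intro!: image_eqI[of _ _ u])
  next
    fix x y assume "x \<in> carrier gr3" "y \<in> carrier gr3"
    then obtain u v where uv: "u \<in> carrier L6" "lam6 u = x" "v \<in> carrier L6" "lam6 v = y" using rep by metis
    have "\<Phi> x <#>\<^bsub>L6\<^esub> \<Phi> y = J6 #>\<^bsub>L6\<^esub> (u \<otimes>\<^bsub>L6\<^esub> v)"
      using J.rcos_sum[of u v] uv by (simp add: coset)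
    then show "\<Phi> (x \<otimes>\<^bsub>gr3\<^esub> y) = \<Phi> x \<otimes>\<^bsub>lie_quotient L6 J6\<^esub> \<Phi> y"
      using uv L6_closed(3)[of u v] by (simp add: lie_quotient_def coset)
    have "J6 #>\<^bsub>L6\<^esub> bracket L6 a b = \<Phi> (bracket gr3 x y)" if "a \<in> \<Phi> x" "b \<in> \<Phi> y" for a b
      using that L6_closed(5)[of a b] by (simp add: \<Phi>_def coset)
    moreover have "u \<in> \<Phi> x" "v \<in> \<Phi> y" using uv by (auto simp: \<Phi>_def)
    ultimately show "\<Phi> (bracket gr3 x y) = bracket (lie_quotient L6 J6) (\<Phi> x) (\<Phi> y)"
      by (auto simp: lie_quotient_def)
  qed
  moreover have "bij_betw \<Phi> (carrier gr3) (carrier (lie_quotient L6 J6))"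
  proof (rule bij_betw_imageI)
    show "inj_on \<Phi> (carrier gr3)"
    proof (rule inj_onI)
      fix x y assume "x \<in> carrier gr3" "y \<in> carrier gr3" "\<Phi> x = \<Phi> y"
      then show "x = y" using rep[of x] unfolding \<Phi>_def by blast
    qed
    have "carrier (lie_quotient L6 J6) = (\<lambda>u. J6 #>\<^bsub>L6\<^esub> u) ` carrier L6"
      by (simp add: lie_quotient_def carrier_FactGroup)
    also have "\<dots> = \<Phi> ` (lam6 ` carrier L6)" by (auto simp: coset image_image)
    also have "lam6 ` carrier L6 = carrier gr3" using rep by auto
    finally show "\<Phi> ` carrier gr3 = carrier (lie_quotient L6 J6)" by simp
  qed
  ultimately show ?thesis unfolding lie_isomorphic_def by blast
qed

theorem theorem1:
  shows "(torsion_free (associated_graded (mccool_group 3)) \<and>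
          (\<exists>J. lie_ideal J (free_lie {1..6::nat}) \<and>
               is_free_lie ((free_lie {1..6::nat})\<lparr>carrier := J\<rparr>) \<and>
               lie_isomorphic (associated_graded (mccool_group 3))
                 (lie_quotient (free_lie {1..6::nat}) J))) \<and>
         (residually_nilpotent (mccool_group 3) \<and>
          (\<forall>c\<ge>1. torsion_free (lower_central_quotient (mccool_group 3) c)) \<and>
          magnus_group (mccool_group 3))"
  using torsion_free_gr3 J6_ideal J6_free gr3_presentation M3_residually_nilpotent torsion_free_quotient_M3
    M.is_group
  unfolding magnus_group_def gr3_def M3_def L6_def by blast

end
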